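(* Let $\Gamma$ be a finite group and $\Gamma'\subseteq\Gamma$ a subgroup. Let $p$ be a prime that is good for $e_{\Gamma/\Gamma'}$, i.e. $e_{\Gamma/\Gamma'}\in\mathbb{Z}_{(p)}[\Gamma]$ and $e_{\Gamma/\Gamma'}\mathbb{Z}_{(p)}[\Gamma]$ is a maximal $\mathbb{Z}_{(p)}$-order in $e_{\Gamma/\Gamma'}\mathbb{Q}[\Gamma]$. Then for every $\mathfrak{o}$-module $H$ which is a finite $p$-group, there is a unique (up to isomorphism) finite $e_{\Gamma/\Gamma'}\mathbb{Z}_{(p)}[\Gamma]$-module $G$ such that ${}^{\Gamma'}G\cong H$ as $\mathfrak{o}$-modules. Moreover, for this $G$ we have $\operatorname{Aut}_{e_{\Gamma/\Gamma'}\mathbb{Z}_{(p)}[\Gamma]}(G)\cong\operatorname{Aut}_{\mathfrak{o}}(H)$.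
   Context: For a finite group $\Gamma$ and subgroup $\Gamma'$, let $r_{\Gamma/\Gamma'}=\operatorname{Ind}_{\Gamma'}^{\Gamma}1_{\Gamma'}$ and $a_{\Gamma/\Gamma'}=r_{\Gamma/\Gamma'}-1_\Gamma$ (the augmentation character). $e_{\Gamma/\Gamma'}$ is the central idempotent of $\mathbb{Q}[\Gamma]$ associated to $a_{\Gamma/\Gamma'}$: the minimal central idempotent of $\mathbb{Q}[\Gamma]$ acting as the identity on a $\mathbb{Q}$-representation of $\Gamma$ with character $a_{\Gamma/\Gamma'}$. For a central idempotent $e$ and ring $R$, $eR=\{ex:x\in R\}$ is a ring with identity $e$. Let $e_1'=\frac{1}{|\Gamma'|}\sum_{\tau\in\Gamma'}\tau\in\mathbb{Q}[\Gamma]$. For a left $\Gamma$-module $M$, ${}^{\Gamma'}M$ denotes the elements fixed by the left action of $\Gamma'$. Define $\mathfrak{o}={}^{\Gamma'}\big(e_{\Gamma/\Gamma'}\mathbb{Z}_{(p)}[\Gamma]e_1'\big)$, where $e_{\Gamma/\Gamma'}\mathbb{Z}_{(p)}[\Gamma]e_1'=\{xe_1': x\in e_{\Gamma/\Gamma'}\mathbb{Z}_{(p)}[\Gamma]\}\subseteq\mathbb{Q}[\Gamma]$; this is a ring under multiplication in $\mathbb{Q}[\Gamma]$ with identity $e_{\Gamma/\Gamma'}e_1'$. For a finitely generated $e_{\Gamma/\Gamma'}\mathbb{Z}_{(p)}[\Gamma]$-module $G$ (a $\Gamma$-module via $\gamma\mapsto e_{\Gamma/\Gamma'}\gamma$),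 ${}^{\Gamma'}G$ is an $\mathfrak{o}$-module via $(\sigma e_1')\cdot g:=\sigma g$ for $\sigma\in e_{\Gamma/\Gamma'}\mathbb{Z}_{(p)}[\Gamma]$, $g\in{}^{\Gamma'}G$ (this is well defined). *)

theory Defs
  imports
    "HOL-Computational_Algebra.Primes"
    "HOL-Algebra.Bij"
    "HOL-Algebra.Module"
    "HOL-Algebra.Subrings"
    "Jordan_Normal_Form.Matrix"
begin

subsection \<open>Left modules over not necessarily commutative rings\<close>

text \<open>The library locale \<open>module\<close> requires a commutative ring of scalars; this is its analogue
  for an arbitrary ring with identity, using the same record type. As there, the multiplication
  and the unit of the record \<open>M\<close> play no role.\<close>

locale left_module = R?: ring R + M?: abelian_group M
  for R :: "('r, 'x) ring_scheme" (structure) and M :: "('r, 'a, 'y) module_scheme" (structure) +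
  assumes smult_closed: "\<lbrakk>a \<in> carrier R; x \<in> carrier M\<rbrakk> \<Longrightarrow> a \<odot>\<^bsub>M\<^esub> x \<in> carrier M"
    and smult_l_distr: "\<lbrakk>a \<in> carrier R; b \<in> carrier R; x \<in> carrier M\<rbrakk> \<Longrightarrow>
      (a \<oplus>\<^bsub>R\<^esub> b) \<odot>\<^bsub>M\<^esub> x = a \<odot>\<^bsub>M\<^esub> x \<oplus>\<^bsub>M\<^esub> b \<odot>\<^bsub>M\<^esub> x"
    and smult_r_distr: "\<lbrakk>a \<in> carrier R; x \<in> carrier M; y \<in> carrier M\<rbrakk> \<Longrightarrow>
      a \<odot>\<^bsub>M\<^esub> (x \<oplus>\<^bsub>M\<^esub> y) = a \<odot>\<^bsub>M\<^esub> x \<oplus>\<^bsub>M\<^esub> a \<odot>\<^bsub>M\<^esub> y"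
    and smult_assoc: "\<lbrakk>a \<in> carrier R; b \<in> carrier R; x \<in> carrier M\<rbrakk> \<Longrightarrow>
      (a \<otimes>\<^bsub>R\<^esub> b) \<odot>\<^bsub>M\<^esub> x = a \<odot>\<^bsub>M\<^esub> (b \<odot>\<^bsub>M\<^esub> x)"
    and smult_one: "x \<in> carrier M \<Longrightarrow> \<one>\<^bsub>R\<^esub> \<odot>\<^bsub>M\<^esub> x = x"

definition mod_hom ::
  "('r, 'x) ring_scheme \<Rightarrow> ('r, 'a) module \<Rightarrow> ('r, 'b) module \<Rightarrow> ('a \<Rightarrow> 'b) set" where
  "mod_hom R M N = {h \<in> carrier M \<rightarrow> carrier N.
     (\<forall>x \<in> carrier M. \<forall>y \<in> carrier M. h (x \<oplus>\<^bsub>M\<^esub> y) = h x \<oplus>\<^bsub>N\<^esub> h y) \<and>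
     (\<forall>r \<in> carrier R. \<forall>x \<in> carrier M. h (r \<odot>\<^bsub>M\<^esub> x) = r \<odot>\<^bsub>N\<^esub> h x)}"

definition mod_isomorphic ::
  "('r, 'x) ring_scheme \<Rightarrow> ('r, 'a) module \<Rightarrow> ('r, 'b) module \<Rightarrow> bool" where
  "mod_isomorphic R M N \<longleftrightarrow> (\<exists>h \<in> mod_hom R M N. bij_betw h (carrier M) (carrier N))"

definition mod_Aut :: "('r, 'x) ring_scheme \<Rightarrow> ('r, 'a) module \<Rightarrow> ('a \<Rightarrow> 'a) monoid" where
  "mod_Aut R M = (BijGroup (carrier M))\<lparr>carrier := mod_hom R M M \<inter> Bij (carrier M)\<rparr>"

subsection \<open>Rational group algebras\<close>

text \<open>Elements of \<open>\<rat>[\<Gamma>]\<close> are coefficient functions vanishing outside \<open>carrier \<Gamma>\<close>, so that equality in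
  \<open>\<rat>[\<Gamma>]\<close> is equality of functions. The formula for the product is only meant for finite \<open>\<Gamma>\<close>.\<close>

definition group_alg :: "('g, 'm) monoid_scheme \<Rightarrow> (rat, 'g \<Rightarrow> rat) module" where
  "group_alg \<Gamma> =
    \<lparr>carrier = {f. \<forall>x. x \<notin> carrier \<Gamma> \<longrightarrow> f x = 0},
     mult = (\<lambda>f g x. if x \<in> carrier \<Gamma>
       then (\<Sum>y \<in> carrier \<Gamma>. f y * g (inv\<^bsub>\<Gamma>\<^esub> y \<otimes>\<^bsub>\<Gamma>\<^esub> x)) else 0),
     one = (\<lambda>x. if x = \<one>\<^bsub>\<Gamma>\<^esub> then 1 else 0),
     zero = (\<lambda>x. 0),
     add = (\<lambda>f g x. f x + g x),
     smult = (\<lambda>c f x. c * f x)\<rparr>"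

definition grp_elt :: "'g \<Rightarrow> 'g \<Rightarrow> rat" where
  "grp_elt \<gamma> = (\<lambda>x. if x = \<gamma> then 1 else 0)"

definition Z_loc :: "nat \<Rightarrow> rat set" where
  "Z_loc p = {of_int a / of_int b | a b. \<not> int p dvd b}"

definition loc_group_ring :: "nat \<Rightarrow> ('g, 'm) monoid_scheme \<Rightarrow> ('g \<Rightarrow> rat) set" where
  "loc_group_ring p \<Gamma> = {f \<in> carrier (group_alg \<Gamma>). \<forall>x \<in> carrier \<Gamma>. f x \<in> Z_loc p}"

definition central_idempotent :: "('a, 'x) ring_scheme \<Rightarrow> 'a \<Rightarrow> bool" where
  "central_idempotent A e \<longleftrightarrow> e \<in> carrier A \<and> e \<otimes>\<^bsub>A\<^esub> e = e \<and>
     (\<forall>x \<in> carrier A. e \<otimes>\<^bsub>A\<^esub> x = x \<otimes>\<^bsub>A\<^esub> e)"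

definition corner :: "('a, 'x) ring_scheme \<Rightarrow> 'a \<Rightarrow> 'a set \<Rightarrow> ('a, 'x) ring_scheme" where
  "corner A e R = A\<lparr>carrier := {e \<otimes>\<^bsub>A\<^esub> x | x. x \<in> R}, one := e\<rparr>"

subsection \<open>Representations and characters\<close>

definition is_rep :: "('g, 'm) monoid_scheme \<Rightarrow> nat \<Rightarrow> ('g \<Rightarrow> rat mat) \<Rightarrow> bool" where
  "is_rep \<Gamma> n \<rho> \<longleftrightarrow> (\<forall>g \<in> carrier \<Gamma>. \<rho> g \<in> carrier_mat n n) \<and> \<rho> \<one>\<^bsub>\<Gamma>\<^esub> = 1\<^sub>m n \<and>
     (\<forall>g \<in> carrier \<Gamma>. \<forall>h \<in> carrier \<Gamma>. \<rho> (g \<otimes>\<^bsub>\<Gamma>\<^esub> h) = \<rho> g * \<rho> h)"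

definition rep_char :: "nat \<Rightarrow> ('g \<Rightarrow> rat mat) \<Rightarrow> 'g \<Rightarrow> rat" where
  "rep_char n \<rho> g = (\<Sum>i<n. \<rho> g $$ (i, i))"

definition rep_ext ::
  "('g, 'm) monoid_scheme \<Rightarrow> nat \<Rightarrow> ('g \<Rightarrow> rat mat) \<Rightarrow> ('g \<Rightarrow> rat) \<Rightarrow> rat mat" where
  "rep_ext \<Gamma> n \<rho> f = mat n n (\<lambda>(i, j). \<Sum>g \<in> carrier \<Gamma>. f g * \<rho> g $$ (i, j))"

definition ind_char ::
  "('g, 'm) monoid_scheme \<Rightarrow> 'g set \<Rightarrow> ('g \<Rightarrow> rat) \<Rightarrow> 'g \<Rightarrow> rat" where
  "ind_char \<Gamma> \<Gamma>' \<chi> g = (1 / of_nat (card \<Gamma>')) *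
     (\<Sum>x \<in> {x \<in> carrier \<Gamma>. inv\<^bsub>\<Gamma>\<^esub> x \<otimes>\<^bsub>\<Gamma>\<^esub> g \<otimes>\<^bsub>\<Gamma>\<^esub> x \<in> \<Gamma>'}. \<chi> (inv\<^bsub>\<Gamma>\<^esub> x \<otimes>\<^bsub>\<Gamma>\<^esub> g \<otimes>\<^bsub>\<Gamma>\<^esub> x))"

definition aug_char :: "('g, 'm) monoid_scheme \<Rightarrow> 'g set \<Rightarrow> 'g \<Rightarrow> rat" where
  "aug_char \<Gamma> \<Gamma>' g = ind_char \<Gamma> \<Gamma>' (\<lambda>_. 1) g - 1"

text \<open>Minimality refers to the usual order on idempotents, \<open>f \<le> e\<close> iff \<open>f e = f\<close> (for commuting
  \<open>e\<close> and \<open>f\<close>).\<close>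

definition min_central_idem ::
  "('g, 'm) monoid_scheme \<Rightarrow> nat \<Rightarrow> ('g \<Rightarrow> rat mat) \<Rightarrow> ('g \<Rightarrow> rat) \<Rightarrow> bool" where
  "min_central_idem \<Gamma> n \<rho> e \<longleftrightarrow>
     central_idempotent (group_alg \<Gamma>) e \<and> rep_ext \<Gamma> n \<rho> e = 1\<^sub>m n \<and>
     (\<forall>f. central_idempotent (group_alg \<Gamma>) f \<and> rep_ext \<Gamma> n \<rho> f = 1\<^sub>m n \<and>
        f \<otimes>\<^bsub>group_alg \<Gamma>\<^esub> e = f \<longrightarrow> f = e)"

text \<open>The idempotent does not depend on the chosen representation: an idempotent \<open>e\<close> acts as the
  identity iff \<open>\<Sum>g. e g * \<chi> g = \<chi> 1\<close>, where \<open>\<chi>\<close> is the character. The description is hence unique.\<close>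

definition char_idem :: "('g, 'm) monoid_scheme \<Rightarrow> ('g \<Rightarrow> rat) \<Rightarrow> 'g \<Rightarrow> rat" where
  "char_idem \<Gamma> \<chi> = (THE e. \<exists>n \<rho>. is_rep \<Gamma> n \<rho> \<and>
     (\<forall>g \<in> carrier \<Gamma>. rep_char n \<rho> g = \<chi> g) \<and> min_central_idem \<Gamma> n \<rho> e)"

definition aug_idem :: "('g, 'm) monoid_scheme \<Rightarrow> 'g set \<Rightarrow> 'g \<Rightarrow> rat" where
  "aug_idem \<Gamma> \<Gamma>' = char_idem \<Gamma> (aug_char \<Gamma> \<Gamma>')"

subsection \<open>Orders\<close>

definition scalar_span :: "rat set \<Rightarrow> (rat, 'a) module \<Rightarrow> 'a set \<Rightarrow> 'a set" where
  "scalar_span S A X =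
     {\<Oplus>\<^bsub>A\<^esub>x \<in> Y. c x \<odot>\<^bsub>A\<^esub> x | Y c. finite Y \<and> Y \<subseteq> X \<and> c \<in> Y \<rightarrow> S}"

text \<open>A \<open>\<int>\<^sub>(\<^sub>p\<^sub>)\<close>-order in a \<open>\<rat>\<close>-algebra: a subring with the same identity that is a finitely generated
  \<open>\<int>\<^sub>(\<^sub>p\<^sub>)\<close>-module and spans the algebra over \<open>\<rat>\<close>.\<close>

definition is_order :: "nat \<Rightarrow> (rat, 'a) module \<Rightarrow> 'a set \<Rightarrow> bool" where
  "is_order p A L \<longleftrightarrow> subring L A \<and>
     (\<exists>X. finite X \<and> X \<subseteq> L \<and> L = scalar_span (Z_loc p) A X) \<and>
     scalar_span UNIV A L = carrier A"

definition is_maximal_order :: "nat \<Rightarrow> (rat, 'a) module \<Rightarrow> 'a set \<Rightarrow> bool" where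
  "is_maximal_order p A L \<longleftrightarrow>
     is_order p A L \<and> (\<forall>L'. is_order p A L' \<and> L \<subseteq> L' \<longrightarrow> L' = L)"

definition loc_corner ::
  "('g, 'm) monoid_scheme \<Rightarrow> nat \<Rightarrow> ('g \<Rightarrow> rat) \<Rightarrow> (rat, 'g \<Rightarrow> rat) module" where
  "loc_corner \<Gamma> p e = corner (group_alg \<Gamma>) e (loc_group_ring p \<Gamma>)"

definition good_prime :: "('g, 'm) monoid_scheme \<Rightarrow> nat \<Rightarrow> ('g \<Rightarrow> rat) \<Rightarrow> bool" where
  "good_prime \<Gamma> p e \<longleftrightarrow> e \<in> loc_group_ring p \<Gamma> \<and>
     is_maximal_order p (corner (group_alg \<Gamma>) e (carrier (group_alg \<Gamma>)))
       (carrier (loc_corner \<Gamma> p e))"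

subsection \<open>Invariants under the subgroup\<close>

definition avg_idem :: "'g set \<Rightarrow> 'g \<Rightarrow> rat" where
  "avg_idem \<Gamma>' = (\<lambda>x. if x \<in> \<Gamma>' then 1 / of_nat (card \<Gamma>') else 0)"

definition aug_loc_ring ::
  "('g, 'm) monoid_scheme \<Rightarrow> 'g set \<Rightarrow> nat \<Rightarrow> (rat, 'g \<Rightarrow> rat) module" where
  "aug_loc_ring \<Gamma> \<Gamma>' p = loc_corner \<Gamma> p (aug_idem \<Gamma> \<Gamma>')"

definition inv_order ::
  "('g, 'm) monoid_scheme \<Rightarrow> 'g set \<Rightarrow> nat \<Rightarrow> (rat, 'g \<Rightarrow> rat) module" where
  "inv_order \<Gamma> \<Gamma>' p = (group_alg \<Gamma>)
    \<lparr>carrier := {x. (\<exists>y \<in> carrier (aug_loc_ring \<Gamma> \<Gamma>' p). x = y \<otimes>\<^bsub>group_alg \<Gamma>\<^esub> avg_idem \<Gamma>') \<and>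
       (\<forall>\<tau> \<in> \<Gamma>'. grp_elt \<tau> \<otimes>\<^bsub>group_alg \<Gamma>\<^esub> x = x)},
     one := aug_idem \<Gamma> \<Gamma>' \<otimes>\<^bsub>group_alg \<Gamma>\<^esub> avg_idem \<Gamma>'\<rparr>"

text \<open>The scalar multiplication is \<open>(\<sigma> e\<^sub>1') \<cdot> g = \<sigma> g\<close> for \<open>\<sigma>\<close> in \<open>aug_loc_ring \<Gamma> \<Gamma>' p\<close> and invariant \<open>g\<close>;
  the definite description expresses that the value is independent of the choice of \<open>\<sigma>\<close>.\<close>

definition inv_module ::
  "('g, 'm) monoid_scheme \<Rightarrow> 'g set \<Rightarrow> nat \<Rightarrow> ('g \<Rightarrow> rat, 'a) module \<Rightarrow> ('g \<Rightarrow> rat, 'a) module" where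
  "inv_module \<Gamma> \<Gamma>' p G = G
    \<lparr>carrier := {g \<in> carrier G.
       \<forall>\<tau> \<in> \<Gamma>'. (aug_idem \<Gamma> \<Gamma>' \<otimes>\<^bsub>group_alg \<Gamma>\<^esub> grp_elt \<tau>) \<odot>\<^bsub>G\<^esub> g = g},
     smult := (\<lambda>x g. THE h. \<exists>\<sigma> \<in> carrier (aug_loc_ring \<Gamma> \<Gamma>' p).
       x = \<sigma> \<otimes>\<^bsub>group_alg \<Gamma>\<^esub> avg_idem \<Gamma>' \<and> h = \<sigma> \<odot>\<^bsub>G\<^esub> g)\<rparr>"

definition finite_module_with_invariants ::
  "('g, 'm) monoid_scheme \<Rightarrow> 'g set \<Rightarrow> nat \<Rightarrow> ('g \<Rightarrow> rat, 'h) module \<Rightarrow>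
    ('g \<Rightarrow> rat, 'a) module \<Rightarrow> bool" where
  "finite_module_with_invariants \<Gamma> \<Gamma>' p H G \<longleftrightarrow>
     left_module (aug_loc_ring \<Gamma> \<Gamma>' p) G \<and> finite (carrier G) \<and>
     mod_isomorphic (inv_order \<Gamma> \<Gamma>' p) (inv_module \<Gamma> \<Gamma>' p G) H"

end

theory Submission
  imports
    "HOL-Library.Function_Algebras"
    "HOL-Number_Theory.Cong"
    "Jordan_Normal_Form.Schur_Decomposition"
    Defs
begin

text \<open>Write \<open>R\<close> for \<open>e \<int>\<^sub>(\<^sub>p\<^sub>)[\<Gamma>]\<close>, \<open>u\<close> for \<open>e e\<^sub>1'\<close>, \<open>P\<close> for the lattice \<open>R u\<close>, \<open>Q\<close> for \<open>{y \<in> R. u y = y}\<close>, and \<open>O\<close>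
  for the invariant order \<open>{z \<in> P. u z = z}\<close>, which is the opposite of \<open>End\<^sub>R(P)\<close>. The \<open>\<Gamma>'\<close>-invariants of \<open>G\<close> are \<open>Hom\<^sub>R(P, G)\<close>, so the
  theorem is the Morita equivalence defined by \<open>P\<close>, and it suffices to show \<open>P Q = R\<close> and \<open>Q P = O\<close>.

  The coefficient at the identity is a symmetrizing form for \<open>R\<close>, for which \<open>P\<close> and \<open>Q\<close> are dual lattices.
  The dual of the ideal \<open>P Q\<close> is therefore \<open>{x. x P \<subseteq> P}\<close>, an order containing \<open>R\<close>; by maximality it is \<open>R\<close>, and so
  \<open>P Q = R\<close>. For an overorder \<open>D\<close> of \<open>O\<close>, \<open>P D Q\<close> is an order containing \<open>R\<close>, whence \<open>O\<close> is maximal too.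
  If \<open>Q P\<close> were a proper ideal of \<open>O\<close>, the ideal theory of maximal orders would give \<open>z \<notin> O\<close> with \<open>Q P z \<subseteq> O\<close>, and then
  \<open>P z = P Q P z \<subseteq> P\<close> puts \<open>z\<close> into \<open>O\<close>.

  That \<open>P\<close> involves all simple factors of \<open>e \<rat>[\<Gamma>]\<close> is the statement that \<open>e\<close> lies in the ideal generated by
  \<open>e\<^sub>1'\<close>: the central idempotent generating that ideal acts as the identity on the augmentation representation.\<close>

section \<open>Orders and a Morita context\<close>

text \<open>The difficulty is a prime dividing the order of \<open>\<Gamma>'\<close>: then
  \<open>u\<close> need not lie in \<open>R\<close>. With \<open>u\<close> in \<open>R\<close> one
  would have \<open>Q = u R\<close> and \<open>Q P = u R u = O\<close> at once; in general
  \<open>P\<close>, \<open>Q\<close> and \<open>O\<close> agree with such corners only up to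
  multiplication by natural numbers. Maximality of \<open>R\<close> is used in a bounded form: a
  ring \<open>L\<close> between \<open>R\<close> and \<open>e \<rat>[\<Gamma>]\<close> with
  \<open>m L \<subseteq> R\<close> for some positive \<open>m\<close> equals \<open>R\<close>. Such
  an \<open>L\<close> is finitely generated because the scalars form a discrete valuation ring. The
  scalars are not complete, so no idempotents of the finite ring \<open>O / p O\<close> are lifted.
  Only its ideals and simple quotients are used, and one returns from statements modulo
  \<open>p\<close> to statements about \<open>O\<close> because some power of \<open>p\<close> lies
  in \<open>Q P\<close>. Once \<open>e = sum a_i b_i\<close> with \<open>a_i\<close> in
  \<open>P\<close> and \<open>b_i\<close> in \<open>Q\<close>, the formula
  \<open>g = sum a_i (b_i g)\<close> recovers every element of a module from invariants. It gives
  faithfulness and the extension of homomorphisms; its analogue for \<open>Q\<close> gives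
  finiteness of the inverse construction, which is taken as \<open>Hom\<close> from \<open>Q\<close>
  over \<open>O\<close> so that no tensor product has to be built.\<close>

definition add_closed :: "'a::ab_group_add set \<Rightarrow> bool" where
  "add_closed K \<longleftrightarrow> 0 \<in> K \<and> (\<forall>x\<in>K. \<forall>y\<in>K. x - y \<in> K)"

lemma add_closedI: "0 \<in> K \<Longrightarrow> (\<And>x y. x \<in> K \<Longrightarrow> y \<in> K \<Longrightarrow> x - y \<in> K) \<Longrightarrow> add_closed K"
  by (simp add: add_closed_def)

lemma add_closed_zero: "add_closed K \<Longrightarrow> 0 \<in> K"
  by (simp add: add_closed_def)

lemma add_closed_diff: "add_closed K \<Longrightarrow> x \<in> K \<Longrightarrow> y \<in> K \<Longrightarrow> x - y \<in> K"
  by (simp add: add_closed_def)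

lemma add_closed_uminus: "add_closed K \<Longrightarrow> x \<in> K \<Longrightarrow> - x \<in> K"
  by (metis add_closed_def diff_0)

lemma add_closed_add: "add_closed K \<Longrightarrow> x \<in> K \<Longrightarrow> y \<in> K \<Longrightarrow> x + y \<in> K"
  by (metis add_closed_def diff_0 diff_minus_eq_add)

lemma add_closed_sum:
  "add_closed K \<Longrightarrow> (\<And>i. i \<in> I \<Longrightarrow> f i \<in> K) \<Longrightarrow> sum f I \<in> K"
  by (induction I rule: infinite_finite_induct) (auto simp: add_closed_zero add_closed_add)

definition set_sum :: "'a::ab_group_add set \<Rightarrow> 'a set \<Rightarrow> 'a set" where
  "set_sum X Y = {x + y | x y. x \<in> X \<and> y \<in> Y}"

lemma set_sumI: "x \<in> X \<Longrightarrow> y \<in> Y \<Longrightarrow> x + y \<in> set_sum X Y"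
  by (auto simp: set_sum_def)

lemma set_sumE:
  assumes "z \<in> set_sum X Y"
  obtains x y where "z = x + y" "x \<in> X" "y \<in> Y"
  using assms by (auto simp: set_sum_def)

lemma add_closed_set_sum:
  assumes "add_closed X" "add_closed Y"
  shows "add_closed (set_sum X Y)"
proof (rule add_closedI)
  show "0 \<in> set_sum X Y"
    using set_sumI[OF add_closed_zero[OF assms(1)] add_closed_zero[OF assms(2)]] by simp
next
  fix a b assume "a \<in> set_sum X Y" "b \<in> set_sum X Y"
  then obtain x y x' y' where *: "a = x + y" "b = x' + y'" "x \<in> X" "y \<in> Y" "x' \<in> X" "y' \<in> Y"
    by (auto simp: set_sum_def)
  have "a - b = (x - x') + (y - y')"
    using * by simp
  also have "\<dots> \<in> set_sum X Y"
    using * assms by (intro set_sumI add_closed_diff)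
  finally show "a - b \<in> set_sum X Y" .
qed

lemma set_sum_left: "add_closed Y \<Longrightarrow> X \<subseteq> set_sum X Y"
  using set_sumI[OF _ add_closed_zero] by fastforce

lemma set_sum_right: "add_closed X \<Longrightarrow> Y \<subseteq> set_sum X Y"
  using set_sumI[OF add_closed_zero] by fastforce

lemma set_sum_least: "add_closed Z \<Longrightarrow> X \<subseteq> Z \<Longrightarrow> Y \<subseteq> Z \<Longrightarrow> set_sum X Y \<subseteq> Z"
  by (auto simp: set_sum_def intro!: add_closed_add)

section \<open>Products of additive subgroups in an algebra over the rationals\<close>

locale rat_algebra = vector_space scale
  for scale :: "rat \<Rightarrow> 'a::ab_group_add \<Rightarrow> 'a" +
  fixes mul :: "'a \<Rightarrow> 'a \<Rightarrow> 'a" (infixl \<open>\<star>\<close> 70)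
  assumes mul_assoc: "(x \<star> y) \<star> z = x \<star> (y \<star> z)"
    and mul_add_left: "(x + y) \<star> z = x \<star> z + y \<star> z"
    and mul_add_right: "x \<star> (y + z) = x \<star> y + x \<star> z"
    and mul_scale_left: "scale c x \<star> y = scale c (x \<star> y)"
    and mul_scale_right: "x \<star> scale c y = scale c (x \<star> y)"
begin

lemma mul_zero_left [simp]: "0 \<star> x = 0"
  using mul_scale_left[of 0 x x] by simp

lemma mul_zero_right [simp]: "x \<star> 0 = 0"
  using mul_scale_right[of x 0 x] by simp

lemma mul_minus_left: "(- x) \<star> y = - (x \<star> y)"
  using mul_add_left[of x "- x" y] by (simp add: eq_neg_iff_add_eq_0 add.commute)

lemma mul_minus_right: "x \<star> (- y) = - (x \<star> y)"
  using mul_add_right[of x y "- y"] by (simp add: eq_neg_iff_add_eq_0 add.commute)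

lemma mul_diff_left: "(x - y) \<star> z = x \<star> z - y \<star> z"
  using mul_add_left[of x "- y" z] by (simp add: mul_minus_left)

lemma mul_diff_right: "x \<star> (y - z) = x \<star> y - x \<star> z"
  using mul_add_right[of x y "- z"] by (simp add: mul_minus_right)

lemma mul_sum_left: "sum f I \<star> x = (\<Sum>i\<in>I. f i \<star> x)"
  by (induction I rule: infinite_finite_induct) (auto simp: mul_add_left)

lemma mul_sum_right: "x \<star> sum f I = (\<Sum>i\<in>I. x \<star> f i)"
  by (induction I rule: infinite_finite_induct) (auto simp: mul_add_right)

text \<open>The product of two lattices. Negation is not a constructor: it comes for free as soon as
  \<open>X\<close> is closed under it. Adding one product at a time leaves a single nontrivial case
  in every induction.\<close>

inductive_set span_prod :: "'a set \<Rightarrow> 'a set \<Rightarrow> 'a set" for X Y where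
  zero: "0 \<in> span_prod X Y"
| add: "x \<in> X \<Longrightarrow> y \<in> Y \<Longrightarrow> s \<in> span_prod X Y \<Longrightarrow> x \<star> y + s \<in> span_prod X Y"

lemma span_prod_mul: "x \<in> X \<Longrightarrow> y \<in> Y \<Longrightarrow> x \<star> y \<in> span_prod X Y"
  using span_prod.add[OF _ _ span_prod.zero] by fastforce

lemma span_prod_plus:
  "s \<in> span_prod X Y \<Longrightarrow> t \<in> span_prod X Y \<Longrightarrow> s + t \<in> span_prod X Y"
  by (induction rule: span_prod.induct) (auto simp: add.assoc intro: span_prod.add)

text \<open>Induction for a target that is closed under addition only and need not be a subgroup.
  With the identity as \<open>f\<close> it shows that elements of a product have a property that is
  stable under sums.\<close>

lemma span_prod_image:
  assumes "s \<in> span_prod X Y" "f 0 = 0" "\<And>a b. f (a + b) = f a + f b"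
    and "\<And>x y. x \<in> X \<Longrightarrow> y \<in> Y \<Longrightarrow> f (x \<star> y) \<in> Z" "0 \<in> Z"
    and "\<And>a b. a \<in> Z \<Longrightarrow> b \<in> Z \<Longrightarrow> a + b \<in> Z"
  shows "f s \<in> Z"
  using assms(1) by induction (auto simp: assms)

lemma add_closed_span_prod:
  assumes "add_closed X"
  shows "add_closed (span_prod X Y)"
proof (rule add_closedI)
  have neg: "- s \<in> span_prod X Y" if "s \<in> span_prod X Y" for s
    using that
  proof induction
    case (add x y s)
    have "- (x \<star> y + s) = (- x) \<star> y + (- s)"
      by (simp add: mul_minus_left)
    then show ?case
      using add assms by (metis add_closed_uminus span_prod.add)
  qed (simp add: span_prod.zero)
  show "x - y \<in> span_prod X Y" if "x \<in> span_prod X Y" "y \<in> span_prod X Y" for x y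
    using span_prod_plus[OF that(1) neg[OF that(2)]] by simp
qed (rule span_prod.zero)

lemma span_prod_least:
  assumes "add_closed Z" "\<And>x y. x \<in> X \<Longrightarrow> y \<in> Y \<Longrightarrow> x \<star> y \<in> Z"
  shows "span_prod X Y \<subseteq> Z"
proof
  fix s assume "s \<in> span_prod X Y"
  then show "s \<in> Z"
    by induction (auto intro: assms add_closed_add add_closed_zero)
qed

lemma span_prod_mono: "X \<subseteq> X' \<Longrightarrow> Y \<subseteq> Y' \<Longrightarrow> span_prod X Y \<subseteq> span_prod X' Y'"
proof
  fix s assume "X \<subseteq> X'" "Y \<subseteq> Y'" "s \<in> span_prod X Y"
  from this(3) this(1,2) show "s \<in> span_prod X' Y'"
    by induction (auto intro: span_prod.intros)
qed

lemma span_prod_left: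
  assumes "s \<in> span_prod X Y" "\<And>x. x \<in> X \<Longrightarrow> a \<star> x \<in> X'"
  shows "a \<star> s \<in> span_prod X' Y"
  using assms(1)
  by induction (auto simp: mul_add_right mul_assoc[symmetric] assms intro: span_prod.intros)

lemma span_prod_right:
  assumes "s \<in> span_prod X Y" "\<And>y. y \<in> Y \<Longrightarrow> y \<star> a \<in> Y'"
  shows "s \<star> a \<in> span_prod X Y'"
  using assms(1)
  by induction (auto simp: mul_add_left mul_assoc assms intro: span_prod.intros)

lemma span_prod_assoc_subset: "span_prod (span_prod X Y) Z \<subseteq> span_prod X (span_prod Y Z)"
proof
  fix s assume "s \<in> span_prod (span_prod X Y) Z"
  then show "s \<in> span_prod X (span_prod Y Z)"
  proof induction
    case (add x z s)
    have "x \<star> z \<in> span_prod X (span_prod Y Z)"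
      by (rule span_prod_right[OF add(1)]) (rule span_prod_mul[OF _ add(2)])
    then show ?case using add by (simp add: span_prod_plus)
  qed (rule span_prod.zero)
qed

lemma span_prod_assoc_supset: "span_prod X (span_prod Y Z) \<subseteq> span_prod (span_prod X Y) Z"
proof
  fix s assume "s \<in> span_prod X (span_prod Y Z)"
  then show "s \<in> span_prod (span_prod X Y) Z"
  proof induction
    case (add x y s)
    have "x \<star> y \<in> span_prod (span_prod X Y) Z"
      by (rule span_prod_left[OF add(2)]) (rule span_prod_mul[OF add(1)])
    then show ?case using add by (simp add: span_prod_plus)
  qed (rule span_prod.zero)
qed

lemma span_prod_assoc: "span_prod (span_prod X Y) Z = span_prod X (span_prod Y Z)"
  using span_prod_assoc_subset span_prod_assoc_supset by blast

text \<open>The sum is indexed by numbers rather than by elements, so that a product may occur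
  several times. Applied to \<open>e\<close> in \<open>span_prod P Q\<close> it supplies the
  coordinates used in the module arguments.\<close>

lemma span_prod_sum_repr:
  assumes "s \<in> span_prod X Y"
  obtains n :: nat and a b where "s = (\<Sum>i<n. a i \<star> b i)"
    "\<And>i. i < n \<Longrightarrow> a i \<in> X" "\<And>i. i < n \<Longrightarrow> b i \<in> Y"
proof -
  have "\<exists>n::nat. \<exists>a b. s = (\<Sum>i<n. a i \<star> b i) \<and> (\<forall>i<n. a i \<in> X \<and> b i \<in> Y)"
    using assms
  proof induction
    case zero
    then show ?case by (intro exI[of _ 0]) auto
  next
    case (add x y s)
    then obtain n :: nat and a b where *: "s = (\<Sum>i<n. a i \<star> b i)" "\<forall>i<n. a i \<in> X \<and> b i \<in> Y"
      by blast
    have "(\<Sum>i<n. (a(n := x)) i \<star> (b(n := y)) i) = (\<Sum>i<n. a i \<star> b i)"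
      by (rule sum.cong) auto
    then show ?case
      using * add by (intro exI[of _ "Suc n"] exI[of _ "a(n := x)"] exI[of _ "b(n := y)"])
        (auto simp: add.commute less_Suc_eq)
  qed
  then show ?thesis using that by blast
qed

end


text \<open>The facts about the group ring from which the order theory follows. \<open>B\<close> is
  the algebra \<open>e \<rat>[\<Gamma>]\<close>, and \<open>N\<close> will be the order of
  \<open>\<Gamma>'\<close>. In \<open>maximal\<close> a bound \<open>m\<close> on the denominators
  of \<open>L\<close> stands in for finite generation, as it is easy to check for products of
  lattices. \<open>dual_Q\<close> and \<open>dual_ideal\<close> encode the duality given by the
  symmetrizing form without mentioning the form. \<open>full\<close> says that \<open>P Q\<close>
  spans \<open>B\<close> over the rationals, and \<open>residues_O\<close> that
  \<open>O_u / p O_u\<close> is finite.\<close>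

locale morita_order = rat_algebra scale mul
  for scale :: "rat \<Rightarrow> 'a::ab_group_add \<Rightarrow> 'a" and mul (infixl \<open>\<star>\<close> 70) +
  fixes p :: nat and e u :: 'a and R :: "'a set" and N :: nat
    and B P Q O_u :: "'a set"
  defines "B \<equiv> {x. e \<star> x = x \<and> x \<star> e = x}"
    and "P \<equiv> {r \<star> u | r. r \<in> R}"
    and "Q \<equiv> {y \<in> R. u \<star> y = y}"
    and "O_u \<equiv> {z \<in> P. u \<star> z = z}"
  assumes prime_p: "prime p"
    and add_closed_R: "add_closed R"
    and mul_R: "\<And>x y. x \<in> R \<Longrightarrow> y \<in> R \<Longrightarrow> x \<star> y \<in> R"
    and scale_R: "\<And>c x. c \<in> Z_loc p \<Longrightarrow> x \<in> R \<Longrightarrow> scale c x \<in> R"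
    and e_R: "e \<in> R"
    and R_subset_B: "R \<subseteq> B"
    and u_idem: "u \<star> u = u"
    and u_B: "u \<in> B"
    and N_pos: "N > 0"
    and N_u: "scale (of_nat N) u \<in> R"
    and maximal: "\<And>L m. L \<subseteq> B \<Longrightarrow> R \<subseteq> L \<Longrightarrow> add_closed L \<Longrightarrow>
      (\<And>x y. x \<in> L \<Longrightarrow> y \<in> L \<Longrightarrow> x \<star> y \<in> L) \<Longrightarrow> (m::nat) > 0 \<Longrightarrow>
      (\<And>x. x \<in> L \<Longrightarrow> scale (of_nat m) x \<in> R) \<Longrightarrow> L \<subseteq> R"
    and dual_Q: "\<And>z. z \<in> B \<Longrightarrow> z \<star> u = z \<Longrightarrow> (\<And>y. y \<in> Q \<Longrightarrow> z \<star> y \<in> R) \<Longrightarrow> z \<in> P"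
    and dual_ideal: "\<And>T. T \<subseteq> R \<Longrightarrow> add_closed T \<Longrightarrow> (\<And>t r. t \<in> T \<Longrightarrow> r \<in> R \<Longrightarrow> t \<star> r \<in> T) \<Longrightarrow>
      (\<And>x. x \<in> B \<Longrightarrow> (\<And>t. t \<in> T \<Longrightarrow> x \<star> t \<in> R) \<Longrightarrow> x \<in> R) \<Longrightarrow> e \<in> T"
    and full: "\<exists>m::nat. m > 0 \<and> scale (of_nat m) e \<in> span_prod P Q"
    and residues_O: "\<exists>X. finite X \<and> X \<subseteq> O_u \<and> (\<forall>z\<in>O_u. \<exists>x\<in>X. \<exists>w\<in>O_u. z = x + scale (of_nat p) w)"
begin

section \<open>Closure properties of \<open>R\<close>, \<open>P\<close>, \<open>Q\<close> and
  \<open>O_u\<close>\<close>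

lemma e_left: "x \<in> B \<Longrightarrow> e \<star> x = x" and e_right: "x \<in> B \<Longrightarrow> x \<star> e = x"
  by (auto simp: B_def)

lemma mul_B: "x \<in> B \<Longrightarrow> y \<in> B \<Longrightarrow> x \<star> y \<in> B"
  unfolding B_def by (metis (mono_tags, lifting) mem_Collect_eq mul_assoc)

lemma scale_B: "x \<in> B \<Longrightarrow> scale c x \<in> B"
  by (auto simp: B_def mul_scale_left mul_scale_right)

lemma add_closed_B: "add_closed B"
  by (rule add_closedI) (auto simp: B_def mul_diff_left mul_diff_right)

lemma PI: "r \<in> R \<Longrightarrow> r \<star> u \<in> P"
  by (auto simp: P_def)

lemma P_B: "x \<in> P \<Longrightarrow> x \<in> B"
  using R_subset_B u_B by (auto simp: P_def intro: mul_B)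

lemma P_u: "x \<in> P \<Longrightarrow> x \<star> u = x"
  by (auto simp: P_def mul_assoc u_idem)

lemma u_P: "u \<in> P"
  using PI[OF e_R] e_left[OF u_B] by simp

lemma R_P: "r \<in> R \<Longrightarrow> x \<in> P \<Longrightarrow> r \<star> x \<in> P"
  by (auto simp: P_def mul_assoc[symmetric] intro: mul_R)

lemma add_closed_P: "add_closed P"
proof (rule add_closedI)
  show "0 \<in> P" using PI[OF add_closed_zero[OF add_closed_R]] by simp
  show "x - y \<in> P" if "x \<in> P" "y \<in> P" for x y
  proof -
    obtain r s where "x = r \<star> u" "y = s \<star> u" "r \<in> R" "s \<in> R"
      using \<open>x \<in> P\<close> \<open>y \<in> P\<close> by (auto simp: P_def)
    then show ?thesis
      using PI[of "r - s"] add_closed_diff[OF add_closed_R] by (simp add: mul_diff_left)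
  qed
qed

lemma Q_R: "y \<in> Q \<Longrightarrow> y \<in> R" and Q_u: "y \<in> Q \<Longrightarrow> u \<star> y = y"
  by (auto simp: Q_def)

lemma Q_B: "y \<in> Q \<Longrightarrow> y \<in> B"
  using Q_R R_subset_B by blast

lemma QI: "y \<in> R \<Longrightarrow> u \<star> y = y \<Longrightarrow> y \<in> Q"
  by (auto simp: Q_def)

lemma mul_Q_R: "y \<in> Q \<Longrightarrow> r \<in> R \<Longrightarrow> y \<star> r \<in> Q"
  by (rule QI) (auto simp: mul_R Q_R Q_u mul_assoc[symmetric])

lemma add_closed_Q: "add_closed Q"
  by (rule add_closedI)
    (auto simp: Q_def mul_diff_right add_closed_zero[OF add_closed_R] add_closed_diff[OF add_closed_R])

lemma mul_P_Q: "x \<in> P \<Longrightarrow> y \<in> Q \<Longrightarrow> x \<star> y \<in> R"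
  by (auto simp: P_def mul_assoc Q_u mul_R Q_R)

lemma O_P: "z \<in> O_u \<Longrightarrow> z \<in> P" and O_u_left: "z \<in> O_u \<Longrightarrow> u \<star> z = z"
  by (auto simp: O_u_def)

lemma O_u_right: "z \<in> O_u \<Longrightarrow> z \<star> u = z"
  by (simp add: O_P P_u)

lemma O_B: "z \<in> O_u \<Longrightarrow> z \<in> B"
  using O_P P_B by blast

lemma OI: "z \<in> P \<Longrightarrow> u \<star> z = z \<Longrightarrow> z \<in> O_u"
  by (auto simp: O_u_def)

lemma u_O: "u \<in> O_u"
  by (simp add: OI u_P u_idem)

text \<open>As \<open>u\<close> may lie outside \<open>R\<close>, \<open>r \<star> u\<close> cannot
  be treated as an element of \<open>R\<close>. But \<open>z\<close> absorbs \<open>u\<close> on the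
  left, so \<open>r \<star> u \<star> z = r \<star> z\<close>, which is in \<open>P\<close> because
  \<open>P\<close> is a left \<open>R\<close>-module.\<close>

lemma mul_P_O: "x \<in> P \<Longrightarrow> z \<in> O_u \<Longrightarrow> x \<star> z \<in> P"
  unfolding P_def
proof clarify
  fix r assume r: "r \<in> R" and z: "z \<in> O_u"
  have "r \<star> u \<star> z = r \<star> z" using z by (simp add: mul_assoc O_u_left)
  then show "\<exists>r'. r \<star> u \<star> z = r' \<star> u \<and> r' \<in> R"
    using R_P[OF r O_P[OF z]] by (auto simp: P_def)
qed

lemma mul_O: "x \<in> O_u \<Longrightarrow> z \<in> O_u \<Longrightarrow> x \<star> z \<in> O_u"
  by (rule OI) (auto simp: mul_P_O O_P O_u_left mul_assoc[symmetric])

lemma mul_Q_P: "y \<in> Q \<Longrightarrow> x \<in> P \<Longrightarrow> y \<star> x \<in> O_u"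
  by (rule OI) (auto simp: R_P Q_R Q_u mul_assoc[symmetric])

lemma mul_O_Q: "z \<in> O_u \<Longrightarrow> y \<in> Q \<Longrightarrow> z \<star> y \<in> Q"
  by (rule QI) (auto simp: mul_P_Q O_P O_u_left mul_assoc[symmetric])

lemma add_closed_O: "add_closed O_u"
  by (rule add_closedI)
    (auto simp: O_u_def mul_diff_right add_closed_zero[OF add_closed_P] add_closed_diff[OF add_closed_P])

lemma scale_P: "c \<in> Z_loc p \<Longrightarrow> x \<in> P \<Longrightarrow> scale c x \<in> P"
  unfolding P_def using scale_R by (force simp: mul_scale_left[symmetric])

lemma scale_O: "c \<in> Z_loc p \<Longrightarrow> z \<in> O_u \<Longrightarrow> scale c z \<in> O_u"
  by (simp add: O_u_def scale_P mul_scale_right)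

lemma of_nat_Z_loc: "of_nat n \<in> Z_loc p"
proof -
  have "of_nat n = (of_int (int n) / of_int 1 :: rat)" by simp
  moreover have "\<not> int p dvd 1" using prime_p by auto
  ultimately show ?thesis unfolding Z_loc_def by blast
qed

text \<open>By \<open>dual_ideal\<close> it suffices that every \<open>x\<close> in \<open>B\<close>
  with \<open>x P Q \<subseteq> R\<close> lies in \<open>R\<close>; such an \<open>x\<close> belongs
  to the left order of \<open>P\<close>, to which maximality applies.\<close>

lemma e_span_PQ: "e \<in> span_prod P Q"
proof (rule dual_ideal)
  show "span_prod P Q \<subseteq> R"
    by (rule span_prod_least[OF add_closed_R]) (rule mul_P_Q)
  show "add_closed (span_prod P Q)"
    by (rule add_closed_span_prod[OF add_closed_P])
  show "t \<star> r \<in> span_prod P Q" if "t \<in> span_prod P Q" "r \<in> R" for t r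
    by (rule span_prod_right[OF that(1)]) (rule mul_Q_R[OF _ that(2)])
next
  fix x assume x: "x \<in> B" and xT: "\<And>t. t \<in> span_prod P Q \<Longrightarrow> x \<star> t \<in> R"
  \<comment> \<open>For \<open>y\<close> in \<open>P\<close> the element \<open>x \<star> y\<close>
    carries \<open>Q\<close> into \<open>R\<close>, so the duality of \<open>P\<close> and
    \<open>Q\<close> puts it into \<open>P\<close>.\<close>
  have xP: "x \<star> y \<in> P" if y: "y \<in> P" for y
  proof (rule dual_Q)
    show "x \<star> y \<star> z \<in> R" if "z \<in> Q" for z
      using xT[OF span_prod_mul[OF y that]] by (simp add: mul_assoc)
  qed (use x y in \<open>auto simp: mul_B P_B P_u mul_assoc\<close>)
  define L where "L = {x \<in> B. \<forall>y\<in>P. x \<star> y \<in> P}"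
  obtain m :: nat where m: "m > 0" "scale (of_nat m) e \<in> span_prod P Q"
    using full by blast
  have "L \<subseteq> R"
  proof (rule maximal[OF _ _ _ _ m(1)])
    show "R \<subseteq> L" using R_subset_B R_P by (auto simp: L_def)
    show "add_closed L"
      using add_closed_B add_closed_P
      by (auto simp: L_def add_closed_def mul_diff_left)
    show "a \<star> b \<in> L" if "a \<in> L" "b \<in> L" for a b
      using that by (auto simp: L_def mul_B mul_assoc)
    \<comment> \<open>The left order of \<open>P\<close> is bounded: \<open>m a = a (m e)\<close>
      lies in \<open>(a P) Q\<close>, hence in \<open>P Q \<subseteq> R\<close>.\<close>
    show "scale (of_nat m) a \<in> R" if "a \<in> L" for a
    proof -
      have "a \<star> scale (of_nat m) e \<in> span_prod P Q"
        by (rule span_prod_left[OF m(2)]) (use that in \<open>auto simp: L_def\<close>)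
      then have "a \<star> scale (of_nat m) e \<in> R"
        using span_prod_least[OF add_closed_R mul_P_Q] by blast
      then show ?thesis
        using that by (simp add: L_def mul_scale_right e_right)
    qed
  qed (auto simp: L_def)
  then show "x \<in> R" using x xP by (auto simp: L_def)
qed

text \<open>Maximality of \<open>O_u\<close> in the form needed later. Let \<open>D\<close> be the
  left order of \<open>V\<close>. The product \<open>P D Q\<close> is a ring since
  \<open>Q P \<subseteq> O_u \<subseteq> D\<close>; it contains \<open>R = P Q\<close>, and
  \<open>k\<close> bounds its denominators, so it equals \<open>R\<close>. In particular
  \<open>u z Q = z Q\<close> lies in \<open>R\<close>, and duality puts \<open>z\<close> into
  \<open>P\<close>.\<close>

lemma left_order_ideal:
  assumes V: "V \<subseteq> O_u" "add_closed V"
    and VO: "\<And>v z. v \<in> V \<Longrightarrow> z \<in> O_u \<Longrightarrow> z \<star> v \<in> V"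
    and k: "(k::nat) > 0" "scale (of_nat k) u \<in> V"
    and z: "z \<in> B" "u \<star> z = z" "z \<star> u = z" and zV: "\<And>v. v \<in> V \<Longrightarrow> z \<star> v \<in> V"
  shows "z \<in> O_u"
proof -
  define D where "D = {z \<in> B. u \<star> z = z \<and> z \<star> u = z \<and> (\<forall>v\<in>V. z \<star> v \<in> V)}"
  have D_mul: "a \<star> b \<in> D" if "a \<in> D" "b \<in> D" for a b
    using that mul_B unfolding D_def
    by clarsimp (metis (no_types, lifting) mul_assoc)
  have D_add: "add_closed D"
    using add_closed_B V(2) by (auto simp: D_def add_closed_def mul_diff_left mul_diff_right)
  have O_D: "O_u \<subseteq> D"
    using VO by (auto simp: D_def O_B O_u_left O_u_right)
  define L where "L = span_prod P (span_prod D Q)"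
  have PDQ: "x \<star> (d \<star> y) \<in> L" if "x \<in> P" "d \<in> D" "y \<in> Q" for x d y
    unfolding L_def using that by (intro span_prod_mul)
  have "L \<subseteq> R"
  proof (rule maximal[OF _ _ _ _ k(1)])
    have DQ: "span_prod D Q \<subseteq> B"
      by (rule span_prod_least[OF add_closed_B]) (auto simp: D_def mul_B Q_B)
    show "L \<subseteq> B"
      unfolding L_def by (rule span_prod_least[OF add_closed_B]) (use DQ in \<open>auto simp: mul_B P_B\<close>)
    show "R \<subseteq> L"
    proof
      fix r assume r: "r \<in> R"
      have "r \<star> e \<in> span_prod P (span_prod D Q)"
      proof -
        have "e \<in> span_prod P (span_prod D Q)"
        proof -
          have "Q \<subseteq> span_prod D Q"
          proof
            fix y assume "y \<in> Q"
            then have "u \<star> y \<in> span_prod D Q"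
              using O_D u_O by (intro span_prod_mul) auto
            then show "y \<in> span_prod D Q"
              using \<open>y \<in> Q\<close> by (simp add: Q_u)
          qed
          then show ?thesis using span_prod_mono[OF order_refl] e_span_PQ by blast
        qed
        then show ?thesis by (rule span_prod_left) (rule R_P[OF r])
      qed
      then show "r \<in> L"
        using r R_subset_B by (simp add: L_def e_right subsetD)
    qed
    show L_add: "add_closed L"
      unfolding L_def by (rule add_closed_span_prod[OF add_closed_P])
    show "a \<star> b \<in> L" if "a \<in> L" "b \<in> L" for a b
    proof -
      have "a \<star> b \<in> span_prod P (span_prod D Q)"
      proof (rule span_prod_right)
        show "a \<in> span_prod P (span_prod D Q)" using that L_def by simp
        fix s assume s: "s \<in> span_prod D Q"
        have "s \<star> b \<in> span_prod D (span_prod D Q)"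
        proof (rule span_prod_right[OF s])
          fix y assume y: "y \<in> Q"
          show "y \<star> b \<in> span_prod D Q"
          proof -
            have "y \<star> b \<in> span_prod O_u (span_prod D Q)"
              using that(2) unfolding L_def by (rule span_prod_left) (rule mul_Q_P[OF y])
            moreover have "span_prod O_u (span_prod D Q) \<subseteq> span_prod D Q"
              by (rule span_prod_least[OF add_closed_span_prod[OF D_add]], erule span_prod_left)
                (use D_mul O_D in blast)
            ultimately show ?thesis by blast
          qed
        qed
        moreover have "span_prod D (span_prod D Q) \<subseteq> span_prod D Q"
          by (rule span_prod_least[OF add_closed_span_prod[OF D_add]])
            (auto intro!: span_prod_left D_mul)
        ultimately show "s \<star> b \<in> span_prod D Q" by blast
      qed
      then show ?thesis by (simp add: L_def)
    qed
    show "scale (of_nat k) a \<in> R" if "a \<in> L" for a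
    proof -
      \<comment> \<open>Here \<open>k d = d (k u)\<close>, and \<open>d\<close> maps
        \<open>V\<close>, which contains \<open>k u\<close>, into
        \<open>V \<subseteq> O_u\<close>.\<close>
      have kD: "scale (of_nat k) d \<in> O_u" if "d \<in> D" for d
        using that k(2) V(1) by (force simp: D_def mul_scale_right dest: bspec[of V])
      show ?thesis
      proof (rule span_prod_image[where f = "scale (of_nat k)"])
        show "a \<in> span_prod P (span_prod D Q)" using that by (simp add: L_def)
        fix x s assume x: "x \<in> P" and s: "s \<in> span_prod D Q"
        have "scale (of_nat k) (x \<star> s) = x \<star> scale (of_nat k) s"
          by (simp add: mul_scale_right)
        moreover have "scale (of_nat k) s \<in> Q"
        proof (rule span_prod_image[where f = "scale (of_nat k)", OF s])
          show "scale (of_nat k) (d \<star> y) \<in> Q" if "d \<in> D" "y \<in> Q" for d y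
            using mul_O_Q[OF kD[OF that(1)] that(2)] by (simp add: mul_scale_left)
        qed (auto simp: scale_right_distrib add_closed_Q add_closed_zero add_closed_add)
        ultimately show "scale (of_nat k) (x \<star> s) \<in> R"
          by (simp add: mul_P_Q x)
      qed (auto simp: scale_right_distrib add_closed_R add_closed_zero add_closed_add)
    qed
  qed
  moreover have "z \<in> D" using z zV by (simp add: D_def)
  ultimately have "z \<star> y \<in> R" if "y \<in> Q" for y
    using PDQ[OF u_P \<open>z \<in> D\<close> that] z by (auto simp: mul_assoc[symmetric])
  then have "z \<in> P" using z by (intro dual_Q) auto
  then show ?thesis using z by (simp add: OI)
qed

section \<open>Ideals of \<open>O_u\<close> and the finite quotient
  \<open>O_u / p O_u\<close>\<close>

definition pO :: "'a set" where
  "pO = scale (of_nat p) ` O_u"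

lemma pO_subset: "pO \<subseteq> O_u"
  by (auto simp: pO_def intro: scale_O of_nat_Z_loc)

lemma pO_I: "z \<in> O_u \<Longrightarrow> scale (of_nat p) z \<in> pO"
  unfolding pO_def by (rule imageI)

lemma add_closed_pO: "add_closed pO"
proof (rule add_closedI)
  show "0 \<in> pO"
    unfolding pO_def using add_closed_zero[OF add_closed_O] by (force intro: image_eqI[of _ _ 0])
  show "x - y \<in> pO" if "x \<in> pO" "y \<in> pO" for x y
    using that add_closed_diff[OF add_closed_O]
    by (auto simp: pO_def scale_right_diff_distrib[symmetric])
qed

lemma mul_pO_left: "z \<in> O_u \<Longrightarrow> x \<in> pO \<Longrightarrow> z \<star> x \<in> pO"
  by (auto simp: pO_def mul_scale_right intro: mul_O)

lemma mul_pO_right: "x \<in> pO \<Longrightarrow> z \<in> O_u \<Longrightarrow> x \<star> z \<in> pO"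
  by (auto simp: pO_def mul_scale_left intro: mul_O)

definition left_ideal :: "'a set \<Rightarrow> bool" where
  "left_ideal K \<longleftrightarrow> K \<subseteq> O_u \<and> add_closed K \<and> (\<forall>z\<in>O_u. \<forall>x\<in>K. z \<star> x \<in> K)"

definition two_sided_ideal :: "'a set \<Rightarrow> bool" where
  "two_sided_ideal K \<longleftrightarrow> left_ideal K \<and> (\<forall>z\<in>O_u. \<forall>x\<in>K. x \<star> z \<in> K)"

text \<open>Demanding \<open>pO \<subseteq> M\<close> makes these correspond to the maximal
  two-sided ideals of the finite ring \<open>O_u / p O_u\<close>, so that counting is enough to
  produce them.\<close>

definition maximal_ideal :: "'a set \<Rightarrow> bool" where
  "maximal_ideal M \<longleftrightarrow> two_sided_ideal M \<and> pO \<subseteq> M \<and> M \<noteq> O_u \<and>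
     (\<forall>I. two_sided_ideal I \<and> M \<subseteq> I \<longrightarrow> I = M \<or> I = O_u)"

lemma left_idealD:
  assumes "left_ideal K"
  shows "K \<subseteq> O_u" "add_closed K" "\<And>z x. z \<in> O_u \<Longrightarrow> x \<in> K \<Longrightarrow> z \<star> x \<in> K"
  using assms by (auto simp: left_ideal_def)

lemma two_sided_idealD:
  assumes "two_sided_ideal K"
  shows "left_ideal K" "K \<subseteq> O_u" "add_closed K" "\<And>z x. z \<in> O_u \<Longrightarrow> x \<in> K \<Longrightarrow> z \<star> x \<in> K"
    "\<And>z x. z \<in> O_u \<Longrightarrow> x \<in> K \<Longrightarrow> x \<star> z \<in> K"
  using assms by (auto simp: two_sided_ideal_def left_ideal_def)

lemma two_sided_ideal_eq_O: "two_sided_ideal I \<Longrightarrow> u \<in> I \<Longrightarrow> I = O_u"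
  using two_sided_idealD(2,4)[of I] O_u_right by fastforce

lemma two_sided_ideal_O: "two_sided_ideal O_u"
  by (auto simp: two_sided_ideal_def left_ideal_def add_closed_O mul_O)

lemma two_sided_ideal_pO: "two_sided_ideal pO"
  unfolding two_sided_ideal_def left_ideal_def
  using add_closed_pO mul_pO_left mul_pO_right pO_subset by blast

lemma left_ideal_set_sum: "left_ideal I \<Longrightarrow> left_ideal J \<Longrightarrow> left_ideal (set_sum I J)"
  unfolding left_ideal_def
  using set_sum_least[OF add_closed_O] add_closed_set_sum
  by (auto simp: mul_add_right set_sumI elim!: set_sumE)

lemma two_sided_ideal_set_sum:
  "two_sided_ideal I \<Longrightarrow> two_sided_ideal J \<Longrightarrow> two_sided_ideal (set_sum I J)"
  unfolding two_sided_ideal_def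
  by (auto simp: left_ideal_set_sum mul_add_left set_sumI elim!: set_sumE)

lemma left_ideal_span_prod:
  assumes "two_sided_ideal I" "J \<subseteq> O_u"
  shows "left_ideal (span_prod I J)"
  unfolding left_ideal_def
proof (intro conjI ballI)
  show "span_prod I J \<subseteq> O_u"
    using assms two_sided_idealD(2) by (intro span_prod_least[OF add_closed_O]) (auto intro: mul_O)
  show "add_closed (span_prod I J)"
    by (rule add_closed_span_prod) (use assms two_sided_idealD in auto)
  show "z \<star> x \<in> span_prod I J" if "z \<in> O_u" "x \<in> span_prod I J" for z x
    using that(2) by (rule span_prod_left) (use assms two_sided_idealD that in auto)
qed

lemma two_sided_ideal_span_prod:
  assumes "two_sided_ideal I" "two_sided_ideal J"
  shows "two_sided_ideal (span_prod I J)"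
  unfolding two_sided_ideal_def
proof (intro conjI ballI)
  show "left_ideal (span_prod I J)"
    using assms by (intro left_ideal_span_prod two_sided_idealD)
  show "x \<star> z \<in> span_prod I J" if "z \<in> O_u" "x \<in> span_prod I J" for z x
    using that(2) by (rule span_prod_right) (use assms two_sided_idealD that in auto)
qed

lemma span_prod_subset_left: "two_sided_ideal I \<Longrightarrow> J \<subseteq> O_u \<Longrightarrow> span_prod I J \<subseteq> I"
  by (rule span_prod_least) (auto dest: two_sided_idealD)

lemma span_prod_subset_right: "I \<subseteq> O_u \<Longrightarrow> left_ideal J \<Longrightarrow> span_prod I J \<subseteq> J"
  by (rule span_prod_least) (auto dest: left_idealD)

text \<open>Meets every coset of \<open>pO\<close>, possibly more than once. The number of residues
  inside an ideal containing \<open>pO\<close> serves as a measure of the size of that ideal modulo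
  \<open>pO\<close>.\<close>

definition residue_set :: "'a set" where
  "residue_set = (SOME X. finite X \<and> X \<subseteq> O_u \<and>
     (\<forall>z\<in>O_u. \<exists>x\<in>X. \<exists>w\<in>O_u. z = x + scale (of_nat p) w))"

lemma residue_set:
  shows finite_residue_set: "finite residue_set"
    and residue_set_subset: "residue_set \<subseteq> O_u"
    and residue_setE: "z \<in> O_u \<Longrightarrow> \<exists>x\<in>residue_set. z - x \<in> pO"
proof -
  have *: "finite residue_set \<and> residue_set \<subseteq> O_u \<and>
     (\<forall>z\<in>O_u. \<exists>x\<in>residue_set. \<exists>w\<in>O_u. z = x + scale (of_nat p) w)"
    unfolding residue_set_def by (rule someI_ex) (rule residues_O)
  then show "finite residue_set" "residue_set \<subseteq> O_u" by blast+
  show "\<exists>x\<in>residue_set. z - x \<in> pO" if "z \<in> O_u"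
    using * that pO_I by (metis add_diff_cancel_left')
qed

text \<open>Subtracting a residue from \<open>z\<close> leaves an element of \<open>pO\<close>,
  which both sets contain. So a subgroup between \<open>pO\<close> and \<open>O_u\<close> is
  determined by the residues in it.\<close>

lemma subset_if_residues_subset:
  assumes "pO \<subseteq> K" "add_closed K" "K' \<subseteq> O_u" "pO \<subseteq> K'" "add_closed K'"
    and "K' \<inter> residue_set \<subseteq> K"
  shows "K' \<subseteq> K"
proof
  fix z assume z: "z \<in> K'"
  then obtain x where x: "x \<in> residue_set" "z - x \<in> pO"
    using residue_setE assms(3) by blast
  then have "x \<in> K'" using add_closed_diff[OF assms(5) z, of "z - x"] assms(4) by auto
  then have "x \<in> K" using x assms(6) by blast
  then show "z \<in> K" using add_closed_add[OF assms(2), of x "z - x"] x assms(1) by auto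
qed

lemma card_residues_less:
  assumes "pO \<subseteq> K" "add_closed K" "K \<subset> K'" "K' \<subseteq> O_u" "add_closed K'"
  shows "card (K \<inter> residue_set) < card (K' \<inter> residue_set)"
proof (rule psubset_card_mono)
  show "finite (K' \<inter> residue_set)" using finite_residue_set by simp
  have "\<not> K' \<inter> residue_set \<subseteq> K"
    using subset_if_residues_subset[OF assms(1,2,4) _ assms(5)] assms by blast
  then show "K \<inter> residue_set \<subset> K' \<inter> residue_set" using assms(3) by blast
qed

text \<open>Residue counts are bounded by \<open>card residue_set\<close> and grow strictly along
  proper inclusions, so a member above \<open>K0\<close> with the largest count is maximal. This
  takes the place of Zorn's lemma.\<close>

lemma exists_maximal_below:
  assumes "F K0" "\<And>K. F K \<Longrightarrow> pO \<subseteq> K \<and> K \<subseteq> O_u \<and> add_closed K"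
  shows "\<exists>K. F K \<and> K0 \<subseteq> K \<and> (\<forall>K'. F K' \<and> K \<subseteq> K' \<longrightarrow> K' = K)"
proof -
  have "\<exists>K. (F K \<and> K0 \<subseteq> K) \<and>
      (\<forall>K'. F K' \<and> K0 \<subseteq> K' \<longrightarrow> card (K' \<inter> residue_set) \<le> card (K \<inter> residue_set))"
    using assms(1) card_mono[OF finite_residue_set]
    by (intro ex_has_greatest_nat[of "\<lambda>K. F K \<and> K0 \<subseteq> K" K0 "\<lambda>K. card (K \<inter> residue_set)"
      "Suc (card residue_set)"]) (auto simp: le_SucI le_imp_less_Suc)
  then obtain K where K: "F K" "K0 \<subseteq> K"
    "\<And>K'. F K' \<Longrightarrow> K0 \<subseteq> K' \<Longrightarrow> card (K' \<inter> residue_set) \<le> card (K \<inter> residue_set)" by blast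
  have "K' = K" if "F K'" "K \<subseteq> K'" for K'
    using card_residues_less[of K K'] assms(2)[OF K(1)] assms(2)[OF that(1)] K that
    by (metis linorder_not_less psubsetI subset_trans)
  then show ?thesis using K by blast
qed

text \<open>The annihilator of a simple module \<open>E/K\<close> over a finite ring is a maximal two-sided ideal.
  A two-sided ideal \<open>I\<close> that does not annihilate \<open>E/K\<close> contains an element that fixes any given finite
  list of vectors modulo \<open>K\<close>; this is an interpolation argument as in the density theorem.\<close>

lemma ideal_fixes_simple_quotient:
  assumes E: "left_ideal E" and K: "left_ideal K" "K \<subset> E"
    and simple: "\<And>K'. left_ideal K' \<Longrightarrow> K \<subseteq> K' \<Longrightarrow> K' \<subseteq> E \<Longrightarrow> K' = K \<or> K' = E"
    and I: "two_sided_ideal I" "\<not> (\<forall>x\<in>I. \<forall>v\<in>E. x \<star> v \<in> K)"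
    and Y: "finite Y" "Y \<subseteq> E"
  shows "\<exists>x\<in>I. \<forall>v\<in>Y. x \<star> v - v \<in> K"
  using Y
proof (induction Y)
  case empty
  then show ?case using two_sided_idealD(3)[OF I(1)] by (auto simp: add_closed_def)
next
  case (insert v Y)
  note Kadd = left_idealD(2)[OF K(1)] and Iadd = two_sided_idealD(3)[OF I(1)]
  obtain x where x: "x \<in> I" "\<And>w. w \<in> Y \<Longrightarrow> x \<star> w - w \<in> K"
    using insert by auto
  have v: "v \<in> E" and vO: "v \<in> O_u" and YO: "Y \<subseteq> O_u"
    using insert left_idealD(1)[OF E] by auto
  define L where "L = {z \<in> O_u. \<forall>w\<in>Y. z \<star> w \<in> K}"
  have L: "left_ideal L"
    using add_closed_O Kadd left_idealD(3)[OF K(1)]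
    by (auto simp: L_def left_ideal_def add_closed_def mul_diff_left mul_assoc mul_O)
  show ?case
  proof (cases "\<forall>z\<in>L. z \<star> v \<in> K")
    case True
    \<comment> \<open>\<open>x\<close> fixes \<open>Y\<close> modulo \<open>K\<close>, so
      \<open>x - u\<close> annihilates \<open>Y\<close> and, in this case, also \<open>v\<close>:
      the old \<open>x\<close> already works.\<close>
    have "x - u \<in> L"
      using x YO two_sided_idealD(2)[OF I(1)] u_O O_u_left
      by (auto simp: L_def mul_diff_left add_closed_diff[OF add_closed_O] subset_iff)
    then have "(x - u) \<star> v \<in> K" using True by blast
    then show ?thesis using x vO by (auto simp: mul_diff_left O_u_left)
  next
    case False
    define Lv where "Lv = (\<lambda>z. z \<star> v) ` L"
    have Lv: "left_ideal Lv"
      unfolding left_ideal_def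
    proof (intro conjI ballI)
      show "Lv \<subseteq> O_u" using vO by (auto simp: Lv_def L_def mul_O)
      show "add_closed Lv"
      proof (rule add_closedI)
        show "0 \<in> Lv" unfolding Lv_def
          using add_closed_zero[OF left_idealD(2)[OF L]] by (force intro: image_eqI[of _ _ 0])
        show "a - b \<in> Lv" if "a \<in> Lv" "b \<in> Lv" for a b
          using that add_closed_diff[OF left_idealD(2)[OF L]]
          by (auto simp: Lv_def mul_diff_left[symmetric])
      qed
      show "z \<star> a \<in> Lv" if "z \<in> O_u" "a \<in> Lv" for z a
        using that left_idealD(3)[OF L] by (auto simp: Lv_def mul_assoc[symmetric])
    qed
    have Lv_sub: "Lv \<subseteq> E"
      using left_idealD(3)[OF E] v by (auto simp: Lv_def L_def)
    have sumE: "set_sum X K = E" if "left_ideal X" "X \<subseteq> E" "\<not> X \<subseteq> K" for X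
    proof -
      have "set_sum X K = K \<or> set_sum X K = E"
        using that K by (intro simple left_ideal_set_sum set_sum_least set_sum_right left_idealD(2)[OF E])
          (auto simp: left_idealD(2))
      then show ?thesis using set_sum_left[OF Kadd, of X] that(3) by blast
    qed
    have LvK: "set_sum Lv K = E"
      by (rule sumE[OF Lv Lv_sub]) (use False in \<open>auto simp: Lv_def\<close>)
    have IE: "set_sum (span_prod I E) K = E"
    proof (rule sumE)
      show "left_ideal (span_prod I E)"
        by (rule left_ideal_span_prod[OF I(1) left_idealD(1)[OF E]])
      show "span_prod I E \<subseteq> E"
        by (rule span_prod_subset_right[OF two_sided_idealD(2)[OF I(1)] E])
      show "\<not> span_prod I E \<subseteq> K" using I(2) span_prod_mul by blast
    qed
    \<comment> \<open>Simplicity gives \<open>L v + K = E\<close> and \<open>I E + K = E\<close>, so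
      \<open>E \<subseteq> (I L) v + K\<close>. The correction \<open>y\<close> is taken from
      \<open>I L\<close> because such an element is in \<open>I\<close> and annihilates
      \<open>Y\<close> modulo \<open>K\<close>.\<close>
    define W where "W = {a. \<exists>y\<in>span_prod I L. \<exists>k\<in>K. a = y \<star> v + k}"
    have ILadd: "add_closed (span_prod I L)"
      by (rule add_closed_span_prod[OF Iadd])
    have Wadd: "add_closed W"
    proof (rule add_closedI)
      show "0 \<in> W" unfolding W_def
        using add_closed_zero[OF ILadd] add_closed_zero[OF Kadd] by force
      fix a b assume "a \<in> W" "b \<in> W"
      then obtain y k y' k' where "a = y \<star> v + k" "b = y' \<star> v + k'"
        "y \<in> span_prod I L" "y' \<in> span_prod I L" "k \<in> K" "k' \<in> K" by (auto simp: W_def)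
      moreover from this have "a - b = (y - y') \<star> v + (k - k')" by (simp add: mul_diff_left)
      ultimately show "a - b \<in> W"
        unfolding W_def using add_closed_diff[OF ILadd] add_closed_diff[OF Kadd] by blast
    qed
    have KW: "K \<subseteq> W"
      using add_closed_zero[OF ILadd] by (force simp: W_def)
    have "span_prod I E \<subseteq> W"
    proof (rule span_prod_least[OF Wadd])
      fix i a assume i: "i \<in> I" and a: "a \<in> E"
      then obtain z k where zk: "a = z \<star> v + k" "z \<in> L" "k \<in> K"
        using LvK by (auto simp: Lv_def elim!: set_sumE)
      have "i \<star> a = (i \<star> z) \<star> v + i \<star> k" by (simp add: zk mul_add_right mul_assoc)
      moreover have "i \<star> z \<in> span_prod I L" by (rule span_prod_mul[OF i zk(2)])
      moreover have "i \<star> k \<in> K"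
        using left_idealD(3)[OF K(1)] two_sided_idealD(2)[OF I(1)] i zk(3) by blast
      ultimately show "i \<star> a \<in> W" by (auto simp: W_def)
    qed
    then have EW: "E \<subseteq> W" using IE set_sum_least[OF Wadd _ KW] by blast
    have "x \<star> v \<in> E"
      using left_idealD(3)[OF E _ v] x(1) two_sided_idealD(2)[OF I(1)] by blast
    then have "v - x \<star> v \<in> W" using EW add_closed_diff[OF left_idealD(2)[OF E] v] by blast
    then obtain y k where y: "y \<in> span_prod I L" "k \<in> K" "v - x \<star> v = y \<star> v + k"
      by (auto simp: W_def)
    have yI: "y \<in> I" using y(1) span_prod_subset_left[OF I(1) left_idealD(1)[OF L]] by blast
    have yL: "y \<in> L"
      using y(1) span_prod_subset_right[OF two_sided_idealD(2)[OF I(1)] L] by blast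
    have "(x + y) \<star> w - w \<in> K" if "w \<in> insert v Y" for w
    proof (cases "w = v")
      case True
      have "(x + y) \<star> v - v = - k"
        using y(3) by (simp add: mul_add_left algebra_simps)
      then show ?thesis using True y(2) add_closed_uminus[OF Kadd] by simp
    next
      case False
      then have w: "w \<in> Y" using that by simp
      have "(x + y) \<star> w - w = (x \<star> w - w) + y \<star> w" by (simp add: mul_add_left)
      also have "\<dots> \<in> K" using x(2)[OF w] yL w by (intro add_closed_add[OF Kadd]) (auto simp: L_def)
      finally show ?thesis .
    qed
    then show ?thesis using add_closed_add[OF Iadd x(1) yI] by blast
  qed
qed

text \<open>Choose \<open>K\<close> maximal among the left ideals that contain \<open>pO\<close> and
  lie strictly below \<open>E + pO\<close>, and let \<open>C\<close> be the annihilator of the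
  simple quotient. Then \<open>C E \<subseteq> K\<close>, which makes the ideal drop. An ideal
  strictly larger than \<open>C\<close> contains an element acting as the identity on the quotient,
  and hence contains \<open>u\<close>.\<close>

lemma exists_maximal_ideal_shrinking:
  assumes E: "two_sided_ideal E" and nE: "\<not> E \<subseteq> pO"
  shows "\<exists>C. maximal_ideal C \<and> set_sum (span_prod C E) pO \<subset> set_sum E pO"
proof -
  define E' where "E' = set_sum E pO"
  have E': "two_sided_ideal E'"
    unfolding E'_def by (rule two_sided_ideal_set_sum[OF E two_sided_ideal_pO])
  have pE': "pO \<subseteq> E'" and EE': "E \<subseteq> E'"
    using set_sum_right[OF two_sided_idealD(3)[OF E]] set_sum_left[OF add_closed_pO]
    by (auto simp: E'_def)
  define F where "F K \<longleftrightarrow> left_ideal K \<and> pO \<subseteq> K \<and> K \<subset> E'" for K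
  have "\<exists>K. F K \<and> pO \<subseteq> K \<and> (\<forall>K'. F K' \<and> K \<subseteq> K' \<longrightarrow> K' = K)"
  proof (rule exists_maximal_below)
    show "F pO" using pE' EE' nE two_sided_idealD(1)[OF two_sided_ideal_pO] by (auto simp: F_def)
    show "\<And>K. F K \<Longrightarrow> pO \<subseteq> K \<and> K \<subseteq> O_u \<and> add_closed K"
      by (auto simp: F_def left_ideal_def)
  qed
  then obtain K where FK: "F K" and max': "\<forall>K'. F K' \<and> K \<subseteq> K' \<longrightarrow> K' = K" by (elim exE conjE)
  have max: "K' = K" if "F K'" "K \<subseteq> K'" for K' using max' that by simp
  have K: "left_ideal K" "pO \<subseteq> K" "K \<subset> E'" using FK by (auto simp: F_def)
  define C where "C = {z \<in> O_u. \<forall>v\<in>E'. z \<star> v \<in> K}"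
  have C: "two_sided_ideal C"
    using add_closed_O left_idealD[OF K(1)] two_sided_idealD[OF E']
    by (auto simp: C_def two_sided_ideal_def left_ideal_def add_closed_def mul_diff_left mul_assoc mul_O)
  have "maximal_ideal C"
    unfolding maximal_ideal_def
  proof (intro conjI allI impI)
    show "pO \<subseteq> C"
      using pO_subset K(2) two_sided_idealD(2)[OF E'] mul_pO_right by (force simp: C_def)
    have "u \<notin> C"
    proof
      assume "u \<in> C"
      then have "E' \<subseteq> K" using two_sided_idealD(2)[OF E'] O_u_left by (force simp: C_def)
      then show False using K(3) by blast
    qed
    then show "C \<noteq> O_u" using u_O by blast
    fix I assume I: "two_sided_ideal I \<and> C \<subseteq> I"
    show "I = C \<or> I = O_u"
    proof (cases "I \<subseteq> C")
      case False
      \<comment> \<open>Interpolation handles only finitely many vectors. The residues in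
        \<open>E'\<close> suffice, because \<open>(x - u) \<star> (v - w)\<close> is in
        \<open>pO \<subseteq> K\<close> whenever \<open>v - w\<close> is in
        \<open>pO\<close>.\<close>
      have "\<exists>x\<in>I. \<forall>v\<in>E' \<inter> residue_set. x \<star> v - v \<in> K"
      proof (rule ideal_fixes_simple_quotient[OF _ K(1,3)])
        show "left_ideal E'" by (rule two_sided_idealD(1)[OF E'])
        show "K' = K \<or> K' = E'" if "left_ideal K'" "K \<subseteq> K'" "K' \<subseteq> E'" for K'
          using max[of K'] that K by (auto simp: F_def)
        show "two_sided_ideal I" using I by blast
        show "\<not> (\<forall>x\<in>I. \<forall>v\<in>E'. x \<star> v \<in> K)"
          using False two_sided_idealD(2) I by (auto simp: C_def)
      qed (use finite_residue_set in auto)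
      then obtain x where x: "x \<in> I" "\<And>v. v \<in> E' \<Longrightarrow> v \<in> residue_set \<Longrightarrow> x \<star> v - v \<in> K"
        by blast
      have xO: "x \<in> O_u" using x(1) I two_sided_idealD(2) by blast
      have xuO: "x - u \<in> O_u" by (rule add_closed_diff[OF add_closed_O xO u_O])
      have "(x - u) \<star> v \<in> K" if v: "v \<in> E'" for v
      proof -
        have vO: "v \<in> O_u" using v two_sided_idealD(2)[OF E'] by blast
        obtain w where w: "w \<in> residue_set" "v - w \<in> pO" using residue_setE[OF vO] by blast
        have wE: "w \<in> E'"
          using add_closed_diff[OF two_sided_idealD(3)[OF E'] v, of "v - w"] w pE' by auto
        have wO: "w \<in> O_u" using w residue_set_subset by blast
        have "(x - u) \<star> w \<in> K"
          using x(2)[OF wE w(1)] by (simp add: mul_diff_left O_u_left[OF wO])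
        moreover have "(x - u) \<star> (v - w) \<in> K"
          using mul_pO_left[OF xuO w(2)] K(2) by blast
        ultimately show ?thesis
          using add_closed_add[OF left_idealD(2)[OF K(1)]] by (fastforce simp: mul_diff_right)
      qed
      then have "x - u \<in> I" using xuO I by (auto simp: C_def)
      then have "u \<in> I" using add_closed_diff[of I x "x - u"] x(1) I two_sided_idealD(3) by auto
      then show ?thesis using I two_sided_ideal_eq_O by blast
    qed (use I in blast)
  qed (rule C)
  moreover have "set_sum (span_prod C E) pO \<subseteq> K"
    using EE' by (intro set_sum_least span_prod_least left_idealD(2)[OF K(1)] K(2)) (auto simp: C_def)
  ultimately show ?thesis
    using K(3) unfolding E'_def by (intro exI[of _ C] conjI) (assumption, rule subset_psubset_trans)
qed

primrec ideal_prod :: "'a set list \<Rightarrow> 'a set" where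
  "ideal_prod [] = O_u"
| "ideal_prod (M # Ms) = span_prod M (ideal_prod Ms)"

lemma two_sided_ideal_prod: "list_all two_sided_ideal Ms \<Longrightarrow> two_sided_ideal (ideal_prod Ms)"
  by (induction Ms) (auto simp: two_sided_ideal_O two_sided_ideal_span_prod)

lemma span_prod_O_left:
  assumes "left_ideal I"
  shows "span_prod O_u I = I"
proof
  show "span_prod O_u I \<subseteq> I" by (rule span_prod_subset_right[OF order_refl assms])
  show "I \<subseteq> span_prod O_u I"
    using span_prod_mul[OF u_O, of _ I] O_u_left left_idealD(1)[OF assms] by (metis subset_iff)
qed

lemma ideal_prod_append:
  "list_all two_sided_ideal Ns \<Longrightarrow> ideal_prod (Ms @ Ns) = span_prod (ideal_prod Ms) (ideal_prod Ns)"
  by (induction Ms)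
    (auto simp: span_prod_O_left two_sided_ideal_prod two_sided_idealD(1) span_prod_assoc)

text \<open>Each factor contributes \<open>p u\<close>. Products of maximal ideals thus have full
  rank, as \<open>left_order_ideal\<close> requires.\<close>

lemma power_u_in_ideal_prod:
  assumes "list_all maximal_ideal Ms"
  shows "scale (of_nat (p ^ length Ms)) u \<in> ideal_prod Ms"
  using assms
proof (induction Ms)
  case (Cons M Ms)
  then have "scale (of_nat p) u \<star> scale (of_nat (p ^ length Ms)) u \<in> span_prod M (ideal_prod Ms)"
    using pO_I[OF u_O] by (intro span_prod_mul) (auto simp: maximal_ideal_def)
  then show ?case by (simp add: mul_scale_left mul_scale_right u_idem mult.commute)
qed (simp add: u_O)

lemma maximal_ideal_two_sided: "list_all maximal_ideal Ms \<Longrightarrow> list_all two_sided_ideal Ms"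
  by (auto simp: list_all_iff maximal_ideal_def)

text \<open>The annihilators of the composition factors of \<open>O_u / p O_u\<close>, multiplied in
  the right order, annihilate it. The induction peels off one factor \<open>C\<close> at a time: a
  product that works for \<open>C E\<close> works for \<open>E\<close> once \<open>C\<close> is
  appended.\<close>

lemma exists_ideal_prod_subset_pO:
  "\<exists>Ms. list_all maximal_ideal Ms \<and> ideal_prod Ms \<subseteq> pO"
proof -
  have "\<exists>Ms. list_all maximal_ideal Ms \<and> span_prod (ideal_prod Ms) E \<subseteq> pO"
    if "two_sided_ideal E" for E
    using that
  proof (induction "card (set_sum E pO \<inter> residue_set)" arbitrary: E rule: less_induct)
    case less
    show ?case
    proof (cases "E \<subseteq> pO")
      case True
      then show ?thesis
        using span_prod_O_left two_sided_idealD(1)[OF less(2)] by (intro exI[of _ "[]"]) auto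
    next
      case False
      then obtain C where C: "maximal_ideal C" "set_sum (span_prod C E) pO \<subset> set_sum E pO"
        using exists_maximal_ideal_shrinking[OF less(2)] by blast
      have C': "two_sided_ideal C" using C by (simp add: maximal_ideal_def)
      have CE: "two_sided_ideal (span_prod C E)"
        by (rule two_sided_ideal_span_prod[OF C' less(2)])
      have "card (set_sum (span_prod C E) pO \<inter> residue_set) < card (set_sum E pO \<inter> residue_set)"
        using C(2) two_sided_idealD(2,3) two_sided_ideal_set_sum[OF CE two_sided_ideal_pO]
          two_sided_ideal_set_sum[OF less(2) two_sided_ideal_pO] two_sided_idealD(3)[OF CE]
        by (intro card_residues_less set_sum_right) auto
      from less(1)[OF this CE] obtain Ms where
        Ms: "list_all maximal_ideal Ms" "span_prod (ideal_prod Ms) (span_prod C E) \<subseteq> pO" by blast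
      have CO: "span_prod C O_u = C"
      proof
        show "span_prod C O_u \<subseteq> C" by (rule span_prod_subset_left[OF C' order_refl])
        show "C \<subseteq> span_prod C O_u"
          using span_prod_mul[OF _ u_O, of _ C] O_u_right two_sided_idealD(2)[OF C'] by (metis subset_iff)
      qed
      have "ideal_prod (Ms @ [C]) = span_prod (ideal_prod Ms) C"
        using C' CO by (subst ideal_prod_append) auto
      then show ?thesis
        using Ms C by (intro exI[of _ "Ms @ [C]"]) (auto simp: span_prod_assoc)
    qed
  qed
  from this[OF two_sided_ideal_O] obtain Ms where
    Ms: "list_all maximal_ideal Ms" "span_prod (ideal_prod Ms) O_u \<subseteq> pO" by blast
  have "ideal_prod Ms \<subseteq> span_prod (ideal_prod Ms) O_u"
  proof
    fix x assume x: "x \<in> ideal_prod Ms"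
    then have "x \<in> O_u"
      using two_sided_idealD(2)[OF two_sided_ideal_prod[OF maximal_ideal_two_sided[OF Ms(1)]]] by blast
    then show "x \<in> span_prod (ideal_prod Ms) O_u"
      using span_prod_mul[OF x u_O] O_u_right by simp
  qed
  then show ?thesis using Ms by blast
qed

text \<open>Since \<open>I + M = O_u\<close>, one can write \<open>u = i + m\<close>; then
  \<open>j = i j + m j\<close> has both summands in \<open>M\<close>.\<close>

lemma maximal_ideal_prime:
  assumes M: "maximal_ideal M" and I: "two_sided_ideal I" and J: "left_ideal J"
    and IJ: "span_prod I J \<subseteq> M" and nI: "\<not> I \<subseteq> M"
  shows "J \<subseteq> M"
proof
  fix j assume j: "j \<in> J"
  have M': "two_sided_ideal M" using M by (simp add: maximal_ideal_def)
  have "two_sided_ideal (set_sum I M)" "M \<subseteq> set_sum I M" "I \<subseteq> set_sum I M"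
    by (rule two_sided_ideal_set_sum[OF I M'], rule set_sum_right[OF two_sided_idealD(3)[OF I]],
      rule set_sum_left[OF two_sided_idealD(3)[OF M']])
  then have "set_sum I M = O_u" using M nI unfolding maximal_ideal_def by blast
  then obtain i m where im: "u = i + m" "i \<in> I" "m \<in> M" using u_O by (auto elim!: set_sumE)
  have "j \<in> O_u" using j left_idealD(1)[OF J] by blast
  then have "j = i \<star> j + m \<star> j" by (metis O_u_left im(1) mul_add_left)
  also have "\<dots> \<in> M"
    using span_prod_mul[OF im(2) j] IJ two_sided_idealD(5)[OF M' \<open>j \<in> O_u\<close> im(3)]
    by (intro add_closed_add two_sided_idealD(3)[OF M']) auto
  finally show "j \<in> M" .
qed

text \<open>By primeness \<open>M\<close> contains one of the factors, and that factor is itself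
  maximal.\<close>

lemma maximal_ideal_mem_if_prod_subset:
  assumes M: "maximal_ideal M" and "list_all maximal_ideal Ms" "ideal_prod Ms \<subseteq> M"
  shows "M \<in> set Ms"
  using assms(2,3)
proof (induction Ms)
  case Nil
  then show ?case using M u_O two_sided_ideal_eq_O by (auto simp: maximal_ideal_def)
next
  case (Cons C Ms)
  have M': "two_sided_ideal M" "M \<noteq> O_u" using M by (auto simp: maximal_ideal_def)
  show ?case
  proof (cases "C \<subseteq> M")
    case True
    then have "M = C" using Cons M' unfolding maximal_ideal_def by auto
    then show ?thesis by simp
  next
    case False
    have "ideal_prod Ms \<subseteq> M"
    proof (rule maximal_ideal_prime[OF M _ _ _ False])
      show "two_sided_ideal C" using Cons by (simp add: maximal_ideal_def)
      show "left_ideal (ideal_prod Ms)"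
        using two_sided_idealD(1) two_sided_ideal_prod maximal_ideal_two_sided Cons by auto
    qed (use Cons in simp)
    then show ?thesis using Cons by simp
  qed
qed

section \<open>The trace ideal \<open>Q P\<close> of \<open>O_u\<close>\<close>

lemma two_sided_ideal_QP: "two_sided_ideal (span_prod Q P)"
  unfolding two_sided_ideal_def left_ideal_def
proof (intro conjI ballI)
  show "span_prod Q P \<subseteq> O_u" by (rule span_prod_least[OF add_closed_O mul_Q_P])
  show "add_closed (span_prod Q P)" by (rule add_closed_span_prod[OF add_closed_Q])
  show "z \<star> x \<in> span_prod Q P" if "z \<in> O_u" "x \<in> span_prod Q P" for z x
    using that(2) by (rule span_prod_left) (rule mul_O_Q[OF that(1)])
  show "x \<star> z \<in> span_prod Q P" if "z \<in> O_u" "x \<in> span_prod Q P" for z x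
    using that(2) by (rule span_prod_right) (rule mul_P_O[OF _ that(1)])
qed

text \<open>Expand the middle \<open>e\<close> of \<open>(N u) e (N u)\<close> as
  \<open>sum a_i b_i\<close>. Each \<open>(N u) a_i (N u)\<close> is in \<open>Q\<close> and each
  \<open>b_i u\<close> in \<open>P\<close>. One factor \<open>N\<close> is spent on the
  \<open>u\<close> to the left of \<open>a_i\<close>, the other on turning \<open>a_i\<close> into
  an element of \<open>R\<close>.\<close>

lemma N_square_u: "scale (of_nat (N * N)) u \<in> span_prod Q P"
proof -
  obtain n :: nat and a b where ab: "e = (\<Sum>i<n. a i \<star> b i)"
    "\<And>i. i < n \<Longrightarrow> a i \<in> P" "\<And>i. i < n \<Longrightarrow> b i \<in> Q"
    by (rule span_prod_sum_repr[OF e_span_PQ]) blast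
  let ?Nu = "scale (of_nat N) u"
  have N: "x \<star> ?Nu \<in> R" if "x \<in> P" for x
  proof -
    obtain r where "x = r \<star> u" "r \<in> R" using \<open>x \<in> P\<close> by (auto simp: P_def)
    then show ?thesis using mul_R[OF _ N_u] by (simp add: mul_scale_right mul_assoc u_idem)
  qed
  have "?Nu \<star> (a i \<star> ?Nu) \<in> Q" if "i < n" for i
    by (rule QI, rule mul_R[OF N_u N[OF ab(2)[OF that]]])
      (simp add: mul_scale_left mul_scale_right mul_assoc[symmetric] u_idem)
  then have "(\<Sum>i<n. (?Nu \<star> (a i \<star> ?Nu)) \<star> (b i \<star> u)) \<in> span_prod Q P"
    using ab PI Q_R by (intro add_closed_sum two_sided_idealD(3)[OF two_sided_ideal_QP] span_prod_mul) auto
  also have "(\<Sum>i<n. (?Nu \<star> (a i \<star> ?Nu)) \<star> (b i \<star> u))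
      = (\<Sum>i<n. ?Nu \<star> ((a i \<star> b i) \<star> ?Nu))"
  proof (rule sum.cong)
    fix i assume "i \<in> {..<n}"
    then have "a i \<star> u = a i" using ab P_u by auto
    then have "a i \<star> (u \<star> (b i \<star> u)) = a i \<star> (b i \<star> u)" by (metis mul_assoc)
    then show "(?Nu \<star> (a i \<star> ?Nu)) \<star> (b i \<star> u) = ?Nu \<star> ((a i \<star> b i) \<star> ?Nu)"
      by (simp add: mul_scale_left mul_scale_right mul_assoc)
  qed simp
  also have "\<dots> = ?Nu \<star> (e \<star> ?Nu)"
    by (simp add: ab(1) mul_sum_left mul_sum_right)
  also have "\<dots> = scale (of_nat (N * N)) u"
    using e_left[OF u_B] by (simp add: mul_scale_left mul_scale_right u_idem)
  finally show ?thesis .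
qed

text \<open>The part of \<open>N * N\<close> prime to \<open>p\<close> is invertible in
  \<open>Z_loc p\<close>.\<close>

lemma power_u_QP: "\<exists>k. scale (of_nat (p ^ k)) u \<in> span_prod Q P"
proof -
  have "N * N \<noteq> 0" using N_pos by simp
  then obtain m where m: "N * N = p ^ multiplicity p (N * N) * m" "\<not> p dvd m"
    using multiplicity_decompose'[of "N * N" p] prime_p not_prime_unit by metis
  define k where "k = multiplicity p (N * N)"
  have c: "1 / of_nat m \<in> Z_loc p"
  proof -
    have "1 / of_nat m = (of_int 1 / of_int (int m) :: rat)" by simp
    moreover have "\<not> int p dvd int m" using m(2) by simp
    ultimately show ?thesis unfolding Z_loc_def by blast
  qed
  have m0: "m \<noteq> 0" using m(2) by (metis dvd_0_right)
  have "scale (1 / of_nat m) u \<star> scale (of_nat (N * N)) u \<in> span_prod Q P"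
    by (rule two_sided_idealD(4)[OF two_sided_ideal_QP scale_O[OF c u_O] N_square_u])
  moreover have "1 / of_nat m * (of_nat (N * N) :: rat) = of_nat (p ^ k)"
  proof -
    have "(of_nat (N * N) :: rat) = of_nat (p ^ k) * of_nat m"
      using m(1) unfolding k_def by (metis of_nat_mult)
    then show ?thesis using m0 by simp
  qed
  ultimately have "scale (of_nat (p ^ k)) u \<in> span_prod Q P"
    by (simp add: mul_scale_left mul_scale_right u_idem del: of_nat_mult of_nat_power)
  then show ?thesis by blast
qed

text \<open>Nakayama's lemma by hand: iterating \<open>O_u = Q P + p O_u\<close> writes
  \<open>u\<close> as an element of \<open>Q P\<close> plus \<open>p^k w\<close> for every
  \<open>k\<close>, and for a suitable \<open>k\<close> the second summand lies in
  \<open>Q P\<close> by \<open>power_u_QP\<close>.\<close>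

lemma u_in_span_QP_if_mod_p:
  assumes "set_sum (span_prod Q P) pO = O_u"
  shows "u \<in> span_prod Q P"
proof -
  define U where "U = span_prod Q P"
  note U = two_sided_idealD[OF two_sided_ideal_QP, folded U_def]
  have step: "\<exists>x\<in>U. \<exists>w\<in>O_u. u = x + scale (of_nat (p ^ k)) w" for k
  proof (induction k)
    case 0
    show ?case using add_closed_zero[OF U(3)] u_O by (intro bexI[of _ 0] bexI[of _ u]) auto
  next
    case (Suc k)
    then obtain x w where xw: "x \<in> U" "w \<in> O_u" "u = x + scale (of_nat (p ^ k)) w" by blast
    obtain y w' where yw: "y \<in> U" "w' \<in> O_u" "w = y + scale (of_nat p) w'"
    proof -
      have "w \<in> set_sum U pO" using assms xw(2) by (simp add: U_def)
      then show thesis using that by (auto simp: pO_def elim!: set_sumE)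
    qed
    have "scale (of_nat (p ^ k)) u \<star> y \<in> U"
      by (rule U(4)[OF scale_O[OF of_nat_Z_loc u_O] yw(1)])
    then have "scale (of_nat (p ^ k)) y \<in> U"
      using yw(1) U(2) O_u_left by (auto simp: mul_scale_left)
    then have "x + scale (of_nat (p ^ k)) y \<in> U" using xw(1) by (rule add_closed_add[OF U(3), rotated])
    moreover have "u = (x + scale (of_nat (p ^ k)) y) + scale (of_nat (p ^ Suc k)) w'"
      using xw(3) yw(3) by (simp add: scale_right_distrib add.assoc mult.commute)
    ultimately show ?case using yw(2) by blast
  qed
  obtain k where k: "scale (of_nat (p ^ k)) u \<in> U" using power_u_QP by (auto simp: U_def)
  obtain x w where xw: "x \<in> U" "w \<in> O_u" "u = x + scale (of_nat (p ^ k)) w" using step by blast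
  have "scale (of_nat (p ^ k)) u \<star> w \<in> U" by (rule U(5)[OF xw(2) k])
  then have "scale (of_nat (p ^ k)) w \<in> U" using xw(2) by (simp add: mul_scale_left O_u_left)
  then have "x + scale (of_nat (p ^ k)) w \<in> U" by (rule add_closed_add[OF U(3) xw(1)])
  then show ?thesis using xw(3) by (simp add: U_def)
qed

text \<open>If \<open>span_prod Q P\<close> lay in a maximal ideal \<open>M\<close> of \<open>O_u\<close>, choose a shortest product of maximal
  ideals inside \<open>p O_u\<close>. It has a factor \<open>M\<close>, say it is \<open>X M Y\<close>, and then \<open>Y X\<close> is not inside \<open>p O_u\<close>. Since the left order
  of \<open>M Y\<close> is \<open>O_u\<close>, any \<open>z = y x / p\<close> satisfies \<open>M z \<subseteq> O_u\<close>, hence \<open>P z = P Q P z \<subseteq> P\<close> and \<open>z \<in> O_u\<close>.\<close>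

lemma u_span_QP: "u \<in> span_prod Q P"
proof (rule ccontr)
  assume "u \<notin> span_prod Q P"
  \<comment> \<open>\<open>Q P\<close> itself need not contain \<open>pO\<close>; adding it allows a
    maximal ideal above \<open>U\<close> to be found by counting residues.\<close>
  define U where "U = set_sum (span_prod Q P) pO"
  have U: "two_sided_ideal U" and pU: "pO \<subseteq> U" and QPU: "span_prod Q P \<subseteq> U"
    unfolding U_def
    using two_sided_ideal_set_sum[OF two_sided_ideal_QP two_sided_ideal_pO]
      set_sum_right[OF two_sided_idealD(3)[OF two_sided_ideal_QP]] set_sum_left[OF add_closed_pO]
    by blast+
  have "U \<noteq> O_u" using u_in_span_QP_if_mod_p \<open>u \<notin> _\<close> by (auto simp: U_def)
  define F where "F I \<longleftrightarrow> two_sided_ideal I \<and> pO \<subseteq> I \<and> I \<noteq> O_u" for I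
  have "\<exists>M. F M \<and> U \<subseteq> M \<and> (\<forall>M'. F M' \<and> M \<subseteq> M' \<longrightarrow> M' = M)"
  proof (rule exists_maximal_below)
    show "F U" using U pU \<open>U \<noteq> O_u\<close> by (simp add: F_def)
    show "\<And>K. F K \<Longrightarrow> pO \<subseteq> K \<and> K \<subseteq> O_u \<and> add_closed K"
      using two_sided_idealD(2,3) by (simp add: F_def)
  qed
  then obtain M where FM: "F M" and UM: "U \<subseteq> M" and max: "\<forall>M'. F M' \<and> M \<subseteq> M' \<longrightarrow> M' = M"
    by (elim exE conjE)
  have M: "maximal_ideal M"
    unfolding maximal_ideal_def
  proof (intro conjI allI impI)
    fix I assume I: "two_sided_ideal I \<and> M \<subseteq> I"
    then have "F I \<or> I = O_u" using FM by (auto simp: F_def)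
    then show "I = M \<or> I = O_u" using max I by (elim disjE) simp_all
  qed (use FM in \<open>simp_all add: F_def\<close>)
  have M2: "two_sided_ideal M" and pM: "pO \<subseteq> M" using FM by (simp_all add: F_def)
  have "\<exists>Ms. (list_all maximal_ideal Ms \<and> ideal_prod Ms \<subseteq> pO) \<and>
      (\<forall>Ns. list_all maximal_ideal Ns \<and> ideal_prod Ns \<subseteq> pO \<longrightarrow> length Ms \<le> length Ns)"
    using exists_ideal_prod_subset_pO
    by (elim exE) (rule ex_has_least_nat[of "\<lambda>Ms. list_all maximal_ideal Ms \<and> ideal_prod Ms \<subseteq> pO" _ length])
  then obtain Ms where Ms: "list_all maximal_ideal Ms" "ideal_prod Ms \<subseteq> pO"
    and least: "\<And>Ns. list_all maximal_ideal Ns \<Longrightarrow> ideal_prod Ns \<subseteq> pO \<Longrightarrow> length Ms \<le> length Ns"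
    by meson
  have "M \<in> set Ms"
    by (rule maximal_ideal_mem_if_prod_subset[OF M Ms(1)]) (use Ms(2) pM in blast)
  then obtain xs ys where split: "Ms = xs @ M # ys" by (meson split_list)
  define X Y V where "X = ideal_prod xs" and "Y = ideal_prod ys" and "V = span_prod M Y"
  have lists: "list_all maximal_ideal xs" "list_all maximal_ideal ys" "list_all maximal_ideal (M # ys)"
    using Ms(1) split M by auto
  have X: "two_sided_ideal X" and Y: "two_sided_ideal Y"
    unfolding X_def Y_def using lists by (simp_all add: two_sided_ideal_prod maximal_ideal_two_sided)
  have V: "two_sided_ideal V" unfolding V_def by (rule two_sided_ideal_span_prod[OF M2 Y])
  have XV: "span_prod X V \<subseteq> pO"
    using Ms(2) ideal_prod_append[of "M # ys" xs] maximal_ideal_two_sided[OF lists(3)]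
    by (simp add: split X_def Y_def V_def)
  \<comment> \<open>The product \<open>Y X\<close> has one factor less than the shortest product
    inside \<open>pO\<close>, so some \<open>y \<star> x\<close> lies outside \<open>pO\<close>;
    divided by \<open>p\<close> it becomes \<open>z\<close>.\<close>
  have "\<not> ideal_prod (ys @ xs) \<subseteq> pO"
    using least[of "ys @ xs"] lists split by auto
  then have YX: "\<not> span_prod Y X \<subseteq> pO"
    using ideal_prod_append[of xs ys] maximal_ideal_two_sided[OF lists(1)] by (simp add: X_def Y_def)
  have "\<exists>y\<in>Y. \<exists>x\<in>X. y \<star> x \<notin> pO"
    using YX span_prod_least[OF add_closed_pO, of Y X] by blast
  then obtain x y where xy: "x \<in> X" "y \<in> Y" "y \<star> x \<notin> pO" by blast
  have xO: "x \<in> O_u" and yO: "y \<in> O_u" using xy X Y two_sided_idealD(2) by blast+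
  have p0: "of_nat p \<noteq> (0::rat)" using prime_p by auto
  define z where "z = scale (1 / of_nat p) (y \<star> x)"
  have zB: "z \<in> B" and uz: "u \<star> z = z" and zu: "z \<star> u = z"
    using mul_O[OF yO xO] by (auto simp: z_def O_B scale_B mul_scale_left mul_scale_right O_u_left O_u_right)
  have pz: "scale (of_nat p) z = y \<star> x" using p0 by (simp add: z_def)
  have Mz: "m \<star> z \<in> O_u" if m: "m \<in> M" for m
  proof (rule left_order_ideal[of V "p ^ Suc (length ys)"])
    have mO: "m \<in> O_u" using m M2 two_sided_idealD(2) by blast
    have my: "m \<star> y \<in> V" unfolding V_def by (rule span_prod_mul[OF m xy(2)])
    show "V \<subseteq> O_u" "add_closed V" using V two_sided_idealD by blast+
    show "w \<star> v \<in> V" if "v \<in> V" "w \<in> O_u" for v w using V two_sided_idealD(4) that by blast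
    show "p ^ Suc (length ys) > 0" using prime_p by (simp add: prime_gt_0_nat)
    show "scale (of_nat (p ^ Suc (length ys))) u \<in> V"
      using power_u_in_ideal_prod[OF lists(3)] by (simp add: V_def Y_def)
    show "m \<star> z \<in> B" by (rule mul_B[OF O_B[OF mO] zB])
    show "u \<star> (m \<star> z) = m \<star> z" "m \<star> z \<star> u = m \<star> z"
      using O_u_left[OF mO] zu by (metis mul_assoc)+
    fix v assume v: "v \<in> V"
    have "x \<star> v \<in> pO" using XV span_prod_mul[OF xy(1) v] by blast
    then obtain w where w: "w \<in> O_u" "x \<star> v = scale (of_nat p) w" by (auto simp: pO_def)
    \<comment> \<open>Since \<open>X V \<subseteq> pO\<close>, the factor \<open>x \<star> v\<close>
      cancels the denominator of \<open>z\<close>.\<close>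
    have "m \<star> z \<star> v = scale (1 / of_nat p) ((m \<star> y) \<star> (x \<star> v))"
      by (simp add: z_def mul_scale_left mul_scale_right mul_assoc)
    also have "\<dots> = (m \<star> y) \<star> w" using p0 by (simp add: w mul_scale_right)
    also have "\<dots> \<in> V" by (rule two_sided_idealD(5)[OF V w(1) my])
    finally show "m \<star> z \<star> v \<in> V" .
  qed
  have QPz: "s \<star> z \<in> O_u" if "s \<in> span_prod Q P" for s
    using Mz that QPU UM by blast
  have "u \<star> z \<in> P"
  proof -
    obtain n :: nat and a b where ab: "e = (\<Sum>i<n. a i \<star> b i)"
      "\<And>i. i < n \<Longrightarrow> a i \<in> P" "\<And>i. i < n \<Longrightarrow> b i \<in> Q"
      by (rule span_prod_sum_repr[OF e_span_PQ]) blast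
    have "u \<star> z = e \<star> (u \<star> z)" using e_left[OF zB] uz by simp
    also have "\<dots> = (\<Sum>i<n. a i \<star> ((b i \<star> u) \<star> z))"
      by (simp add: ab(1) mul_sum_left mul_assoc)
    also have "\<dots> \<in> P"
      using ab u_P by (intro add_closed_sum[OF add_closed_P] mul_P_O QPz span_prod_mul) auto
    finally show ?thesis .
  qed
  then have "z \<in> O_u" using uz by (simp add: OI)
  then have "scale (of_nat p) z \<in> pO" by (rule pO_I)
  then show False using xy(3) by (simp add: pz)
qed

end

section \<open>Idempotents of rational group algebras\<close>

text \<open>Gram-Schmidt, one coordinate at a time. It works over the rationals because the standard
  form is positive definite, so the norm \<open>n\<close> by which one divides is nonzero.\<close>

lemma orthogonal_projection_exists:
  fixes W :: "('g \<Rightarrow> rat) set"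
  assumes "finite X" and "\<And>w x. w \<in> W \<Longrightarrow> x \<notin> X \<Longrightarrow> w x = 0"
    and "0 \<in> W" "\<And>a b c. a \<in> W \<Longrightarrow> b \<in> W \<Longrightarrow> (\<lambda>x. a x + c * b x) \<in> W"
  shows "\<exists>w\<in>W. \<forall>w'\<in>W. (\<Sum>x\<in>X. (v x - w x) * w' x) = 0"
  using assms
proof (induction X arbitrary: W v)
  case empty
  then show ?case by auto
next
  case (insert y X)
  define W0 where "W0 = {w \<in> W. w y = 0}"
  have IH: "\<exists>w\<in>W0. \<forall>w'\<in>W0. (\<Sum>x\<in>X. (v x - w x) * w' x) = 0" for v
  proof (rule insert.IH)
    show "w x = 0" if "w \<in> W0" "x \<notin> X" for w x
      using that insert.prems(1)[of w x] by (cases "x = y") (auto simp: W0_def)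
    show "(\<lambda>x. a x + c * b x) \<in> W0" if "a \<in> W0" "b \<in> W0" for a b c
      using that insert.prems(3)[of a b c] by (auto simp: W0_def)
  qed (use insert.prems(2) in \<open>auto simp: W0_def\<close>)
  have W0_sum: "(\<Sum>x\<in>insert y X. f x * w x) = (\<Sum>x\<in>X. f x * w x)" if "w \<in> W0" for f w
    using insert.hyps that by (simp add: W0_def)
  obtain w0 where w0: "w0 \<in> W0" "\<And>w'. w' \<in> W0 \<Longrightarrow> (\<Sum>x\<in>insert y X. (v x - w0 x) * w' x) = 0"
    using IH[of v] W0_sum by metis
  show ?case
  proof (cases "\<exists>w\<in>W. w y \<noteq> 0")
    case False
    then have "W0 = W" by (auto simp: W0_def)
    then show ?thesis using w0 by auto
  next
    case True
    then obtain w1 where w1: "w1 \<in> W" "w1 y \<noteq> 0" by blast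
    obtain t where t: "t \<in> W0" "\<And>w'. w' \<in> W0 \<Longrightarrow> (\<Sum>x\<in>insert y X. (w1 x - t x) * w' x) = 0"
      using IH[of w1] W0_sum by metis
    \<comment> \<open>\<open>w2\<close> is the part of \<open>w1\<close> orthogonal to
      \<open>W0\<close>. Every \<open>w'\<close> in \<open>W\<close> differs from an element of
      \<open>W0\<close> by a multiple of \<open>w2\<close>, found by comparing the values at
      \<open>y\<close>.\<close>
    define w2 where "w2 = (\<lambda>x. w1 x + (- 1) * t x)"
    have w2: "w2 \<in> W" unfolding w2_def
      using w1 t by (intro insert.prems(3)) (auto simp: W0_def)
    have w2y: "w2 y \<noteq> 0" using w1 t by (simp add: w2_def W0_def)
    have w2_orth: "(\<Sum>x\<in>insert y X. w2 x * w' x) = 0" if "w' \<in> W0" for w'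
      using t(2)[OF that] by (simp add: w2_def)
    define n where "n = (\<Sum>x\<in>insert y X. w2 x * w2 x)"
    have n: "n \<noteq> 0"
    proof -
      have "w2 y * w2 y \<le> n" unfolding n_def
        using insert.hyps by (intro member_le_sum) auto
      moreover have "w2 y * w2 y > 0" using w2y by (metis not_square_less_zero linorder_neqE_linordered_idom mult_eq_0_iff)
      ultimately show ?thesis by linarith
    qed
    define c where "c = (\<Sum>x\<in>insert y X. v x * w2 x) / n"
    have w0W: "w0 \<in> W" using w0 by (simp add: W0_def)
    have "(\<Sum>x\<in>insert y X. (v x - (w0 x + c * w2 x)) * w' x) = 0" if w': "w' \<in> W" for w'
    proof -
      define d where "d = w' y / w2 y"
      define w'' where "w'' = (\<lambda>x. w' x + (- d) * w2 x)"
      have w''W: "w'' \<in> W" unfolding w''_def by (rule insert.prems(3)[OF w' w2])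
      then have w'': "w'' \<in> W0" using w2y by (simp add: W0_def w''_def d_def)
      have eq: "w' = (\<lambda>x. w'' x + d * w2 x)" by (auto simp: w''_def)
      have 1: "(\<Sum>x\<in>insert y X. (v x - (w0 x + c * w2 x)) * w'' x) = 0"
        using w0(2)[OF w''] w2_orth[OF w'']
        by (simp add: ring_distribs sum.distrib sum_subtractf mult.assoc sum_distrib_left[symmetric] del: sum.insert)
      have "(\<Sum>x\<in>insert y X. w0 x * w2 x) = 0"
        using w2_orth[OF w0(1)] by (simp add: mult.commute del: sum.insert)
      then have 2: "(\<Sum>x\<in>insert y X. (v x - (w0 x + c * w2 x)) * w2 x) = 0"
      proof -
        have "(\<Sum>x\<in>insert y X. (v x - (w0 x + c * w2 x)) * w2 x)
            = (\<Sum>x\<in>insert y X. v x * w2 x) - (\<Sum>x\<in>insert y X. w0 x * w2 x) - c * n"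
          unfolding n_def sum_distrib_left sum_subtractf[symmetric]
          by (rule sum.cong) (auto simp: algebra_simps)
        moreover have "c * n = (\<Sum>x\<in>insert y X. v x * w2 x)" using n by (simp add: c_def)
        ultimately show ?thesis using \<open>(\<Sum>x\<in>insert y X. w0 x * w2 x) = 0\<close> by linarith
      qed
      have "(\<Sum>x\<in>insert y X. (v x - (w0 x + c * w2 x)) * w' x)
          = (\<Sum>x\<in>insert y X. (v x - (w0 x + c * w2 x)) * w'' x)
            + d * (\<Sum>x\<in>insert y X. (v x - (w0 x + c * w2 x)) * w2 x)"
        unfolding eq sum_distrib_left sum.distrib[symmetric]
        by (rule sum.cong) (auto simp: algebra_simps)
      then show ?thesis using 1 2 by simp
    qed
    moreover have "(\<lambda>x. w0 x + c * w2 x) \<in> W" by (rule insert.prems(3)[OF w0W w2])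
    ultimately show ?thesis by (intro bexI[of _ "\<lambda>x. w0 x + c * w2 x"]) auto
  qed
qed

lemma sum_apply: "(sum f I :: 'a \<Rightarrow> 'b::comm_monoid_add) x = (\<Sum>i\<in>I. f i x)"
  by (induction I rule: infinite_finite_induct) auto

text \<open>The diagonal entries are \<open>0\<close> or \<open>1\<close>, so in characteristic zero
  a vanishing trace makes all of them vanish. What remains is strictly upper triangular, and
  \<open>B = B * B\<close> kills its entries by induction on the distance from the diagonal.\<close>

lemma idempotent_upper_triangular_eq_zero:
  fixes B :: "complex mat"
  assumes B: "B \<in> carrier_mat n n" "upper_triangular B" "B * B = B"
    and tr: "(\<Sum>i<n. B $$ (i, i)) = 0"
  shows "B = 0\<^sub>m n n"
proof -
  have ent: "B $$ (i, j) = (\<Sum>k<n. B $$ (i, k) * B $$ (k, j))" if "i < n" "j < n" for i j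
  proof -
    have "B $$ (i, j) = (B * B) $$ (i, j)" using B by simp
    also have "\<dots> = (\<Sum>k<n. B $$ (i, k) * B $$ (k, j))"
      using B(1) that by (auto simp: scalar_prod_def atLeast0LessThan intro!: sum.cong)
    finally show ?thesis .
  qed
  have low: "B $$ (i, j) = 0" if "j < i" "i < n" for i j
    using B that by (auto simp: upper_triangular_def)
  have diag_idem: "B $$ (i, i) = 0 \<or> B $$ (i, i) = 1" if "i < n" for i
  proof -
    have "B $$ (i, i) = (\<Sum>k\<in>{i}. B $$ (i, k) * B $$ (k, i))"
      unfolding ent[OF that that]
      by (rule sum.mono_neutral_right) (use low that in \<open>auto, metis linorder_neqE_nat\<close>)
    then show ?thesis by auto
  qed
  have diag: "B $$ (i, i) = 0" if "i < n" for i
  proof -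
    have "(\<Sum>i<n. Re (B $$ (i, i))) = 0" using tr by (metis Re_sum zero_complex.sel(1))
    moreover have "\<And>i. i \<in> {..<n} \<Longrightarrow> 0 \<le> Re (B $$ (i, i))" using diag_idem by fastforce
    ultimately have "Re (B $$ (i, i)) = 0" using that by (subst (asm) sum_nonneg_eq_0_iff) auto
    then show ?thesis using diag_idem[OF that] by auto
  qed
  have "B $$ (i, j) = 0" if "i < n" "j < n" for i j
    using that
  proof (induction "j - i" arbitrary: i j rule: less_induct)
    case less
    have "B $$ (i, k) * B $$ (k, j) = 0" if "k < n" for k
    proof (cases "k \<le> i \<or> j \<le> k")
      case True
      then show ?thesis using low[of k i] low[of j k] diag that less.prems
        by (metis le_neq_implies_less mult_eq_0_iff)
    next
      case False
      then have "k - i < j - i" by linarith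
      then show ?thesis using less.hyps[of k i] that less.prems by simp
    qed
    then have "(\<Sum>k<n. B $$ (i, k) * B $$ (k, j)) = 0" by (intro sum.neutral) auto
    then show ?case using ent[OF less.prems] by simp
  qed
  then show ?thesis using B(1) by (intro eq_matI) auto
qed

lemma trace_mult_comm:
  fixes A :: "'a::comm_semiring_0 mat"
  assumes "A \<in> carrier_mat n m" "B \<in> carrier_mat m n"
  shows "(\<Sum>i<n. (A * B) $$ (i, i)) = (\<Sum>i<m. (B * A) $$ (i, i))"
proof -
  have "(\<Sum>i<n. (A * B) $$ (i, i)) = (\<Sum>i<n. \<Sum>j<m. A $$ (i, j) * B $$ (j, i))"
    using assms by (auto simp: scalar_prod_def atLeast0LessThan intro!: sum.cong)
  also have "\<dots> = (\<Sum>j<m. \<Sum>i<n. A $$ (i, j) * B $$ (j, i))" by (rule sum.swap)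
  also have "\<dots> = (\<Sum>i<m. (B * A) $$ (i, i))"
    using assms by (auto simp: scalar_prod_def atLeast0LessThan mult.commute intro!: sum.cong)
  finally show ?thesis .
qed

text \<open>Over the complex numbers the matrix is similar to an upper triangular one, which is
  again idempotent and has the same trace.\<close>

lemma idempotent_trace_zero:
  fixes A :: "complex mat"
  assumes A: "A \<in> carrier_mat n n" "A * A = A" and tr: "(\<Sum>i<n. A $$ (i, i)) = 0"
  shows "A = 0\<^sub>m n n"
proof -
  obtain as where "char_poly A = (\<Prod>a\<leftarrow>as. [:- a, 1:])" using char_poly_factorized[OF A(1)] by blast
  then obtain B where B: "B \<in> carrier_mat n n" "upper_triangular B" "similar_mat A B"
    using schur_decomposition_exists[OF A(1)] by blast
  then obtain S T where "similar_mat_wit A B S T" by (auto simp: similar_mat_def)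
  then have ST: "S \<in> carrier_mat n n" "T \<in> carrier_mat n n" "S * T = 1\<^sub>m n" "T * S = 1\<^sub>m n"
    "A = S * B * T"
    using A(1) by (auto simp: similar_mat_wit_def Let_def)
  have "T * (S * B) = B" using assoc_mult_mat[OF ST(2) ST(1) B(1)] ST(4) B(1) by simp
  then have B_eq: "B = T * A * S"
    using ST B(1) by (simp add: ST(5) assoc_mult_mat[of _ n n _ n _ n])
  have "B * B = T * A * (S * T) * A * S"
    unfolding B_eq using ST(1,2) A(1) by (simp add: assoc_mult_mat[of _ n n _ n _ n])
  also have "\<dots> = T * (A * A) * S"
    using ST A(1) by (simp add: assoc_mult_mat[of _ n n _ n _ n])
  finally have "B * B = B" using A(2) B_eq by simp
  moreover have "(\<Sum>i<n. B $$ (i, i)) = 0"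
  proof -
    have "(\<Sum>i<n. B $$ (i, i)) = (\<Sum>i<n. (T * (A * S)) $$ (i, i))"
      using ST A(1) B_eq by (simp add: assoc_mult_mat[of _ n n _ n _ n])
    also have "\<dots> = (\<Sum>i<n. (A * S * T) $$ (i, i))"
      by (rule trace_mult_comm) (use ST A(1) in auto)
    also have "A * S * T = A" using ST A(1) by (simp add: assoc_mult_mat[of _ n n _ n _ n])
    finally show ?thesis using tr by simp
  qed
  ultimately have "B = 0\<^sub>m n n" using idempotent_upper_triangular_eq_zero B by blast
  then show ?thesis using ST by simp
qed

text \<open>The complementary idempotent has trace zero. This is what makes acting as the identity
  visible from the character alone.\<close>

lemma idempotent_trace_eq_dim:
  fixes A :: "rat mat"
  assumes A: "A \<in> carrier_mat n n" "A * A = A" and tr: "(\<Sum>i<n. A $$ (i, i)) = of_nat n"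
  shows "A = 1\<^sub>m n"
proof -
  define C where "C = 1\<^sub>m n - A"
  define D where "D = map_mat (of_rat :: rat \<Rightarrow> complex) C"
  have C: "C \<in> carrier_mat n n" and D: "D \<in> carrier_mat n n" using A by (auto simp: C_def D_def)
  have "C * C = C"
  proof -
    have "C * C = (1\<^sub>m n - A) * 1\<^sub>m n - (1\<^sub>m n - A) * A"
      unfolding C_def using A by (intro mult_minus_distrib_mat) auto
    also have "(1\<^sub>m n - A) * A = 1\<^sub>m n * A - A * A"
      using A by (intro minus_mult_distrib_mat) auto
    also have "\<dots> = 0\<^sub>m n n"
      using A(1) by (simp add: A(2) left_mult_one_mat[OF A(1)] minus_r_inv_mat[OF A(1)])
    finally show ?thesis using A by (auto simp: C_def)
  qed
  then have "D * D = D" unfolding D_def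
    by (metis C of_rat_hom.mat_hom_mult)
  moreover have "(\<Sum>i<n. D $$ (i, i)) = 0"
  proof -
    have "(\<Sum>i<n. D $$ (i, i)) = of_rat (\<Sum>i<n. C $$ (i, i))"
      using C by (simp add: D_def of_rat_sum)
    also have "(\<Sum>i<n. C $$ (i, i)) = 0" using A tr by (simp add: C_def sum_subtractf)
    finally show ?thesis by simp
  qed
  ultimately have D0: "D = 0\<^sub>m n n" by (rule idempotent_trace_zero[OF D])
  have "A $$ (i, j) = 1\<^sub>m n $$ (i, j)" if ij: "i < n" "j < n" for i j
  proof -
    have "of_rat (C $$ (i, j)) = D $$ (i, j)" using C ij by (simp add: D_def)
    then have "C $$ (i, j) = 0" using D0 ij by simp
    then show ?thesis using A ij by (simp add: C_def)
  qed
  then show ?thesis using A by (intro eq_matI) auto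
qed


section \<open>The group algebra as an algebra of functions\<close>

locale finite_group = group \<Gamma> for \<Gamma> :: "('g, 'm) monoid_scheme" (structure) +
  assumes finite_carrier: "finite (carrier \<Gamma>)"
begin

definition conv :: "('g \<Rightarrow> rat) \<Rightarrow> ('g \<Rightarrow> rat) \<Rightarrow> 'g \<Rightarrow> rat" (infixl \<open>\<star>\<close> 70) where
  "f \<star> g = f \<otimes>\<^bsub>group_alg \<Gamma>\<^esub> g"

definition scl :: "rat \<Rightarrow> ('g \<Rightarrow> rat) \<Rightarrow> 'g \<Rightarrow> rat" where
  "scl c f = (\<lambda>x. c * f x)"

abbreviation A :: "('g \<Rightarrow> rat) set" where
  "A \<equiv> carrier (group_alg \<Gamma>)"

lemma A_iff: "f \<in> A \<longleftrightarrow> (\<forall>x. x \<notin> carrier \<Gamma> \<longrightarrow> f x = 0)"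
  by (simp add: group_alg_def)

text \<open>Zero and addition of the record are those of the function type, so the type class laws
  for sums and differences become available for the group algebra.\<close>

lemma group_alg_simps:
  "monoid.mult (group_alg \<Gamma>) = (\<star>)" "ring.add (group_alg \<Gamma>) = (+)" "ring.zero (group_alg \<Gamma>) = 0"
  "monoid.one (group_alg \<Gamma>) = grp_elt \<one>" "module.smult (group_alg \<Gamma>) = scl"
  by (auto simp: conv_def fun_eq_iff group_alg_def grp_elt_def scl_def)

lemma conv_apply:
  "x \<in> carrier \<Gamma> \<Longrightarrow> (f \<star> g) x = (\<Sum>y\<in>carrier \<Gamma>. f y * g (inv y \<otimes> x))"
  by (simp add: conv_def group_alg_def)

lemma conv_outside: "x \<notin> carrier \<Gamma> \<Longrightarrow> (f \<star> g) x = 0"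
  by (simp add: conv_def group_alg_def)

lemma conv_A [simp]: "f \<star> g \<in> A"
  by (simp add: A_iff conv_outside)

lemma sum_translate_left:
  "a \<in> carrier \<Gamma> \<Longrightarrow> (\<Sum>x\<in>carrier \<Gamma>. h (a \<otimes> x)) = (\<Sum>x\<in>carrier \<Gamma>. h x)"
  by (rule sum.reindex_bij_witness[of _ "\<lambda>x. inv a \<otimes> x" "\<lambda>x. a \<otimes> x"]) (auto simp: m_assoc[symmetric])

lemma sum_translate_right:
  "a \<in> carrier \<Gamma> \<Longrightarrow> (\<Sum>x\<in>carrier \<Gamma>. h (x \<otimes> a)) = (\<Sum>x\<in>carrier \<Gamma>. h x)"
  by (rule sum.reindex_bij_witness[of _ "\<lambda>x. x \<otimes> inv a" "\<lambda>x. x \<otimes> a"]) (auto simp: m_assoc)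

lemma sum_inverse: "(\<Sum>x\<in>carrier \<Gamma>. h (inv x)) = (\<Sum>x\<in>carrier \<Gamma>. h x)"
  by (rule sum.reindex_bij_witness[of _ "\<lambda>x. inv x" "\<lambda>x. inv x"]) auto

lemma conv_apply':
  assumes "x \<in> carrier \<Gamma>"
  shows "(f \<star> g) x = (\<Sum>y\<in>carrier \<Gamma>. f (x \<otimes> inv y) * g y)"
proof -
  have "(f \<star> g) x = (\<Sum>y\<in>carrier \<Gamma>. f (x \<otimes> y) * g (inv (x \<otimes> y) \<otimes> x))"
    unfolding conv_apply[OF assms]
    by (rule sum_translate_left[OF assms, symmetric, of "\<lambda>y. f y * g (inv y \<otimes> x)"])
  also have "\<dots> = (\<Sum>y\<in>carrier \<Gamma>. f (x \<otimes> y) * g (inv y))"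
    using assms by (intro sum.cong) (auto simp: inv_mult_group m_assoc)
  also have "\<dots> = (\<Sum>y\<in>carrier \<Gamma>. f (x \<otimes> inv y) * g y)"
    by (subst sum_inverse[symmetric]) simp
  finally show ?thesis .
qed

lemma conv_assoc: "(f \<star> g) \<star> h = f \<star> (g \<star> h)"
proof
  fix x
  show "(f \<star> g \<star> h) x = (f \<star> (g \<star> h)) x"
  proof (cases "x \<in> carrier \<Gamma>")
    case True
    have "(f \<star> g \<star> h) x = (\<Sum>y\<in>carrier \<Gamma>. \<Sum>z\<in>carrier \<Gamma>. f z * g (inv z \<otimes> y) * h (inv y \<otimes> x))"
      using True by (auto simp: conv_apply sum_distrib_right intro!: sum.cong)
    also have "\<dots> = (\<Sum>z\<in>carrier \<Gamma>. \<Sum>y\<in>carrier \<Gamma>. f z * g (inv z \<otimes> y) * h (inv y \<otimes> x))"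
      by (rule sum.swap)
    also have "\<dots> = (\<Sum>z\<in>carrier \<Gamma>. \<Sum>y\<in>carrier \<Gamma>. f z * (g y * h (inv y \<otimes> (inv z \<otimes> x))))"
    proof (rule sum.cong[OF refl])
      fix z assume z: "z \<in> carrier \<Gamma>"
      have "(\<Sum>y\<in>carrier \<Gamma>. f z * g (inv z \<otimes> y) * h (inv y \<otimes> x))
          = (\<Sum>y\<in>carrier \<Gamma>. f z * g (inv z \<otimes> (z \<otimes> y)) * h (inv (z \<otimes> y) \<otimes> x))"
        by (rule sum_translate_left[OF z, symmetric, of "\<lambda>y. f z * g (inv z \<otimes> y) * h (inv y \<otimes> x)"])
      also have "\<dots> = (\<Sum>y\<in>carrier \<Gamma>. f z * (g y * h (inv y \<otimes> (inv z \<otimes> x))))"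
        using True z by (intro sum.cong) (auto simp: inv_mult_group m_assoc, auto simp: m_assoc[symmetric])
      finally show "(\<Sum>y\<in>carrier \<Gamma>. f z * g (inv z \<otimes> y) * h (inv y \<otimes> x)) = \<dots>" .
    qed
    also have "\<dots> = (f \<star> (g \<star> h)) x"
      using True by (auto simp: conv_apply sum_distrib_left intro!: sum.cong)
    finally show ?thesis .
  qed (simp add: conv_outside)
qed

text \<open>The laws hold for arbitrary functions, since values outside
  \<open>carrier \<Gamma>\<close> never enter a convolution. A unit exists only on \<open>A\<close>,
  which is why \<open>rat_algebra\<close> does not ask for one.\<close>

sublocale rat_algebra scl conv
proof unfold_locales
  fix f g h :: "'g \<Rightarrow> rat" and c d :: rat
  show "scl c (f + g) = scl c f + scl c g" "scl (c + d) f = scl c f + scl d f"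
    "scl c (scl d f) = scl (c * d) f" "scl 1 f = f"
    by (auto simp: scl_def fun_eq_iff algebra_simps)
  show "f \<star> g \<star> h = f \<star> (g \<star> h)" by (rule conv_assoc)
  show "(f + g) \<star> h = f \<star> h + g \<star> h" "f \<star> (g + h) = f \<star> g + f \<star> h"
    "scl c f \<star> g = scl c (f \<star> g)" "f \<star> scl c g = scl c (f \<star> g)"
    by (auto simp: fun_eq_iff conv_def group_alg_def scl_def algebra_simps sum.distrib sum_distrib_left)
qed

lemma add_closed_A: "add_closed A"
  by (rule add_closedI) (auto simp: A_iff)

lemma scl_A [simp]: "f \<in> A \<Longrightarrow> scl c f \<in> A"
  by (auto simp: A_iff scl_def)

lemma grp_elt_A [simp]: "a \<in> carrier \<Gamma> \<Longrightarrow> grp_elt a \<in> A"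
  by (auto simp: A_iff grp_elt_def)

lemma grp_elt_conv:
  assumes "a \<in> carrier \<Gamma>" "x \<in> carrier \<Gamma>"
  shows "(grp_elt a \<star> f) x = f (inv a \<otimes> x)"
proof -
  have "(grp_elt a \<star> f) x = (\<Sum>y\<in>carrier \<Gamma>. if y = a then f (inv a \<otimes> x) else 0)"
    unfolding conv_apply[OF assms(2)] by (rule sum.cong) (auto simp: grp_elt_def)
  then show ?thesis using assms finite_carrier by simp
qed

lemma conv_grp_elt:
  assumes "a \<in> carrier \<Gamma>" "x \<in> carrier \<Gamma>"
  shows "(f \<star> grp_elt a) x = f (x \<otimes> inv a)"
proof -
  have "(f \<star> grp_elt a) x = (\<Sum>y\<in>carrier \<Gamma>. if y = a then f (x \<otimes> inv a) else 0)"
    unfolding conv_apply'[OF assms(2)] by (rule sum.cong) (auto simp: grp_elt_def)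
  then show ?thesis using assms finite_carrier by simp
qed

lemma A_eqI: "f \<in> A \<Longrightarrow> g \<in> A \<Longrightarrow> (\<And>x. x \<in> carrier \<Gamma> \<Longrightarrow> f x = g x) \<Longrightarrow> f = g"
  by (metis A_iff ext)

lemma conv_one_left [simp]: "f \<in> A \<Longrightarrow> grp_elt \<one> \<star> f = f"
  by (rule A_eqI) (auto simp: grp_elt_conv)

lemma conv_one_right [simp]: "f \<in> A \<Longrightarrow> f \<star> grp_elt \<one> = f"
  by (rule A_eqI) (auto simp: conv_grp_elt)

lemma grp_elt_mult:
  assumes "a \<in> carrier \<Gamma>" "b \<in> carrier \<Gamma>"
  shows "grp_elt a \<star> grp_elt b = grp_elt (a \<otimes> b)"
proof (rule A_eqI)
  fix x assume x: "x \<in> carrier \<Gamma>"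
  have "inv a \<otimes> x = b \<longleftrightarrow> x = a \<otimes> b" using assms x by (metis inv_solve_left)
  then show "(grp_elt a \<star> grp_elt b) x = grp_elt (a \<otimes> b) x"
    using assms x by (simp add: grp_elt_conv) (simp add: grp_elt_def)
qed (use assms in auto)

lemma expand: "f \<in> A \<Longrightarrow> f = (\<Sum>x\<in>carrier \<Gamma>. scl (f x) (grp_elt x))"
proof (rule ext)
  fix y assume f: "f \<in> A"
  have "(\<Sum>x\<in>carrier \<Gamma>. scl (f x) (grp_elt x)) y = (\<Sum>x\<in>carrier \<Gamma>. if x = y then f y else 0)"
    by (subst sum_apply) (auto simp: scl_def grp_elt_def intro!: sum.cong)
  also have "\<dots> = f y" using f finite_carrier by (simp add: A_iff)
  finally show "f y = (\<Sum>x\<in>carrier \<Gamma>. scl (f x) (grp_elt x)) y" by simp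
qed

definition ip :: "('g \<Rightarrow> rat) \<Rightarrow> ('g \<Rightarrow> rat) \<Rightarrow> rat" where
  "ip f g = (\<Sum>x\<in>carrier \<Gamma>. f x * g x)"

text \<open>The anti-involution induced by inversion in \<open>\<Gamma>\<close>: for the form
  \<open>ip\<close>, multiplication by \<open>adj a\<close> is adjoint to multiplication by
  \<open>a\<close>, on either side.\<close>

definition adj :: "('g \<Rightarrow> rat) \<Rightarrow> 'g \<Rightarrow> rat" where
  "adj f = (\<lambda>x. if x \<in> carrier \<Gamma> then f (inv x) else 0)"

lemma adj_A [simp]: "adj f \<in> A"
  by (simp add: adj_def A_iff)

lemma ip_conv_left: "ip (a \<star> f) g = ip f (adj a \<star> g)"
proof -
  have "ip (a \<star> f) g = (\<Sum>x\<in>carrier \<Gamma>. \<Sum>y\<in>carrier \<Gamma>. a y * (f (inv y \<otimes> x) * g x))"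
    by (auto simp: ip_def conv_apply sum_distrib_right mult.assoc intro!: sum.cong)
  also have "\<dots> = (\<Sum>y\<in>carrier \<Gamma>. \<Sum>x\<in>carrier \<Gamma>. a y * (f (inv y \<otimes> x) * g x))"
    by (rule sum.swap)
  also have "\<dots> = (\<Sum>y\<in>carrier \<Gamma>. \<Sum>x\<in>carrier \<Gamma>. a y * (f x * g (y \<otimes> x)))"
  proof (rule sum.cong[OF refl])
    fix y assume y: "y \<in> carrier \<Gamma>"
    show "(\<Sum>x\<in>carrier \<Gamma>. a y * (f (inv y \<otimes> x) * g x)) = (\<Sum>x\<in>carrier \<Gamma>. a y * (f x * g (y \<otimes> x)))"
      using y by (subst sum_translate_left[OF y, symmetric]) (auto simp: m_assoc[symmetric] intro!: sum.cong)
  qed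
  also have "\<dots> = (\<Sum>y\<in>carrier \<Gamma>. \<Sum>x\<in>carrier \<Gamma>. a (inv y) * (f x * g (inv y \<otimes> x)))"
    by (rule sum_inverse[symmetric])
  also have "\<dots> = (\<Sum>x\<in>carrier \<Gamma>. \<Sum>y\<in>carrier \<Gamma>. a (inv y) * (f x * g (inv y \<otimes> x)))"
    by (rule sum.swap)
  also have "\<dots> = ip f (adj a \<star> g)"
    by (auto simp: ip_def conv_apply sum_distrib_left adj_def mult.left_commute intro!: sum.cong)
  finally show ?thesis .
qed

lemma ip_conv_right: "ip (f \<star> a) g = ip f (g \<star> adj a)"
proof -
  have "ip (f \<star> a) g = (\<Sum>x\<in>carrier \<Gamma>. \<Sum>y\<in>carrier \<Gamma>. a y * (f (x \<otimes> inv y) * g x))"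
    by (auto simp: ip_def conv_apply' sum_distrib_right mult.assoc mult.left_commute intro!: sum.cong)
  also have "\<dots> = (\<Sum>y\<in>carrier \<Gamma>. \<Sum>x\<in>carrier \<Gamma>. a y * (f (x \<otimes> inv y) * g x))"
    by (rule sum.swap)
  also have "\<dots> = (\<Sum>y\<in>carrier \<Gamma>. \<Sum>x\<in>carrier \<Gamma>. a y * (f x * g (x \<otimes> y)))"
  proof (rule sum.cong[OF refl])
    fix y assume y: "y \<in> carrier \<Gamma>"
    show "(\<Sum>x\<in>carrier \<Gamma>. a y * (f (x \<otimes> inv y) * g x)) = (\<Sum>x\<in>carrier \<Gamma>. a y * (f x * g (x \<otimes> y)))"
      using y by (subst sum_translate_right[OF y, symmetric]) (auto simp: m_assoc intro!: sum.cong)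
  qed
  also have "\<dots> = (\<Sum>y\<in>carrier \<Gamma>. \<Sum>x\<in>carrier \<Gamma>. a (inv y) * (f x * g (x \<otimes> inv y)))"
    by (rule sum_inverse[symmetric])
  also have "\<dots> = (\<Sum>x\<in>carrier \<Gamma>. \<Sum>y\<in>carrier \<Gamma>. a (inv y) * (f x * g (x \<otimes> inv y)))"
    by (rule sum.swap)
  also have "\<dots> = ip f (g \<star> adj a)"
    by (auto simp: ip_def conv_apply' sum_distrib_left adj_def mult.commute mult.left_commute intro!: sum.cong)
  finally show ?thesis .
qed

lemma ip_self_eq_zero:
  assumes "f \<in> A" "ip f f = 0"
  shows "f = 0"
proof -
  have "\<forall>x\<in>carrier \<Gamma>. f x * f x = 0"
    using assms(2) finite_carrier unfolding ip_def by (subst (asm) sum_nonneg_eq_0_iff) auto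
  then show ?thesis using assms(1) by (auto simp: A_iff fun_eq_iff)
qed

lemma central_idempotent_iff:
  "central_idempotent (group_alg \<Gamma>) e \<longleftrightarrow> e \<in> A \<and> e \<star> e = e \<and> (\<forall>x\<in>A. e \<star> x = x \<star> e)"
  by (simp add: central_idempotent_def group_alg_simps)

text \<open>A substitute for semisimplicity. Let \<open>f\<close> be the orthogonal projection of
  the unit to \<open>I\<close>. For \<open>x\<close> in \<open>I\<close> the element
  \<open>y = (1 - f) x\<close> is in \<open>I\<close>, and moving \<open>x\<close> across the form
  turns the vanishing product of \<open>1 - f\<close> with \<open>y (adj x)\<close> into
  \<open>ip y y = 0\<close>. So \<open>f\<close> is a two-sided identity of \<open>I\<close>, and
  \<open>f x = f x f = x f\<close> for every \<open>x\<close> makes it central.\<close>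

lemma ideal_central_idempotent:
  assumes "I \<subseteq> A" "add_closed I" and sc: "\<And>c x. x \<in> I \<Longrightarrow> scl c x \<in> I"
    and l: "\<And>a x. a \<in> A \<Longrightarrow> x \<in> I \<Longrightarrow> a \<star> x \<in> I" and r: "\<And>a x. a \<in> A \<Longrightarrow> x \<in> I \<Longrightarrow> x \<star> a \<in> I"
  shows "\<exists>f\<in>I. central_idempotent (group_alg \<Gamma>) f \<and> (\<forall>x\<in>I. f \<star> x = x)"
proof -
  define v :: "'g \<Rightarrow> rat" where "v = grp_elt \<one>"
  have vA: "v \<in> A" by (simp add: v_def)
  have "\<exists>w\<in>I. \<forall>w'\<in>I. (\<Sum>x\<in>carrier \<Gamma>. (v x - w x) * w' x) = 0"
  proof (rule orthogonal_projection_exists[OF finite_carrier])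
    show "w x = 0" if "w \<in> I" "x \<notin> carrier \<Gamma>" for w x
      using that assms(1) by (auto simp: A_iff)
    show "0 \<in> I" using assms(2) by (rule add_closed_zero)
    show "(\<lambda>x. a x + c * b x) \<in> I" if "a \<in> I" "b \<in> I" for a b c
      using add_closed_add[OF assms(2) that(1) sc[OF that(2), of c]] by (simp add: scl_def plus_fun_def)
  qed
  then obtain f where f: "f \<in> I" "\<And>w. w \<in> I \<Longrightarrow> ip (v - f) w = 0"
    by (auto simp: ip_def)
  have fA: "f \<in> A" using f assms(1) by blast
  have left: "f \<star> x = x" if x: "x \<in> I" for x
  proof -
    have xA: "x \<in> A" using x assms(1) by blast
    have "(v - f) \<star> x = x - f \<star> x" using xA by (simp add: mul_diff_left v_def)
    also have "\<dots> \<in> I" using x l[OF fA x] by (rule add_closed_diff[OF assms(2)])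
    finally have "ip (v - f) (((v - f) \<star> x) \<star> adj x) = 0" by (intro f(2) r[OF adj_A])
    then have "(v - f) \<star> x = 0" by (intro ip_self_eq_zero) (auto simp: ip_conv_right)
    then show ?thesis using xA by (simp add: mul_diff_left v_def)
  qed
  have right: "x \<star> f = x" if x: "x \<in> I" for x
  proof -
    have xA: "x \<in> A" using x assms(1) by blast
    have "x \<star> (v - f) = x - x \<star> f" using xA by (simp add: mul_diff_right v_def)
    also have "\<dots> \<in> I" using x r[OF fA x] by (rule add_closed_diff[OF assms(2)])
    finally have "ip (v - f) (adj x \<star> (x \<star> (v - f))) = 0" by (intro f(2) l[OF adj_A])
    then have "x \<star> (v - f) = 0" by (intro ip_self_eq_zero) (auto simp: ip_conv_left)
    then show ?thesis using xA by (simp add: mul_diff_right v_def)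
  qed
  have "f \<star> x = x \<star> f" if "x \<in> A" for x
    using right[OF r[OF that f(1)]] left[OF l[OF that f(1)]] by (simp add: conv_assoc)
  then have "central_idempotent (group_alg \<Gamma>) f"
    using left[OF f(1)] fA unfolding central_idempotent_iff by blast
  then show ?thesis using f(1) left by blast
qed

section \<open>Central idempotents attached to characters\<close>

lemma rep_ext_carrier: "rep_ext \<Gamma> n \<rho> f \<in> carrier_mat n n"
  by (simp add: rep_ext_def)

lemma rep_ext_conv:
  assumes "is_rep \<Gamma> n \<rho>"
  shows "rep_ext \<Gamma> n \<rho> (f \<star> g) = rep_ext \<Gamma> n \<rho> f * rep_ext \<Gamma> n \<rho> g"
proof (rule eq_matI)
  fix i j assume "i < dim_row (rep_ext \<Gamma> n \<rho> f * rep_ext \<Gamma> n \<rho> g)"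
    "j < dim_col (rep_ext \<Gamma> n \<rho> f * rep_ext \<Gamma> n \<rho> g)"
  then have ij: "i < n" "j < n" by (auto simp: rep_ext_def)
  have rho: "\<rho> y \<in> carrier_mat n n" if "y \<in> carrier \<Gamma>" for y
    using assms that by (simp add: is_rep_def)
  have rho_mult: "\<rho> (y \<otimes> z) $$ (i, j) = (\<Sum>k<n. \<rho> y $$ (i, k) * \<rho> z $$ (k, j))"
    if "y \<in> carrier \<Gamma>" "z \<in> carrier \<Gamma>" for y z
  proof -
    have "\<rho> (y \<otimes> z) = \<rho> y * \<rho> z" using assms that by (simp add: is_rep_def)
    then show ?thesis
      using rho[OF that(1)] rho[OF that(2)] ij
      by (auto simp: scalar_prod_def atLeast0LessThan intro!: sum.cong)
  qed
  have "rep_ext \<Gamma> n \<rho> (f \<star> g) $$ (i, j)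
      = (\<Sum>x\<in>carrier \<Gamma>. \<Sum>y\<in>carrier \<Gamma>. f y * g (inv y \<otimes> x) * \<rho> x $$ (i, j))"
    using ij by (auto simp: rep_ext_def conv_apply sum_distrib_right intro!: sum.cong)
  also have "\<dots> = (\<Sum>y\<in>carrier \<Gamma>. \<Sum>x\<in>carrier \<Gamma>. f y * g (inv y \<otimes> x) * \<rho> x $$ (i, j))"
    by (rule sum.swap)
  also have "\<dots> = (\<Sum>y\<in>carrier \<Gamma>. \<Sum>z\<in>carrier \<Gamma>. f y * g z * \<rho> (y \<otimes> z) $$ (i, j))"
  proof (rule sum.cong[OF refl])
    fix y assume y: "y \<in> carrier \<Gamma>"
    show "(\<Sum>x\<in>carrier \<Gamma>. f y * g (inv y \<otimes> x) * \<rho> x $$ (i, j))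
        = (\<Sum>z\<in>carrier \<Gamma>. f y * g z * \<rho> (y \<otimes> z) $$ (i, j))"
      using y by (subst sum_translate_left[OF y, symmetric]) (auto simp: m_assoc[symmetric] intro!: sum.cong)
  qed
  also have "\<dots> = (\<Sum>y\<in>carrier \<Gamma>. \<Sum>z\<in>carrier \<Gamma>. \<Sum>k<n. (f y * \<rho> y $$ (i, k)) * (g z * \<rho> z $$ (k, j)))"
    by (auto simp: rho_mult sum_distrib_left mult_ac intro!: sum.cong)
  also have "\<dots> = (\<Sum>y\<in>carrier \<Gamma>. \<Sum>k<n. \<Sum>z\<in>carrier \<Gamma>. (f y * \<rho> y $$ (i, k)) * (g z * \<rho> z $$ (k, j)))"
    by (intro sum.cong refl sum.swap)
  also have "\<dots> = (\<Sum>k<n. \<Sum>y\<in>carrier \<Gamma>. \<Sum>z\<in>carrier \<Gamma>. (f y * \<rho> y $$ (i, k)) * (g z * \<rho> z $$ (k, j)))"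
    by (rule sum.swap)
  also have "\<dots> = (rep_ext \<Gamma> n \<rho> f * rep_ext \<Gamma> n \<rho> g) $$ (i, j)"
    using ij by (auto simp: rep_ext_def scalar_prod_def atLeast0LessThan sum_product intro!: sum.cong)
  finally show "rep_ext \<Gamma> n \<rho> (f \<star> g) $$ (i, j) = (rep_ext \<Gamma> n \<rho> f * rep_ext \<Gamma> n \<rho> g) $$ (i, j)" .
qed (auto simp: rep_ext_def)

lemma rep_ext_one:
  assumes "is_rep \<Gamma> n \<rho>"
  shows "rep_ext \<Gamma> n \<rho> (grp_elt \<one>) = 1\<^sub>m n"
proof (rule eq_matI)
  fix i j assume "i < dim_row (1\<^sub>m n :: rat mat)" "j < dim_col (1\<^sub>m n :: rat mat)"
  then have ij: "i < n" "j < n" by auto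
  have "rep_ext \<Gamma> n \<rho> (grp_elt \<one>) $$ (i, j) = (\<Sum>g\<in>carrier \<Gamma>. if g = \<one> then \<rho> \<one> $$ (i, j) else 0)"
    using ij by (auto simp: rep_ext_def grp_elt_def intro!: sum.cong)
  also have "\<dots> = 1\<^sub>m n $$ (i, j)" using assms finite_carrier by (simp add: is_rep_def)
  finally show "rep_ext \<Gamma> n \<rho> (grp_elt \<one>) $$ (i, j) = 1\<^sub>m n $$ (i, j)" .
qed (auto simp: rep_ext_def)

lemma rep_ext_linear:
  "rep_ext \<Gamma> n \<rho> (f + scl c g) = rep_ext \<Gamma> n \<rho> f + c \<cdot>\<^sub>m rep_ext \<Gamma> n \<rho> g"
  by (rule eq_matI)
    (auto simp: rep_ext_def scl_def ring_distribs sum.distrib sum_distrib_left mult.assoc)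

lemma rep_ext_trace:
  "(\<Sum>i<n. rep_ext \<Gamma> n \<rho> f $$ (i, i)) = (\<Sum>g\<in>carrier \<Gamma>. f g * rep_char n \<rho> g)"
proof -
  have "(\<Sum>i<n. rep_ext \<Gamma> n \<rho> f $$ (i, i)) = (\<Sum>i<n. \<Sum>g\<in>carrier \<Gamma>. f g * \<rho> g $$ (i, i))"
    by (simp add: rep_ext_def)
  also have "\<dots> = (\<Sum>g\<in>carrier \<Gamma>. \<Sum>i<n. f g * \<rho> g $$ (i, i))" by (rule sum.swap)
  finally show ?thesis by (simp add: rep_char_def sum_distrib_left)
qed

lemma rep_char_one: "is_rep \<Gamma> n \<rho> \<Longrightarrow> rep_char n \<rho> \<one> = of_nat n"
  by (simp add: is_rep_def rep_char_def)

text \<open>For an idempotent matrix, being the identity is a condition on the trace.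
  Representations with equal characters therefore have the same idempotents acting as the
  identity.\<close>

lemma rep_ext_idem_iff:
  assumes "is_rep \<Gamma> n \<rho>" "f \<star> f = f"
  shows "rep_ext \<Gamma> n \<rho> f = 1\<^sub>m n \<longleftrightarrow> (\<Sum>g\<in>carrier \<Gamma>. f g * rep_char n \<rho> g) = of_nat n"
proof
  assume "rep_ext \<Gamma> n \<rho> f = 1\<^sub>m n"
  then show "(\<Sum>g\<in>carrier \<Gamma>. f g * rep_char n \<rho> g) = of_nat n"
    unfolding rep_ext_trace[symmetric] by simp
next
  assume "(\<Sum>g\<in>carrier \<Gamma>. f g * rep_char n \<rho> g) = of_nat n"
  then show "rep_ext \<Gamma> n \<rho> f = 1\<^sub>m n"
    using rep_ext_conv[OF assms(1), of f f] assms(2)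
    by (intro idempotent_trace_eq_dim rep_ext_carrier) (auto simp: rep_ext_trace)
qed

text \<open>The complement of the central idempotent generating the kernel of the representation is the
  least central idempotent that acts as the identity.\<close>

lemma least_central_idempotent_exists:
  assumes rep: "is_rep \<Gamma> n \<rho>"
  shows "\<exists>e. central_idempotent (group_alg \<Gamma>) e \<and> rep_ext \<Gamma> n \<rho> e = 1\<^sub>m n \<and>
    (\<forall>f. central_idempotent (group_alg \<Gamma>) f \<and> rep_ext \<Gamma> n \<rho> f = 1\<^sub>m n \<longrightarrow> f \<star> e = e)"
proof -
  define J where "J = {x \<in> A. rep_ext \<Gamma> n \<rho> x = 0\<^sub>m n n}"
  have diff: "rep_ext \<Gamma> n \<rho> (x - y) = rep_ext \<Gamma> n \<rho> x + (- 1) \<cdot>\<^sub>m rep_ext \<Gamma> n \<rho> y" for x y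
  proof -
    have "x - y = x + scl (- 1) y" by (simp add: scl_def fun_eq_iff)
    then show ?thesis by (simp only: rep_ext_linear)
  qed
  have diff': "rep_ext \<Gamma> n \<rho> (x - y) = 0\<^sub>m n n"
    if "rep_ext \<Gamma> n \<rho> x = rep_ext \<Gamma> n \<rho> y" for x y
    unfolding diff that using rep_ext_carrier[of n \<rho> y] by (intro eq_matI) auto
  have "\<exists>f\<in>J. central_idempotent (group_alg \<Gamma>) f \<and> (\<forall>x\<in>J. f \<star> x = x)"
  proof (rule ideal_central_idempotent)
    show "add_closed J"
    proof (rule add_closedI)
      show "0 \<in> J" by (auto simp: J_def A_iff rep_ext_def)
      show "x - y \<in> J" if "x \<in> J" "y \<in> J" for x y
        using that diff'[of x y] add_closed_diff[OF add_closed_A] by (auto simp: J_def)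
    qed
    show "scl c x \<in> J" if "x \<in> J" for c x
      using that rep_ext_linear[of n \<rho> 0 c x]
      by (auto simp: J_def) (auto simp: rep_ext_def)
    show "a \<star> x \<in> J" "x \<star> a \<in> J" if "a \<in> A" "x \<in> J" for a x
      using that rep_ext_carrier[of n \<rho> a] by (auto simp: J_def rep_ext_conv[OF rep])
  qed (auto simp: J_def)
  then obtain f where f: "f \<in> J" "central_idempotent (group_alg \<Gamma>) f" "\<And>x. x \<in> J \<Longrightarrow> f \<star> x = x"
    by blast
  have fA: "f \<in> A" and ff: "f \<star> f = f" and fc: "\<And>x. x \<in> A \<Longrightarrow> f \<star> x = x \<star> f"
    using f(2) by (auto simp: central_idempotent_iff)
  define e where "e = grp_elt \<one> - f"
  have eA: "e \<in> A" unfolding e_def by (intro add_closed_diff[OF add_closed_A] fA) simp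
  have "central_idempotent (group_alg \<Gamma>) e"
    unfolding central_idempotent_iff
  proof (intro conjI ballI)
    show "e \<star> e = e" using fA ff by (simp add: e_def mul_diff_left mul_diff_right)
    show "e \<star> x = x \<star> e" if "x \<in> A" for x
      using that by (simp add: e_def mul_diff_left mul_diff_right fc[OF that])
  qed (rule eA)
  moreover have "rep_ext \<Gamma> n \<rho> e = 1\<^sub>m n"
    using f(1) rep_ext_one[OF rep] unfolding e_def diff J_def by auto
  moreover have "g \<star> e = e" if g: "central_idempotent (group_alg \<Gamma>) g" "rep_ext \<Gamma> n \<rho> g = 1\<^sub>m n" for g
  proof -
    have gA: "g \<in> A" using g by (simp add: central_idempotent_iff)
    have "grp_elt \<one> - g \<in> J"
      using diff'[of "grp_elt \<one>" g] rep_ext_one[OF rep] g(2) add_closed_diff[OF add_closed_A _ gA]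
      by (simp add: J_def)
    then have "f \<star> (grp_elt \<one> - g) = grp_elt \<one> - g" by (rule f(3))
    then have "f - f \<star> g = grp_elt \<one> - g" using fA by (simp add: mul_diff_right)
    then show ?thesis using gA fc[OF gA] by (simp add: e_def mul_diff_right algebra_simps)
  qed
  ultimately show ?thesis by blast
qed

text \<open>Resolves the definite description and upgrades minimal to least. If \<open>e'\<close> is
  minimal for another representation with the same character, the least idempotent \<open>e\<close>
  acts as the identity there too and satisfies \<open>e \<star> e' = e\<close>, so minimality forces
  \<open>e = e'\<close>.\<close>

lemma char_idem_characterization:
  assumes rep: "is_rep \<Gamma> n \<rho>" and chi: "\<And>g. g \<in> carrier \<Gamma> \<Longrightarrow> rep_char n \<rho> g = \<chi> g"
  shows "central_idempotent (group_alg \<Gamma>) (char_idem \<Gamma> \<chi>)"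
    and "\<And>f. central_idempotent (group_alg \<Gamma>) f \<Longrightarrow> rep_ext \<Gamma> n \<rho> f = 1\<^sub>m n \<Longrightarrow>
      f \<star> char_idem \<Gamma> \<chi> = char_idem \<Gamma> \<chi>"
proof -
  obtain e where e: "central_idempotent (group_alg \<Gamma>) e" "rep_ext \<Gamma> n \<rho> e = 1\<^sub>m n"
    and least: "\<And>f. central_idempotent (group_alg \<Gamma>) f \<Longrightarrow> rep_ext \<Gamma> n \<rho> f = 1\<^sub>m n \<Longrightarrow> f \<star> e = e"
    using least_central_idempotent_exists[OF rep] by blast
  have comm: "f \<star> g = g \<star> f"
    if "central_idempotent (group_alg \<Gamma>) f" "central_idempotent (group_alg \<Gamma>) g" for f g
    using that unfolding central_idempotent_iff by blast
  have "char_idem \<Gamma> \<chi> = e"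
    unfolding char_idem_def
  proof (rule the_equality)
    have "min_central_idem \<Gamma> n \<rho> e"
      unfolding min_central_idem_def group_alg_simps using e least by metis
    then show "\<exists>n \<rho>. is_rep \<Gamma> n \<rho> \<and> (\<forall>g\<in>carrier \<Gamma>. rep_char n \<rho> g = \<chi> g) \<and> min_central_idem \<Gamma> n \<rho> e"
      using rep chi by blast
  next
    fix e' assume "\<exists>n \<rho>. is_rep \<Gamma> n \<rho> \<and> (\<forall>g\<in>carrier \<Gamma>. rep_char n \<rho> g = \<chi> g) \<and> min_central_idem \<Gamma> n \<rho> e'"
    then obtain m \<sigma> where \<sigma>: "is_rep \<Gamma> m \<sigma>" "\<And>g. g \<in> carrier \<Gamma> \<Longrightarrow> rep_char m \<sigma> g = \<chi> g"
      "min_central_idem \<Gamma> m \<sigma> e'" by blast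
    have "of_nat m = (of_nat n :: rat)"
      using rep_char_one[OF rep] rep_char_one[OF \<sigma>(1)] chi \<sigma>(2) by (metis one_closed)
    then have "m = n" by simp
    have same: "rep_ext \<Gamma> m \<sigma> f = 1\<^sub>m m \<longleftrightarrow> rep_ext \<Gamma> n \<rho> f = 1\<^sub>m n" if "f \<star> f = f" for f
      using rep_ext_idem_iff[OF rep that] rep_ext_idem_iff[OF \<sigma>(1) that] chi \<sigma>(2) \<open>m = n\<close> by simp
    have e': "central_idempotent (group_alg \<Gamma>) e'" "rep_ext \<Gamma> m \<sigma> e' = 1\<^sub>m m"
      and min: "\<And>f. central_idempotent (group_alg \<Gamma>) f \<Longrightarrow> rep_ext \<Gamma> m \<sigma> f = 1\<^sub>m m \<Longrightarrow> f \<star> e' = f \<Longrightarrow> f = e'"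
      using \<sigma>(3) by (auto simp: min_central_idem_def group_alg_simps)
    have "rep_ext \<Gamma> n \<rho> e' = 1\<^sub>m n" using same e' unfolding central_idempotent_iff by blast
    then have "e' \<star> e = e" using least e'(1) by blast
    then have "e \<star> e' = e" using comm[OF e(1) e'(1)] by simp
    moreover have "rep_ext \<Gamma> m \<sigma> e = 1\<^sub>m m" using same e unfolding central_idempotent_iff by blast
    ultimately show "e' = e" using min[OF e(1)] by simp
  qed
  then show "central_idempotent (group_alg \<Gamma>) (char_idem \<Gamma> \<chi>)"
    and "\<And>f. central_idempotent (group_alg \<Gamma>) f \<Longrightarrow> rep_ext \<Gamma> n \<rho> f = 1\<^sub>m n \<Longrightarrow>
      f \<star> char_idem \<Gamma> \<chi> = char_idem \<Gamma> \<chi>"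
    using e least by simp_all
qed

end

section \<open>The augmentation representation\<close>

locale finite_group_subgroup = finite_group \<Gamma> for \<Gamma> :: "('g, 'm) monoid_scheme" (structure) +
  fixes \<Gamma>' :: "'g set"
  assumes subgroup_\<Gamma>': "subgroup \<Gamma>' \<Gamma>"
begin

lemma \<Gamma>'_carrier: "\<tau> \<in> \<Gamma>' \<Longrightarrow> \<tau> \<in> carrier \<Gamma>"
  using subgroup.subset[OF subgroup_\<Gamma>'] by blast

lemma finite_\<Gamma>': "finite \<Gamma>'"
  using finite_subset[OF subgroup.subset[OF subgroup_\<Gamma>'] finite_carrier] .

lemma \<Gamma>'_mult: "\<tau> \<in> \<Gamma>' \<Longrightarrow> \<sigma> \<in> \<Gamma>' \<Longrightarrow> \<tau> \<otimes> \<sigma> \<in> \<Gamma>'"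
  and \<Gamma>'_inv: "\<tau> \<in> \<Gamma>' \<Longrightarrow> inv \<tau> \<in> \<Gamma>'"
  and \<Gamma>'_one: "\<one> \<in> \<Gamma>'"
  using subgroup_\<Gamma>' by (auto simp: subgroup.m_closed subgroup.m_inv_closed subgroup.one_closed)

lemma card_\<Gamma>'_pos: "card \<Gamma>' > 0"
  using finite_\<Gamma>' \<Gamma>'_one by (auto simp: card_gt_0_iff)

lemma \<Gamma>'_trans:
  assumes "inv x \<otimes> y \<in> \<Gamma>'" "inv y \<otimes> z \<in> \<Gamma>'" "x \<in> carrier \<Gamma>" "y \<in> carrier \<Gamma>" "z \<in> carrier \<Gamma>"
  shows "inv x \<otimes> z \<in> \<Gamma>'"
proof -
  have "inv x \<otimes> z = (inv x \<otimes> y) \<otimes> (inv y \<otimes> z)"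
    using assms by (simp add: m_assoc) (simp add: m_assoc[symmetric])
  then show ?thesis using \<Gamma>'_mult assms by simp
qed

lemma \<Gamma>'_sym:
  assumes "inv x \<otimes> y \<in> \<Gamma>'" "x \<in> carrier \<Gamma>" "y \<in> carrier \<Gamma>"
  shows "inv y \<otimes> x \<in> \<Gamma>'"
  using \<Gamma>'_inv[OF assms(1)] assms by (simp add: inv_mult_group)

text \<open>\<open>K x\<close> is the left coset of \<open>x\<close>. Cosets are numbered from zero
  so that the augmentation representation can be written in matrices.\<close>

lemma transversal_exists:
  "\<exists>(m::nat) t. m > 0 \<and> (\<forall>i<m. t i \<in> carrier \<Gamma>) \<and>
    (\<forall>x\<in>carrier \<Gamma>. \<exists>!i. i < m \<and> inv (t i) \<otimes> x \<in> \<Gamma>')"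
proof -
  define K where "K x = {y \<in> carrier \<Gamma>. inv x \<otimes> y \<in> \<Gamma>'}" for x
  define S where "S = K ` carrier \<Gamma>"
  have finS: "finite S" using finite_carrier by (simp add: S_def)
  have neS: "S \<noteq> {}" by (auto simp: S_def)
  obtain h where h: "bij_betw h {0..<card S} S" using ex_bij_betw_nat_finite[OF finS] by blast
  have Keq: "K x = K y" if "inv x \<otimes> y \<in> \<Gamma>'" "x \<in> carrier \<Gamma>" "y \<in> carrier \<Gamma>" for x y
    unfolding K_def using \<Gamma>'_trans \<Gamma>'_sym that by blast
  have Kself: "x \<in> K x" if "x \<in> carrier \<Gamma>" for x
    using that \<Gamma>'_one by (simp add: K_def)
  define t where "t i = (SOME x. x \<in> carrier \<Gamma> \<and> K x = h i)" for i
  have t: "t i \<in> carrier \<Gamma> \<and> K (t i) = h i" if "i < card S" for i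
  proof -
    have "h i \<in> S" using h that by (auto simp: bij_betw_def)
    then have "\<exists>x. x \<in> carrier \<Gamma> \<and> K x = h i" unfolding S_def by (metis imageE)
    then show ?thesis unfolding t_def by (rule someI_ex)
  qed
  have uniq: "\<exists>!i. i < card S \<and> inv (t i) \<otimes> x \<in> \<Gamma>'" if x: "x \<in> carrier \<Gamma>" for x
  proof (rule ex_ex1I)
    have "K x \<in> h ` {0..<card S}" using h x by (auto simp: bij_betw_def S_def)
    then obtain i where i: "i < card S" "h i = K x" by auto
    then have "x \<in> K (t i)" using t Kself[OF x] by simp
    then show "\<exists>i. i < card S \<and> inv (t i) \<otimes> x \<in> \<Gamma>'" using i by (auto simp: K_def)
    fix i j assume "i < card S \<and> inv (t i) \<otimes> x \<in> \<Gamma>'" "j < card S \<and> inv (t j) \<otimes> x \<in> \<Gamma>'"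
    then have ij: "i < card S" "j < card S" and "K (t i) = K x" "K (t j) = K x"
      using t Keq x by blast+
    then have "h i = h j" using t by metis
    then show "i = j" using h ij unfolding bij_betw_def inj_on_def by simp
  qed
  have "card S > 0" using finS neS by (simp add: card_gt_0_iff)
  then show ?thesis
    by (intro exI[of _ "card S"] exI[of _ t] conjI allI impI ballI) (simp_all only: t uniq)
qed

definition num_cosets :: nat where
  "num_cosets = (SOME m. \<exists>t. m > 0 \<and> (\<forall>i<m. t i \<in> carrier \<Gamma>) \<and>
    (\<forall>x\<in>carrier \<Gamma>. \<exists>!i. i < m \<and> inv (t i) \<otimes> x \<in> \<Gamma>'))"

definition coset_rep :: "nat \<Rightarrow> 'g" where
  "coset_rep = (SOME t. num_cosets > 0 \<and> (\<forall>i<num_cosets. t i \<in> carrier \<Gamma>) \<and>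
    (\<forall>x\<in>carrier \<Gamma>. \<exists>!i. i < num_cosets \<and> inv (t i) \<otimes> x \<in> \<Gamma>'))"

definition coset_index :: "'g \<Rightarrow> nat" where
  "coset_index x = (THE i. i < num_cosets \<and> inv (coset_rep i) \<otimes> x \<in> \<Gamma>')"

lemma transversal:
  shows num_cosets_pos: "num_cosets > 0"
    and coset_rep_carrier: "i < num_cosets \<Longrightarrow> coset_rep i \<in> carrier \<Gamma>"
    and coset_index_unique: "x \<in> carrier \<Gamma> \<Longrightarrow> \<exists>!i. i < num_cosets \<and> inv (coset_rep i) \<otimes> x \<in> \<Gamma>'"
proof -
  have "\<exists>t. num_cosets > 0 \<and> (\<forall>i<num_cosets. t i \<in> carrier \<Gamma>) \<and>
    (\<forall>x\<in>carrier \<Gamma>. \<exists>!i. i < num_cosets \<and> inv (t i) \<otimes> x \<in> \<Gamma>')"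
    unfolding num_cosets_def by (rule someI_ex) (rule transversal_exists)
  then have *: "num_cosets > 0 \<and> (\<forall>i<num_cosets. coset_rep i \<in> carrier \<Gamma>) \<and>
    (\<forall>x\<in>carrier \<Gamma>. \<exists>!i. i < num_cosets \<and> inv (coset_rep i) \<otimes> x \<in> \<Gamma>')"
    unfolding coset_rep_def by (rule someI_ex)
  show "num_cosets > 0" using * by simp
  show "coset_rep i \<in> carrier \<Gamma>" if "i < num_cosets" using * that by simp
  show "\<exists>!i. i < num_cosets \<and> inv (coset_rep i) \<otimes> x \<in> \<Gamma>'" if "x \<in> carrier \<Gamma>" using * that by simp
qed

lemma coset_index:
  assumes "x \<in> carrier \<Gamma>"
  shows "coset_index x < num_cosets" "inv (coset_rep (coset_index x)) \<otimes> x \<in> \<Gamma>'"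
  using theI'[OF coset_index_unique[OF assms]] by (auto simp: coset_index_def)

lemma coset_index_eqI:
  assumes "x \<in> carrier \<Gamma>" "i < num_cosets" "inv (coset_rep i) \<otimes> x \<in> \<Gamma>'"
  shows "coset_index x = i"
  using coset_index_unique[OF assms(1)] coset_index[OF assms(1)] assms by blast

lemma coset_index_eq_iff:
  assumes "x \<in> carrier \<Gamma>" "y \<in> carrier \<Gamma>"
  shows "coset_index x = coset_index y \<longleftrightarrow> inv x \<otimes> y \<in> \<Gamma>'"
proof
  assume "coset_index x = coset_index y"
  then show "inv x \<otimes> y \<in> \<Gamma>'"
    using \<Gamma>'_trans \<Gamma>'_sym coset_index coset_rep_carrier assms by metis
next
  assume *: "inv x \<otimes> y \<in> \<Gamma>'"
  have "inv (coset_rep (coset_index x)) \<otimes> y \<in> \<Gamma>'"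
    using \<Gamma>'_trans[OF coset_index(2)[OF assms(1)] *] coset_rep_carrier coset_index assms by blast
  then show "coset_index x = coset_index y"
    using coset_index_eqI[OF assms(2)] coset_index(1)[OF assms(1)] by simp
qed

lemma coset_index_rep: "i < num_cosets \<Longrightarrow> coset_index (coset_rep i) = i"
  by (rule coset_index_eqI) (auto simp: coset_rep_carrier \<Gamma>'_one)

lemma coset_index_mult_right:
  "x \<in> carrier \<Gamma> \<Longrightarrow> \<tau> \<in> \<Gamma>' \<Longrightarrow> coset_index (x \<otimes> \<tau>) = coset_index x"
  using coset_index_eq_iff[of x "x \<otimes> \<tau>"] \<Gamma>'_carrier by (simp add: m_assoc[symmetric])

lemma coset_index_mult_left:
  assumes "g \<in> carrier \<Gamma>" "x \<in> carrier \<Gamma>"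
  shows "coset_index (g \<otimes> x) = coset_index (g \<otimes> coset_rep (coset_index x))"
proof -
  have r: "coset_rep (coset_index x) \<in> carrier \<Gamma>" using assms coset_index coset_rep_carrier by blast
  have "inv (g \<otimes> coset_rep (coset_index x)) \<otimes> (g \<otimes> x) = inv (coset_rep (coset_index x)) \<otimes> x"
    using assms r by (simp add: inv_mult_group m_assoc) (simp add: m_assoc[symmetric])
  then have "coset_index (g \<otimes> coset_rep (coset_index x)) = coset_index (g \<otimes> x)"
    using coset_index_eq_iff assms r coset_index(2)[OF assms(2)] by simp
  then show ?thesis by simp
qed

lemma sum_carrier_cosets:
  "(\<Sum>x\<in>carrier \<Gamma>. F x) = (\<Sum>i<num_cosets. \<Sum>\<tau>\<in>\<Gamma>'. F (coset_rep i \<otimes> \<tau>))"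
proof -
  have "(\<Sum>i<num_cosets. \<Sum>\<tau>\<in>\<Gamma>'. F (coset_rep i \<otimes> \<tau>))
      = (\<Sum>(i, \<tau>)\<in>{..<num_cosets} \<times> \<Gamma>'. F (coset_rep i \<otimes> \<tau>))"
    by (rule sum.cartesian_product)
  also have "\<dots> = (\<Sum>x\<in>carrier \<Gamma>. F x)"
  proof (rule sum.reindex_bij_witness[of _
        "\<lambda>x. (coset_index x, inv (coset_rep (coset_index x)) \<otimes> x)" "\<lambda>(i, \<tau>). coset_rep i \<otimes> \<tau>"])
    fix x assume x: "x \<in> carrier \<Gamma>"
    have r: "coset_rep (coset_index x) \<in> carrier \<Gamma>" using x coset_index coset_rep_carrier by blast
    show "(case (coset_index x, inv (coset_rep (coset_index x)) \<otimes> x) of (i, \<tau>) \<Rightarrow> coset_rep i \<otimes> \<tau>) = x"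
      using x r by (simp add: m_assoc[symmetric])
    show "(coset_index x, inv (coset_rep (coset_index x)) \<otimes> x) \<in> {..<num_cosets} \<times> \<Gamma>'"
      using coset_index[OF x] by simp
  next
    fix a assume "a \<in> {..<num_cosets} \<times> \<Gamma>'"
    then obtain i \<tau> where a: "a = (i, \<tau>)" "i < num_cosets" "\<tau> \<in> \<Gamma>'" by auto
    have r: "coset_rep i \<in> carrier \<Gamma>" and \<tau>: "\<tau> \<in> carrier \<Gamma>"
      using a coset_rep_carrier \<Gamma>'_carrier by auto
    have "coset_index (coset_rep i \<otimes> \<tau>) = i"
      using coset_index_mult_right[OF r a(3)] coset_index_rep a by simp
    then show "(coset_index (case a of (i, \<tau>) \<Rightarrow> coset_rep i \<otimes> \<tau>),
          inv (coset_rep (coset_index (case a of (i, \<tau>) \<Rightarrow> coset_rep i \<otimes> \<tau>))) \<otimes>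
          (case a of (i, \<tau>) \<Rightarrow> coset_rep i \<otimes> \<tau>)) = a"
      using a r \<tau> by (simp add: m_assoc[symmetric])
    show "(case a of (i, \<tau>) \<Rightarrow> coset_rep i \<otimes> \<tau>) \<in> carrier \<Gamma>" using a r \<tau> by simp
  qed (auto split: prod.splits)
  finally show ?thesis by simp
qed

definition coset_act :: "'g \<Rightarrow> nat \<Rightarrow> nat" where
  "coset_act g i = coset_index (g \<otimes> coset_rep i)"

lemma coset_act_less: "g \<in> carrier \<Gamma> \<Longrightarrow> i < num_cosets \<Longrightarrow> coset_act g i < num_cosets"
  by (simp add: coset_act_def coset_index coset_rep_carrier)

lemma coset_act_one: "i < num_cosets \<Longrightarrow> coset_act \<one> i = i"
  by (simp add: coset_act_def coset_rep_carrier coset_index_rep)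

lemma coset_act_mult:
  assumes "g \<in> carrier \<Gamma>" "h \<in> carrier \<Gamma>" "i < num_cosets"
  shows "coset_act (g \<otimes> h) i = coset_act g (coset_act h i)"
  using coset_index_mult_left[OF assms(1), of "h \<otimes> coset_rep i"] assms coset_rep_carrier
  by (simp add: coset_act_def m_assoc)

text \<open>The augmentation representation on the sum-zero part of the permutation module, in the basis
  \<open>v\<^sub>i - v\<^sub>0\<close> for \<open>1 \<le> i < num_cosets\<close>; \<open>aug_entry g j i\<close> is the coefficient of \<open>v\<^sub>j\<close> in \<open>g (v\<^sub>i - v\<^sub>0)\<close>.\<close>

definition aug_entry :: "'g \<Rightarrow> nat \<Rightarrow> nat \<Rightarrow> rat" where
  "aug_entry g j i = of_bool (coset_act g i = j) - of_bool (coset_act g 0 = j)"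

definition aug_rep :: "'g \<Rightarrow> rat mat" where
  "aug_rep g = mat (num_cosets - 1) (num_cosets - 1) (\<lambda>(j, i). aug_entry g (Suc j) (Suc i))"

lemma aug_entry_mult:
  assumes "g \<in> carrier \<Gamma>" "h \<in> carrier \<Gamma>" "i < num_cosets"
  shows "aug_entry (g \<otimes> h) k i = (\<Sum>j<num_cosets - 1. aug_entry g k (Suc j) * aug_entry h (Suc j) i)"
proof -
  have "num_cosets = Suc (num_cosets - 1)" using num_cosets_pos by simp
  then have "(\<Sum>j<num_cosets. aug_entry g k j * aug_entry h j i)
      = aug_entry g k 0 * aug_entry h 0 i + (\<Sum>j<num_cosets - 1. aug_entry g k (Suc j) * aug_entry h (Suc j) i)"
    using sum.lessThan_Suc_shift[of "\<lambda>j. aug_entry g k j * aug_entry h j i" "num_cosets - 1"] by simp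
  \<comment> \<open>The basis omits the index \<open>0\<close>, but summing over all cosets changes
    nothing: \<open>aug_entry g k 0\<close> is a coefficient of
    \<open>g (v_0 - v_0)\<close>.\<close>
  moreover have "aug_entry g k 0 = 0" by (simp add: aug_entry_def)
  moreover have pick: "(\<Sum>j<num_cosets. aug_entry g k j * of_bool (l = j)) = aug_entry g k l"
    if "l < num_cosets" for l
    using that by (simp add: of_bool_def if_distrib[of "\<lambda>x. _ * x"] cong: if_cong)
  have "(\<Sum>j<num_cosets. aug_entry g k j * aug_entry h j i)
      = aug_entry g k (coset_act h i) - aug_entry g k (coset_act h 0)"
    unfolding aug_entry_def[of h] right_diff_distrib sum_subtractf
    using pick[OF coset_act_less[OF assms(2,3)]] pick[OF coset_act_less[OF assms(2) num_cosets_pos]] by simp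
  moreover have "\<dots> = aug_entry (g \<otimes> h) k i"
    using coset_act_mult[OF assms(1,2)] assms(3) num_cosets_pos by (simp add: aug_entry_def)
  ultimately show ?thesis by simp
qed

lemma is_rep_aug_rep: "is_rep \<Gamma> (num_cosets - 1) aug_rep"
  unfolding is_rep_def
proof (intro conjI ballI)
  show "aug_rep \<one> = 1\<^sub>m (num_cosets - 1)"
    by (rule eq_matI) (auto simp: aug_rep_def aug_entry_def coset_act_one)
  show "aug_rep (g \<otimes> h) = aug_rep g * aug_rep h" if "g \<in> carrier \<Gamma>" "h \<in> carrier \<Gamma>" for g h
    using that
    by (intro eq_matI) (auto simp: aug_rep_def scalar_prod_def atLeast0LessThan aug_entry_mult intro!: sum.cong)
qed (auto simp: aug_rep_def)

lemma rep_char_aug_rep: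
  assumes g: "g \<in> carrier \<Gamma>"
  shows "rep_char (num_cosets - 1) aug_rep g = aug_char \<Gamma> \<Gamma>' g"
proof -
  let ?m = "num_cosets"
  have Suc: "Suc (?m - 1) = ?m" using num_cosets_pos by simp
  \<comment> \<open>The trace runs over the nonzero indices only. Its two sums lack the index
    \<open>0\<close>, where their terms would agree, so their difference is the number of fixed
    cosets minus \<open>1\<close>.\<close>
  have fix_eq: "(\<Sum>i<?m. of_bool (coset_act g i = i)) =
      of_bool (coset_act g 0 = 0) + (\<Sum>i<?m - 1. of_bool (coset_act g (Suc i) = Suc i) :: rat)"
    using sum.lessThan_Suc_shift[of "\<lambda>i. of_bool (coset_act g i = i) :: rat" "?m - 1"] Suc by simp
  have zero_eq: "(\<Sum>i<?m. of_bool (coset_act g 0 = i)) =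
      of_bool (coset_act g 0 = 0) + (\<Sum>i<?m - 1. of_bool (coset_act g 0 = Suc i) :: rat)"
    using sum.lessThan_Suc_shift[of "\<lambda>i. of_bool (coset_act g 0 = i) :: rat" "?m - 1"] Suc by simp
  have one: "(\<Sum>i<?m. of_bool (coset_act g 0 = i)) = (1 :: rat)"
    using coset_act_less[OF g num_cosets_pos] by (simp add: of_bool_def)
  have "rep_char (?m - 1) aug_rep g = (\<Sum>i<?m. of_bool (coset_act g i = i)) - 1"
    using fix_eq zero_eq one by (simp add: rep_char_def aug_rep_def aug_entry_def sum_subtractf)
  moreover have "ind_char \<Gamma> \<Gamma>' (\<lambda>_. 1) g = (\<Sum>i<?m. of_bool (coset_act g i = i))"
  proof -
    \<comment> \<open>\<open>x\<close> contributes to the induced character exactly when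
      \<open>g\<close> fixes its coset, and each fixed coset is counted
      \<open>card \<Gamma>'\<close> times.\<close>
    have "{x \<in> carrier \<Gamma>. inv x \<otimes> g \<otimes> x \<in> \<Gamma>'} = {x \<in> carrier \<Gamma>. coset_index x = coset_index (g \<otimes> x)}"
      using g by (auto simp: coset_index_eq_iff m_assoc)
    then have "(\<Sum>x\<in>{x \<in> carrier \<Gamma>. inv x \<otimes> g \<otimes> x \<in> \<Gamma>'}. 1::rat)
        = (\<Sum>x\<in>carrier \<Gamma>. of_bool (coset_index x = coset_index (g \<otimes> x)))"
      using finite_carrier by (simp add: sum.If_cases of_bool_def Int_def)
    also have "\<dots> = (\<Sum>i<?m. \<Sum>\<tau>\<in>\<Gamma>'. of_bool (coset_act g i = i))"
      unfolding sum_carrier_cosets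
    proof (intro sum.cong refl)
      fix i \<tau> assume i: "i \<in> {..<?m}" and \<tau>: "\<tau> \<in> \<Gamma>'"
      have r: "coset_rep i \<in> carrier \<Gamma>" using i coset_rep_carrier by simp
      have "g \<otimes> (coset_rep i \<otimes> \<tau>) = g \<otimes> coset_rep i \<otimes> \<tau>"
        using g r \<Gamma>'_carrier[OF \<tau>] by (simp add: m_assoc)
      then have "coset_index (g \<otimes> (coset_rep i \<otimes> \<tau>)) = coset_act g i"
        using coset_index_mult_right[of "g \<otimes> coset_rep i" \<tau>] g r \<tau> by (simp add: coset_act_def)
      moreover have "coset_index (coset_rep i \<otimes> \<tau>) = i"
        using coset_index_mult_right[OF r \<tau>] coset_index_rep i by simp
      ultimately show "of_bool (coset_index (coset_rep i \<otimes> \<tau>) = coset_index (g \<otimes> (coset_rep i \<otimes> \<tau>)))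
          = (of_bool (coset_act g i = i) :: rat)" by auto
    qed
    also have "\<dots> = of_nat (card \<Gamma>') * (\<Sum>i<?m. of_bool (coset_act g i = i))"
      by (simp add: sum_distrib_left)
    finally show ?thesis using card_\<Gamma>'_pos by (simp add: ind_char_def)
  qed
  ultimately show ?thesis by (simp add: aug_char_def)
qed

section \<open>The averaging idempotent and the ideal it generates\<close>

abbreviation e1 :: "'g \<Rightarrow> rat" where
  "e1 \<equiv> avg_idem \<Gamma>'"

lemma e1_A [simp]: "e1 \<in> A"
  using \<Gamma>'_carrier by (auto simp: A_iff avg_idem_def)

lemma conv_e1_apply:
  assumes "x \<in> carrier \<Gamma>"
  shows "(f \<star> e1) x = (\<Sum>\<tau>\<in>\<Gamma>'. f (x \<otimes> \<tau>)) / of_nat (card \<Gamma>')"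
proof -
  have "(f \<star> e1) x = (\<Sum>y\<in>carrier \<Gamma>. f (x \<otimes> inv y) * e1 y)" by (rule conv_apply'[OF assms])
  also have "\<dots> = (\<Sum>y\<in>\<Gamma>'. f (x \<otimes> inv y) * e1 y)"
    by (rule sum.mono_neutral_right) (auto simp: finite_carrier \<Gamma>'_carrier avg_idem_def)
  also have "\<dots> = (\<Sum>y\<in>\<Gamma>'. f (x \<otimes> inv y)) / of_nat (card \<Gamma>')"
    by (simp add: avg_idem_def sum_divide_distrib)
  also have "(\<Sum>y\<in>\<Gamma>'. f (x \<otimes> inv y)) = (\<Sum>y\<in>\<Gamma>'. f (x \<otimes> y))"
    by (rule sum.reindex_bij_witness[of _ "\<lambda>y. inv y" "\<lambda>y. inv y"])
      (auto simp: \<Gamma>'_inv \<Gamma>'_carrier)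
  finally show ?thesis .
qed

lemma central_idempotent_class_fun:
  assumes "central_idempotent (group_alg \<Gamma>) f" "x \<in> carrier \<Gamma>" "y \<in> carrier \<Gamma>"
  shows "f (x \<otimes> y) = f (y \<otimes> x)"
proof -
  have "grp_elt (inv y) \<star> f = f \<star> grp_elt (inv y)"
    using assms by (simp add: central_idempotent_def group_alg_simps)
  then have "(grp_elt (inv y) \<star> f) x = (f \<star> grp_elt (inv y)) x" by simp
  then show ?thesis using assms by (simp add: grp_elt_conv conv_grp_elt)
qed

text \<open>The permutation module on the cosets is \<open>\<rat>[\<Gamma>] e1\<close>, on which a
  central \<open>f\<close> fixing \<open>e1\<close> acts as the identity. Concretely, moving
  \<open>inv s\<close> to the other side by the class function property shows that the matrix entry
  is \<open>card \<Gamma>'\<close> times the coefficient of \<open>f \<star> e1\<close> at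
  \<open>inv s \<otimes> t\<close>.\<close>

lemma sum_central_idempotent_coset_act:
  assumes f: "central_idempotent (group_alg \<Gamma>) f" "f \<star> e1 = e1" and ij: "i < num_cosets" "j < num_cosets"
  shows "(\<Sum>g\<in>carrier \<Gamma>. f g * of_bool (coset_act g i = j)) = of_bool (i = j)"
proof -
  define s t where "s = coset_rep i" and "t = coset_rep j"
  have st: "s \<in> carrier \<Gamma>" "t \<in> carrier \<Gamma>" using ij coset_rep_carrier by (auto simp: s_def t_def)
  have act: "coset_act g i = j \<longleftrightarrow> inv t \<otimes> (g \<otimes> s) \<in> \<Gamma>'" if "g \<in> carrier \<Gamma>" for g
    using coset_index_eq_iff[of t "g \<otimes> s"] st that coset_index_rep[OF ij(2)]
    by (auto simp: coset_act_def s_def t_def)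
  have "(\<Sum>g\<in>carrier \<Gamma>. f g * of_bool (coset_act g i = j))
      = (\<Sum>g\<in>carrier \<Gamma>. f g * of_bool (inv t \<otimes> (g \<otimes> s) \<in> \<Gamma>'))"
    by (rule sum.cong) (auto simp: act)
  also have "\<dots> = (\<Sum>g\<in>carrier \<Gamma>. f (t \<otimes> g) * of_bool (inv t \<otimes> (t \<otimes> g \<otimes> s) \<in> \<Gamma>'))"
    by (rule sum_translate_left[OF st(2), symmetric])
  also have "\<dots> = (\<Sum>g\<in>carrier \<Gamma>. f (t \<otimes> g) * of_bool (g \<otimes> s \<in> \<Gamma>'))"
    using st by (intro sum.cong) (auto simp: m_assoc, auto simp: m_assoc[symmetric])
  also have "\<dots> = (\<Sum>g\<in>carrier \<Gamma>. f (t \<otimes> (g \<otimes> inv s)) * of_bool (g \<otimes> inv s \<otimes> s \<in> \<Gamma>'))"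
    by (rule sum_translate_right[symmetric]) (use st in auto)
  also have "\<dots> = (\<Sum>g\<in>carrier \<Gamma>. f (inv s \<otimes> t \<otimes> g) * of_bool (g \<in> \<Gamma>'))"
  proof (intro sum.cong refl)
    fix g assume g: "g \<in> carrier \<Gamma>"
    have "f (t \<otimes> (g \<otimes> inv s)) = f (inv s \<otimes> (t \<otimes> g))"
      using central_idempotent_class_fun[OF f(1), of "t \<otimes> g" "inv s"] g st by (simp add: m_assoc)
    then show "f (t \<otimes> (g \<otimes> inv s)) * of_bool (g \<otimes> inv s \<otimes> s \<in> \<Gamma>') = f (inv s \<otimes> t \<otimes> g) * of_bool (g \<in> \<Gamma>')"
      using g st by (simp add: m_assoc)
  qed
  also have "\<dots> = (\<Sum>g\<in>\<Gamma>'. f (inv s \<otimes> t \<otimes> g))"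
    using \<Gamma>'_carrier by (intro sum.mono_neutral_cong_right) (auto simp: finite_carrier)
  also have "\<dots> = of_nat (card \<Gamma>') * (f \<star> e1) (inv s \<otimes> t)"
    using st card_\<Gamma>'_pos by (simp add: conv_e1_apply)
  also have "\<dots> = of_bool (inv s \<otimes> t \<in> \<Gamma>')"
    using card_\<Gamma>'_pos unfolding f(2) by (simp add: avg_idem_def)
  also have "inv s \<otimes> t \<in> \<Gamma>' \<longleftrightarrow> i = j"
    using coset_index_eq_iff[OF st] coset_index_rep ij by (simp add: s_def t_def)
  finally show ?thesis .
qed

lemma rep_ext_aug_rep_eq_one:
  assumes f: "central_idempotent (group_alg \<Gamma>) f" "f \<star> e1 = e1"
  shows "rep_ext \<Gamma> (num_cosets - 1) aug_rep f = 1\<^sub>m (num_cosets - 1)"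
proof (rule eq_matI)
  fix j i assume "j < dim_row (1\<^sub>m (num_cosets - 1) :: rat mat)" "i < dim_col (1\<^sub>m (num_cosets - 1) :: rat mat)"
  then have ij: "i < num_cosets - 1" "j < num_cosets - 1" by auto
  have "rep_ext \<Gamma> (num_cosets - 1) aug_rep f $$ (j, i)
      = (\<Sum>g\<in>carrier \<Gamma>. f g * of_bool (coset_act g (Suc i) = Suc j))
        - (\<Sum>g\<in>carrier \<Gamma>. f g * of_bool (coset_act g 0 = Suc j))"
    using ij by (simp add: rep_ext_def aug_rep_def aug_entry_def right_diff_distrib sum_subtractf)
  also have "\<dots> = 1\<^sub>m (num_cosets - 1) $$ (j, i)"
    using ij num_cosets_pos by (subst (1 2) sum_central_idempotent_coset_act[OF f]) auto
  finally show "rep_ext \<Gamma> (num_cosets - 1) aug_rep f $$ (j, i) = 1\<^sub>m (num_cosets - 1) $$ (j, i)" .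
qed (auto simp: rep_ext_def)

abbreviation e :: "'g \<Rightarrow> rat" where
  "e \<equiv> aug_idem \<Gamma> \<Gamma>'"

lemma central_idempotent_e: "central_idempotent (group_alg \<Gamma>) e"
  unfolding aug_idem_def
  by (rule char_idem_characterization(1)[OF is_rep_aug_rep]) (rule rep_char_aug_rep)

lemma e_A [simp]: "e \<in> A" and e_idem: "e \<star> e = e" and e_central: "x \<in> A \<Longrightarrow> e \<star> x = x \<star> e"
  using central_idempotent_e unfolding central_idempotent_iff by blast+

text \<open>\<open>e\<close> is the least central idempotent acting as the identity on the
  augmentation representation. The identity \<open>f\<close> of the ideal acts so as well, whence
  \<open>f \<star> e = e\<close>, and this product lies in the ideal.\<close>

lemma e_mem_ideal: "e \<in> span_prod A ((\<star>) e1 ` A)"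
proof -
  define I where "I = span_prod A ((\<star>) e1 ` A)"
  have "\<exists>f\<in>I. central_idempotent (group_alg \<Gamma>) f \<and> (\<forall>x\<in>I. f \<star> x = x)"
  proof (rule ideal_central_idempotent)
    show "I \<subseteq> A" unfolding I_def by (rule span_prod_least[OF add_closed_A]) simp
    show "add_closed I" unfolding I_def by (rule add_closed_span_prod[OF add_closed_A])
    show "scl c x \<in> I" if "x \<in> I" for c x
    proof (rule span_prod_image[where f = "scl c"])
      show "x \<in> span_prod A ((\<star>) e1 ` A)" using that by (simp add: I_def)
      show "scl c (a \<star> b) \<in> I" if "a \<in> A" "b \<in> (\<star>) e1 ` A" for a b
        unfolding I_def mul_scale_left[symmetric] using that by (intro span_prod_mul) simp_all
    qed (auto simp: I_def scale_right_distrib intro: span_prod.zero span_prod_plus)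
    show "a \<star> x \<in> I" if "a \<in> A" "x \<in> I" for a x
      using that(2) unfolding I_def by (rule span_prod_left) simp
    show "x \<star> a \<in> I" if "a \<in> A" "x \<in> I" for a x
      using that(2) unfolding I_def by (rule span_prod_right) (auto simp: conv_assoc)
  qed
  then obtain f where f: "f \<in> I" "central_idempotent (group_alg \<Gamma>) f" "\<And>x. x \<in> I \<Longrightarrow> f \<star> x = x"
    by blast
  have "grp_elt \<one> \<star> (e1 \<star> grp_elt \<one>) \<in> I"
    unfolding I_def by (intro span_prod_mul imageI) auto
  then have "e1 \<in> I" by simp
  then have "f \<star> e1 = e1" by (rule f(3))
  then have "f \<star> e = e"
    unfolding aug_idem_def
    using char_idem_characterization(2)[OF is_rep_aug_rep, of "aug_char \<Gamma> \<Gamma>'" f] rep_char_aug_rep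
      rep_ext_aug_rep_eq_one f(2) by blast
  moreover have "f \<star> e \<in> I"
    using f(1) unfolding I_def by (rule span_prod_right) (auto simp: conv_assoc)
  ultimately show ?thesis by (simp add: I_def)
qed

end

section \<open>Lattices over the localized integers\<close>

locale Z_local =
  fixes p :: nat
  assumes prime_p: "prime p"
begin

abbreviation Zp :: "rat set" where
  "Zp \<equiv> Z_loc p"

lemma p_rat_nonzero: "of_nat p \<noteq> (0 :: rat)"
  using prime_p by (simp add: prime_gt_0_nat)

lemma ZpI: "\<not> int p dvd b \<Longrightarrow> of_int a / of_int b \<in> Zp"
  by (auto simp: Z_loc_def)

lemma ZpE:
  assumes "x \<in> Zp"
  obtains a b where "x = of_int a / of_int b" "\<not> int p dvd b" "b \<noteq> 0"
  using assms by (auto simp: Z_loc_def)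

lemma Zp_of_int: "of_int a \<in> Zp"
  using ZpI[of 1 a] prime_gt_1_nat[OF prime_p] by simp

lemma Zp_of_nat: "of_nat a \<in> Zp"
  using Zp_of_int[of "int a"] by simp

lemma Zp_0: "0 \<in> Zp" and Zp_1: "1 \<in> Zp"
  using Zp_of_int[of 0] Zp_of_int[of 1] by auto

lemma prime_int_p: "prime (int p)"
  using prime_p by simp

lemma Zp_diff:
  assumes "x \<in> Zp" "y \<in> Zp"
  shows "x - y \<in> Zp"
proof -
  obtain a b c d where *: "x = of_int a / of_int b" "\<not> int p dvd b" "b \<noteq> 0"
      "y = of_int c / of_int d" "\<not> int p dvd d" "d \<noteq> 0"
    by (rule ZpE[OF assms(1)], rule ZpE[OF assms(2)]) blast
  have "x - y = of_int (a * d - c * b) / of_int (b * d)"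
    unfolding *(1,4) using *(3,6) by (simp add: diff_frac_eq)
  moreover have "\<not> int p dvd b * d" using * prime_int_p by (simp add: prime_dvd_mult_iff)
  ultimately show ?thesis using ZpI by metis
qed

lemma Zp_mult:
  assumes "x \<in> Zp" "y \<in> Zp"
  shows "x * y \<in> Zp"
proof -
  obtain a b c d where *: "x = of_int a / of_int b" "\<not> int p dvd b" "b \<noteq> 0"
      "y = of_int c / of_int d" "\<not> int p dvd d" "d \<noteq> 0"
    by (rule ZpE[OF assms(1)], rule ZpE[OF assms(2)]) blast
  have "x * y = of_int (a * c) / of_int (b * d)" using * by simp
  moreover have "\<not> int p dvd b * d" using * prime_int_p by (simp add: prime_dvd_mult_iff)
  ultimately show ?thesis using ZpI by metis
qed

lemma add_closed_Zp: "add_closed Zp"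
  by (rule add_closedI) (auto simp: Zp_0 Zp_diff)

lemma Zp_uminus: "x \<in> Zp \<Longrightarrow> - x \<in> Zp"
  by (rule add_closed_uminus[OF add_closed_Zp])

lemma Zp_sum: "(\<And>i. i \<in> I \<Longrightarrow> f i \<in> Zp) \<Longrightarrow> sum f I \<in> Zp"
  by (rule add_closed_sum[OF add_closed_Zp])

lemma Zp_inverse_p: "1 / of_nat p \<notin> Zp"
proof
  assume "1 / of_nat p \<in> Zp"
  then obtain a b where *: "1 / of_nat p = (of_int a / of_int b :: rat)" "\<not> int p dvd b" "b \<noteq> 0"
    by (rule ZpE)
  then have "of_int b = (of_int (a * int p) :: rat)"
    using p_rat_nonzero by (simp add: field_simps)
  then have "b = a * int p" by (metis of_int_eq_iff)
  then show False using *(2) by simp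
qed

text \<open>The exponent is the multiplicity of \<open>p\<close> in the numerator; the denominator
  is a unit already.\<close>

lemma Zp_power_unit:
  assumes "x \<in> Zp" "x \<noteq> 0"
  shows "\<exists>k u. x = of_nat p ^ k * u \<and> u \<in> Zp \<and> 1 / u \<in> Zp \<and> u \<noteq> 0"
proof -
  obtain a b where ab: "x = of_int a / of_int b" "\<not> int p dvd b" "b \<noteq> 0"
    using assms(1) by (rule ZpE)
  have "a \<noteq> 0" using ab assms(2) by auto
  then obtain c where c: "a = int p ^ multiplicity (int p) a * c" "\<not> int p dvd c"
    using multiplicity_decompose'[of a "int p"] prime_int_p not_prime_unit by metis
  define k where "k = multiplicity (int p) a"
  have "c \<noteq> 0" using c(2) by auto
  have "(of_int a :: rat) = of_nat p ^ k * of_int c"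
    using arg_cong[OF c(1), of "of_int :: int \<Rightarrow> rat"] by (simp add: k_def)
  then have "x = of_nat p ^ k * (of_int c / of_int b)" using ab by simp
  moreover have "of_int c / of_int b \<in> Zp" using ab by (intro ZpI)
  moreover have "1 / (of_int c / of_int b) \<in> Zp" using ZpI[OF c(2), of b] by simp
  ultimately show ?thesis using \<open>c \<noteq> 0\<close> ab(3) by force
qed

text \<open>The denominator is inverted modulo \<open>p\<close>, so the residue field is that of the
  integers, with representatives \<open>n\<close> below \<open>p\<close>.\<close>

lemma Zp_residue:
  assumes "x \<in> Zp"
  shows "\<exists>n<p. \<exists>y\<in>Zp. x = of_nat n + of_nat p * y"
proof -
  obtain a b where ab: "x = of_int a / of_int b" "\<not> int p dvd b" "b \<noteq> 0"
    using assms by (rule ZpE)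
  have "coprime b (int p)"
    using prime_imp_coprime[OF prime_int_p ab(2)] by (simp only: coprime_commute)
  then obtain c where c: "[b * c = 1] (mod int p)" using cong_solve_coprime_int by blast
  define n where "n = nat ((a * c) mod int p)"
  have p0: "int p > 0" using prime_p by (simp add: prime_gt_0_nat)
  have n: "int n = (a * c) mod int p" "n < p"
    using p0 by (auto simp: n_def nat_less_iff)
  have "[b * int n = b * (a * c)] (mod int p)"
    unfolding n(1) by (simp add: cong_def mod_mult_right_eq)
  also have "b * (a * c) = a * (b * c)" by simp
  also have "[a * (b * c) = a * 1] (mod int p)" by (rule cong_scalar_left[OF c])
  finally have "int p dvd a - b * int n" by (simp add: cong_iff_dvd_diff dvd_diff_commute)
  then obtain d where d: "a - b * int n = int p * d" by blast
  have "(of_int a :: rat) = of_int b * of_nat n + of_nat p * of_int d"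
  proof -
    have "a = b * int n + int p * d" using d by simp
    then have "(of_int a :: rat) = of_int (b * int n + int p * d)" by simp
    then show ?thesis by simp
  qed
  then have "x = of_nat n + of_nat p * (of_int d / of_int b)"
    using ab by (simp add: field_simps)
  then show ?thesis using n(2) ZpI[OF ab(2)] by blast
qed

lemma Zp_denominator: "\<exists>m::nat. m > 0 \<and> of_nat m * (x::rat) \<in> Zp"
proof -
  obtain a b where "quotient_of x = (a, b)" by (cases "quotient_of x")
  then have x: "x = of_int a / of_int b" "b > 0"
    using quotient_of_div quotient_of_denom_pos by auto
  then have "of_nat (nat b) * x = of_int a" by simp
  then show ?thesis using x(2) Zp_of_int by (intro exI[of _ "nat b"]) auto
qed

text \<open>Proper submodules are detected by functionals with denominator \<open>p\<close>.
  Deleting the coordinate \<open>x\<close> preserves the hypotheses, so by induction only the unit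
  vector \<open>\<delta>\<close> is in question. If it is missing from \<open>W\<close>, all
  multiples of \<open>\<delta>\<close> in \<open>W\<close> have coefficients divisible by
  \<open>p\<close>, and this yields a functional that is integral on \<open>W\<close> but takes the
  value \<open>1 / p\<close> at \<open>x\<close>.\<close>

lemma submodule_eq_if_dual_integral:
  fixes W :: "('g \<Rightarrow> rat) set"
  assumes "finite X" and "\<And>w x. w \<in> W \<Longrightarrow> w x \<in> Zp" and "\<And>w x. w \<in> W \<Longrightarrow> x \<notin> X \<Longrightarrow> w x = 0"
    and "0 \<in> W" "\<And>a b c. a \<in> W \<Longrightarrow> b \<in> W \<Longrightarrow> c \<in> Zp \<Longrightarrow> (\<lambda>x. a x + c * b x) \<in> W"
    and "\<And>y. (\<And>w. w \<in> W \<Longrightarrow> (\<Sum>x\<in>X. y x * w x) \<in> Zp) \<Longrightarrow> \<forall>x\<in>X. y x \<in> Zp"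
    and "\<And>x. f x \<in> Zp" "\<And>x. x \<notin> X \<Longrightarrow> f x = 0"
  shows "f \<in> W"
  using assms
proof (induction X arbitrary: W f)
  case empty
  then have "f = 0" by (auto simp: fun_eq_iff)
  then show ?case using empty by simp
next
  case (insert x X)
  note W_Zp = insert.prems(1) and W_supp = insert.prems(2) and W_zero = insert.prems(3)
    and W_lin = insert.prems(4) and W_dual = insert.prems(5)
  define cut where "cut w = (\<lambda>z. if z = x then 0 else w z)" for w :: "'g \<Rightarrow> rat"
  define \<delta> where "\<delta> = (\<lambda>z. if z = x then 1 else 0 :: rat)"
  have W': "g \<in> cut ` W" if g: "\<And>z. g z \<in> Zp" "\<And>z. z \<notin> X \<Longrightarrow> g z = 0" for g
  proof (rule insert.IH[OF _ _ _ _ _ g])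
    show "w z \<in> Zp" if "w \<in> cut ` W" for w z
      using that W_Zp Zp_0 by (auto simp: cut_def)
    show "w z = 0" if "w \<in> cut ` W" "z \<notin> X" for w z
      using that W_supp by (auto simp: cut_def)
    show "0 \<in> cut ` W" using W_zero by (auto simp: cut_def image_iff fun_eq_iff intro: bexI[of _ 0])
    show "(\<lambda>z. a z + c * b z) \<in> cut ` W" if "a \<in> cut ` W" "b \<in> cut ` W" "c \<in> Zp" for a b c
    proof -
      obtain a' b' where "a' \<in> W" "b' \<in> W" "a = cut a'" "b = cut b'" using \<open>a \<in> _\<close> \<open>b \<in> _\<close> by auto
      then show ?thesis
        using W_lin[of a' b' c] \<open>c \<in> Zp\<close> by (intro image_eqI[of _ _ "\<lambda>z. a' z + c * b' z"]) (auto simp: cut_def)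
    qed
    show "\<forall>z\<in>X. y z \<in> Zp" if y: "\<And>w. w \<in> cut ` W \<Longrightarrow> (\<Sum>z\<in>X. y z * w z) \<in> Zp" for y
    proof -
      have "\<forall>z\<in>insert x X. (y(x := 0)) z \<in> Zp"
      proof (rule W_dual)
        fix w assume "w \<in> W"
        have "(\<Sum>z\<in>insert x X. (y(x := 0)) z * w z) = (\<Sum>z\<in>X. y z * cut w z)"
          using insert.hyps by (auto simp: cut_def intro!: sum.cong)
        then show "(\<Sum>z\<in>insert x X. (y(x := 0)) z * w z) \<in> Zp" using y \<open>w \<in> W\<close> by simp
      qed
      then show ?thesis using insert.hyps by (auto split: if_splits)
    qed
  qed
  have \<delta>W: "\<delta> \<in> W"
  proof (rule ccontr)
    assume "\<delta> \<notin> W"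
    have in_pZ: "c / of_nat p \<in> Zp" if c: "(\<lambda>z. c * \<delta> z) \<in> W" for c
    proof (cases "c = 0")
      case False
      have "c \<in> Zp" using W_Zp[OF c, of x] by (simp add: \<delta>_def)
      then obtain k u where k: "c = of_nat p ^ k * u" "u \<in> Zp" "1 / u \<in> Zp" "u \<noteq> 0"
        using Zp_power_unit False by blast
      have "k \<noteq> 0"
      proof
        assume "k = 0"
        then have "(\<lambda>z. 0 z + 1 / u * (c * \<delta> z)) = \<delta>" using k by (auto simp: fun_eq_iff)
        then show False using W_lin[OF W_zero c k(3)] \<open>\<delta> \<notin> W\<close> by simp
      qed
      then obtain j where "k = Suc j" using not0_implies_Suc by blast
      then have "c / of_nat p = of_nat p ^ j * u" using k p_rat_nonzero by simp
      then show ?thesis using k(2) Zp_of_nat[of "p ^ j"] Zp_mult by simp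
    qed (simp add: Zp_0)
    have "\<exists>w\<in>W. cut w = (\<lambda>z. if z = g then 1 else 0)" if "g \<in> X" for g
      using W'[of "\<lambda>z. if z = g then 1 else 0"] that by (force simp: Zp_0 Zp_1)
    then obtain b where b: "\<And>g. g \<in> X \<Longrightarrow> b g \<in> W"
      "\<And>g. g \<in> X \<Longrightarrow> cut (b g) = (\<lambda>z. if z = g then 1 else 0)" by metis
    \<comment> \<open>\<open>b g\<close> lifts the unit vector at \<open>g\<close>. Subtracting from
      \<open>w\<close> the matching combination of the \<open>b g\<close> leaves a multiple of
      \<open>\<delta>\<close> in \<open>W\<close>, and \<open>y\<close> computes its coefficient
      divided by \<open>p\<close>.\<close>
    define y where "y = (\<lambda>z. if z = x then 1 / of_nat p else - (b z x / of_nat p))"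
    have "\<forall>z\<in>insert x X. y z \<in> Zp"
    proof (rule W_dual)
      fix w assume w: "w \<in> W"
      have comb: "(\<lambda>z. w z - (\<Sum>g\<in>Y. w g * b g z)) \<in> W" if "Y \<subseteq> X" for Y
        using finite_subset[OF that insert.hyps(1)] that
      proof (induction Y)
        case (insert g Y)
        have "- w g \<in> Zp" using W_Zp[OF w] by (rule Zp_uminus)
        then have "(\<lambda>z. (w z - (\<Sum>g\<in>Y. w g * b g z)) + - w g * b g z) \<in> W"
          using insert b(1) by (intro W_lin) auto
        then show ?case using insert.hyps by (simp add: algebra_simps)
      qed (simp add: w)
      define c where "c = w x - (\<Sum>g\<in>X. w g * b g x)"
      have "(\<lambda>z. w z - (\<Sum>g\<in>X. w g * b g z)) = (\<lambda>z. c * \<delta> z)"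
      proof
        fix z
        show "w z - (\<Sum>g\<in>X. w g * b g z) = c * \<delta> z"
        proof (cases "z = x")
          case False
          have "(\<Sum>g\<in>X. w g * b g z) = (\<Sum>g\<in>X. if g = z then w z else 0)"
          proof (rule sum.cong[OF refl])
            fix g assume "g \<in> X"
            then have "b g z = (if z = g then 1 else 0)" using fun_cong[OF b(2)[of g], of z] False by (simp add: cut_def)
            then show "w g * b g z = (if g = z then w z else 0)" by auto
          qed
          also have "\<dots> = w z" using insert.hyps(1) W_supp[OF w, of z] False by simp
          finally show ?thesis using False by (simp add: \<delta>_def)
        qed (simp add: \<delta>_def c_def)
      qed
      then have "c / of_nat p \<in> Zp" using comb[of X] by (intro in_pZ) simp
      moreover have "(\<Sum>z\<in>insert x X. y z * w z) = c / of_nat p"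
      proof -
        have "(\<Sum>z\<in>X. y z * w z) = - (\<Sum>z\<in>X. w z * b z x) / of_nat p"
          unfolding minus_divide_left[symmetric] sum_divide_distrib sum_negf[symmetric]
          using insert.hyps by (intro sum.cong) (auto simp: y_def)
        then show ?thesis using insert.hyps by (simp add: y_def c_def diff_divide_distrib)
      qed
      ultimately show "(\<Sum>z\<in>insert x X. y z * w z) \<in> Zp" by simp
    qed
    then show False using Zp_inverse_p by (simp add: y_def)
  qed
  have "cut f \<in> cut ` W"
    using insert.prems(6,7) Zp_0 by (intro W') (auto simp: cut_def)
  then obtain w where w: "w \<in> W" "cut f = cut w" by auto
  have "f = (\<lambda>z. w z + (f x - w x) * \<delta> z)"
  proof
    fix z show "f z = w z + (f x - w x) * \<delta> z"
      using fun_cong[OF w(2), of z] by (auto simp: cut_def \<delta>_def split: if_splits)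
  qed
  moreover have "f x - w x \<in> Zp" using insert.prems(6) W_Zp[OF w(1)] by (intro Zp_diff)
  ultimately show ?case using W_lin[OF w(1) \<delta>W] by metis
qed

text \<open>As for submodules of free modules over a principal ideal domain: a vector
  \<open>v\<close> whose value at \<open>x\<close> has the least valuation generates all values at
  \<open>x\<close>, and what is left vanishes there. The bound \<open>m\<close> clears denominators,
  so that valuations are natural numbers and a least one exists.\<close>

lemma bounded_submodule_finitely_generated:
  fixes W :: "('g \<Rightarrow> rat) set" and m :: nat
  assumes "finite X" and "m > 0" and "\<And>w x. w \<in> W \<Longrightarrow> of_nat m * w x \<in> Zp"
    and "\<And>w x. w \<in> W \<Longrightarrow> x \<notin> X \<Longrightarrow> w x = 0"
    and "0 \<in> W" "\<And>a b c. a \<in> W \<Longrightarrow> b \<in> W \<Longrightarrow> c \<in> Zp \<Longrightarrow> (\<lambda>x. a x + c * b x) \<in> W"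
  shows "\<exists>Y. finite Y \<and> Y \<subseteq> W \<and> (\<forall>w\<in>W. \<exists>c. (\<forall>y. c y \<in> Zp) \<and> w = (\<Sum>y\<in>Y. (\<lambda>x. c y * y x)))"
  using assms
proof (induction X arbitrary: W)
  case empty
  then have "\<And>w. w \<in> W \<Longrightarrow> w = 0" by (auto simp: fun_eq_iff)
  then show ?case using Zp_0 by (intro exI[of _ "{}"]) (auto simp: zero_fun_def)
next
  case (insert x X)
  note W_m = insert.prems(2) and W_supp = insert.prems(3) and W_zero = insert.prems(4)
    and W_lin = insert.prems(5)
  define W0 where "W0 = {w \<in> W. w x = 0}"
  have "\<exists>Y. finite Y \<and> Y \<subseteq> W0 \<and> (\<forall>w\<in>W0. \<exists>c. (\<forall>y. c y \<in> Zp) \<and> w = (\<Sum>y\<in>Y. (\<lambda>x. c y * y x)))"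
  proof (rule insert.IH[OF insert.prems(1)])
    show "w z = 0" if "w \<in> W0" "z \<notin> X" for w z
      using that W_supp[of w z] by (cases "z = x") (auto simp: W0_def)
  qed (use W_m W_zero W_lin in \<open>auto simp: W0_def\<close>)
  then obtain Y where Y: "finite Y" "Y \<subseteq> W0"
    "\<And>w. w \<in> W0 \<Longrightarrow> \<exists>c. (\<forall>y. c y \<in> Zp) \<and> w = (\<Sum>y\<in>Y. (\<lambda>x. c y * y x))" by blast
  show ?case
  proof (cases "\<exists>w\<in>W. w x \<noteq> 0")
    case False
    then have "W0 = W" by (auto simp: W0_def)
    then show ?thesis using Y by (intro exI[of _ Y]) auto
  next
    case True
    define val where "val w k \<longleftrightarrow> (\<exists>u. of_nat m * w x = of_nat p ^ k * u \<and> u \<in> Zp \<and> 1 / u \<in> Zp \<and> u \<noteq> 0)"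
      for w :: "'g \<Rightarrow> rat" and k
    have val_ex: "\<exists>k. val w k" if "w \<in> W" "w x \<noteq> 0" for w
      unfolding val_def using Zp_power_unit[OF W_m[OF that(1), of x]] that insert.prems(1) by simp
    have "\<exists>k. \<exists>w\<in>W. w x \<noteq> 0 \<and> val w k" using True val_ex by blast
    then obtain k where k: "\<exists>w\<in>W. w x \<noteq> 0 \<and> val w k" and least: "\<And>j. j < k \<Longrightarrow> \<not> (\<exists>w\<in>W. w x \<noteq> 0 \<and> val w j)"
      using exists_least_iff[of "\<lambda>k. \<exists>w\<in>W. w x \<noteq> 0 \<and> val w k"] by blast
    then obtain v where v: "v \<in> W" "v x \<noteq> 0" "val v k" by blast
    have quot: "w x / v x \<in> Zp" if w: "w \<in> W" for w
    proof (cases "w x = 0")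
      case False
      then obtain j where j: "val w j" using val_ex w by blast
      then have "k \<le> j" using least w False not_le by blast
      obtain u u' where u: "of_nat m * v x = of_nat p ^ k * u" "1 / u \<in> Zp" "u \<noteq> 0"
        "of_nat m * w x = of_nat p ^ j * u'" "u' \<in> Zp"
        using j v(3) by (auto simp: val_def)
      have "w x / v x = (of_nat m * w x) / (of_nat m * v x)" using insert.prems(1) by simp
      also have "\<dots> = of_nat (p ^ (j - k)) * (u' * (1 / u))"
      proof -
        have "of_nat p ^ j = (of_nat p ^ k * of_nat (p ^ (j - k)) :: rat)"
          using \<open>k \<le> j\<close> by (simp add: power_add[symmetric] del: power_diff)
        then show ?thesis unfolding u(1,4) using p_rat_nonzero u(3) by simp
      qed
      also have "\<dots> \<in> Zp" using u by (intro Zp_mult Zp_of_nat)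
      finally show ?thesis .
    qed (simp add: Zp_0)
    have vY: "v \<notin> Y" using v Y(2) by (auto simp: W0_def)
    have "\<exists>c. (\<forall>y. c y \<in> Zp) \<and> w = (\<Sum>y\<in>insert v Y. (\<lambda>x. c y * y x))" if w: "w \<in> W" for w
    proof -
      define d where "d = w x / v x"
      have d: "d \<in> Zp" using quot[OF w] by (simp add: d_def)
      have "(\<lambda>z. w z + (- d) * v z) \<in> W" using w v(1) Zp_uminus[OF d] by (rule W_lin)
      then have "(\<lambda>z. w z + (- d) * v z) \<in> W0" using v(2) by (simp add: W0_def d_def)
      then obtain c where c: "\<forall>y. c y \<in> Zp" "(\<lambda>z. w z + (- d) * v z) = (\<Sum>y\<in>Y. (\<lambda>x. c y * y x))"
        using Y(3) by blast
      have "(\<Sum>y\<in>insert v Y. (\<lambda>x. (c(v := d)) y * y x)) = (\<lambda>z. d * v z) + (\<Sum>y\<in>Y. (\<lambda>x. c y * y x))"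
        using Y(1) vY by (simp, intro sum.cong) auto
      also have "\<dots> = w" unfolding c(2)[symmetric] by (auto simp: fun_eq_iff)
      finally have "w = (\<Sum>y\<in>insert v Y. (\<lambda>x. (c(v := d)) y * y x))" by simp
      moreover have "\<forall>y. (c(v := d)) y \<in> Zp" using c(1) d by simp
      ultimately show ?thesis by blast
    qed
    moreover have "insert v Y \<subseteq> W" using v Y(2) by (auto simp: W0_def)
    ultimately show ?thesis using Y(1) by (intro exI[of _ "insert v Y"]) auto
  qed
qed

end


context finite_group
begin

text \<open>\<open>R\<close>, \<open>O_u\<close> and \<open>B\<close> share the multiplication of
  the group algebra but in general not its unit, so they are not subrings of it. Only carrier and
  unit are replaced.\<close>

definition subalg :: "('g \<Rightarrow> rat) set \<Rightarrow> ('g \<Rightarrow> rat) \<Rightarrow> (rat, 'g \<Rightarrow> rat) module" where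
  "subalg C i = (group_alg \<Gamma>)\<lparr>carrier := C, one := i\<rparr>"

lemma subalg_simps [simp]:
  "carrier (subalg C i) = C" "monoid.mult (subalg C i) = (\<star>)" "ring.add (subalg C i) = (+)"
  "ring.zero (subalg C i) = 0" "monoid.one (subalg C i) = i" "module.smult (subalg C i) = scl"
  by (simp_all add: subalg_def group_alg_simps)

lemma ring_subalg:
  assumes "add_closed C" "\<And>x y. x \<in> C \<Longrightarrow> y \<in> C \<Longrightarrow> x \<star> y \<in> C" "i \<in> C"
    "\<And>x. x \<in> C \<Longrightarrow> i \<star> x = x" "\<And>x. x \<in> C \<Longrightarrow> x \<star> i = x"
  shows "ring (subalg C i)"
proof (rule ringI)
  show "abelian_group (subalg C i)"
    by (rule abelian_groupI)
      (use assms(1) in \<open>auto simp: add_closed_add add_closed_zero add_ac intro: bexI[of _ "- x" for x] add_closed_uminus\<close>)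
  show "monoid (subalg C i)"
    by (rule monoidI) (use assms in \<open>auto simp: conv_assoc\<close>)
qed (auto simp: mul_add_left mul_add_right)

lemma finsum_subalg:
  assumes "ring (subalg C i)" "finite Y" "\<And>y. y \<in> Y \<Longrightarrow> f y \<in> C"
  shows "finsum (subalg C i) f Y = sum f Y"
proof -
  interpret S: ring "subalg C i" by fact
  show ?thesis using assms(2,3)
  proof (induction Y)
    case (insert y Y)
    then show ?case by (subst S.finsum_insert) auto
  qed (use S.finsum_empty in simp)
qed

lemma a_inv_subalg:
  assumes "ring (subalg C i)" "add_closed C" "x \<in> C"
  shows "a_inv (subalg C i) x = - x"
proof -
  interpret S: ring "subalg C i" by fact
  show ?thesis using S.minus_equality[of "- x" x] assms add_closed_uminus[OF assms(2,3)] by simp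
qed

end

section \<open>The lattices \<open>P\<close> and \<open>Q\<close> in the group algebra at a good
  prime\<close>

locale good_prime_setup = finite_group_subgroup \<Gamma> \<Gamma>' + Z_local p
  for \<Gamma> :: "('g, 'm) monoid_scheme" (structure) and \<Gamma>' :: "'g set" and p :: nat +
  assumes good: "good_prime \<Gamma> p (aug_idem \<Gamma> \<Gamma>')"
begin

abbreviation \<Lambda> :: "('g \<Rightarrow> rat) set" where
  "\<Lambda> \<equiv> loc_group_ring p \<Gamma>"

lemma \<Lambda>_iff: "f \<in> \<Lambda> \<longleftrightarrow> f \<in> A \<and> (\<forall>x. f x \<in> Zp)"
  using Zp_0 by (simp add: loc_group_ring_def A_iff) metis

lemma add_closed_\<Lambda>: "add_closed \<Lambda>"
  using add_closed_A by (auto simp: add_closed_def \<Lambda>_iff Zp_0 Zp_diff)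

lemma conv_\<Lambda>: "f \<in> \<Lambda> \<Longrightarrow> g \<in> \<Lambda> \<Longrightarrow> f \<star> g \<in> \<Lambda>"
  unfolding \<Lambda>_iff using conv_outside
  by (auto simp: conv_def group_alg_def Zp_0 intro!: Zp_sum Zp_mult)

lemma scl_\<Lambda>: "c \<in> Zp \<Longrightarrow> f \<in> \<Lambda> \<Longrightarrow> scl c f \<in> \<Lambda>"
  by (auto simp: \<Lambda>_iff) (auto simp: scl_def Zp_mult)

lemma grp_elt_\<Lambda>: "a \<in> carrier \<Gamma> \<Longrightarrow> grp_elt a \<in> \<Lambda>"
  by (auto simp: \<Lambda>_iff) (auto simp: grp_elt_def Zp_0 Zp_1)

lemma e_\<Lambda>: "e \<in> \<Lambda>"
  using good by (simp add: good_prime_def)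

definition R where "R = {x \<in> \<Lambda>. e \<star> x = x}"

text \<open>Because \<open>e\<close> has coefficients in \<open>Zp\<close>, multiplication by
  \<open>e\<close> stays in \<open>\<Lambda>\<close>, and the multiples of \<open>e\<close> there
  are the elements fixed by \<open>e\<close>.\<close>

lemma carrier_loc_corner: "carrier (loc_corner \<Gamma> p e) = R"
proof -
  have "{e \<star> x | x. x \<in> \<Lambda>} = R"
    unfolding R_def using conv_\<Lambda>[OF e_\<Lambda>] e_idem by (auto simp: conv_assoc[symmetric]) metis
  then show ?thesis by (simp add: loc_corner_def corner_def group_alg_simps)
qed

lemma R_A: "x \<in> R \<Longrightarrow> x \<in> A" and R_\<Lambda>: "x \<in> R \<Longrightarrow> x \<in> \<Lambda>"
  by (auto simp: R_def \<Lambda>_iff)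

definition B where "B = {x. e \<star> x = x \<and> x \<star> e = x}"

lemma B_A: "x \<in> B \<Longrightarrow> x \<in> A"
  unfolding B_def by (metis (mono_tags, lifting) conv_A mem_Collect_eq)

lemma B_iff: "x \<in> B \<longleftrightarrow> x \<in> A \<and> e \<star> x = x"
  using B_A e_central by (auto simp: B_def)

lemma R_iff: "x \<in> R \<longleftrightarrow> x \<in> \<Lambda> \<and> x \<in> B"
  by (auto simp: R_def B_iff \<Lambda>_iff)

lemma e_conv_B: "x \<in> A \<Longrightarrow> e \<star> x \<in> B"
  by (simp add: B_iff conv_assoc[symmetric] e_idem)

lemma e_conv_R: "x \<in> \<Lambda> \<Longrightarrow> e \<star> x \<in> R"
  by (simp add: R_iff e_conv_B conv_\<Lambda> e_\<Lambda>) (simp add: \<Lambda>_iff e_conv_B)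

definition u where "u = e \<star> e1"

lemma e1_e1: "e1 \<star> e1 = e1"
proof (rule A_eqI)
  fix x assume x: "x \<in> carrier \<Gamma>"
  have "x \<otimes> \<tau> \<in> \<Gamma>' \<longleftrightarrow> x \<in> \<Gamma>'" if "\<tau> \<in> \<Gamma>'" for \<tau>
    using x that \<Gamma>'_mult \<Gamma>'_inv \<Gamma>'_carrier by (metis inv_solve_right')
  then have "(\<Sum>\<tau>\<in>\<Gamma>'. e1 (x \<otimes> \<tau>)) = (\<Sum>\<tau>\<in>\<Gamma>'. e1 x)"
    by (intro sum.cong) (auto simp: avg_idem_def)
  then show "(e1 \<star> e1) x = e1 x" using x card_\<Gamma>'_pos by (simp add: conv_e1_apply)
qed auto

lemma grp_elt_e1:
  assumes "\<tau> \<in> \<Gamma>'"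
  shows "grp_elt \<tau> \<star> e1 = e1"
proof (rule A_eqI)
  fix x assume x: "x \<in> carrier \<Gamma>"
  have "inv \<tau> \<otimes> x \<in> \<Gamma>' \<longleftrightarrow> x \<in> \<Gamma>'"
    using x assms \<Gamma>'_mult \<Gamma>'_inv \<Gamma>'_carrier by (metis inv_closed inv_inv inv_solve_left' )
  then show "(grp_elt \<tau> \<star> e1) x = e1 x"
    using x assms \<Gamma>'_carrier by (simp add: grp_elt_conv) (simp add: avg_idem_def)
qed auto

lemma e1_expand: "e1 = scl (1 / of_nat (card \<Gamma>')) (\<Sum>\<tau>\<in>\<Gamma>'. grp_elt \<tau>)"
proof
  fix x
  have "(\<Sum>\<tau>\<in>\<Gamma>'. grp_elt \<tau>) x = (if x \<in> \<Gamma>' then 1 else 0)"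
    using finite_\<Gamma>' by (simp add: sum_apply grp_elt_def)
  then show "e1 x = scl (1 / of_nat (card \<Gamma>')) (\<Sum>\<tau>\<in>\<Gamma>'. grp_elt \<tau>) x"
    by (simp add: scl_def avg_idem_def)
qed

lemma invariant_iff:
  assumes "x \<in> A"
  shows "(\<forall>\<tau>\<in>\<Gamma>'. grp_elt \<tau> \<star> x = x) \<longleftrightarrow> e1 \<star> x = x"
proof
  assume *: "\<forall>\<tau>\<in>\<Gamma>'. grp_elt \<tau> \<star> x = x"
  have "e1 \<star> x = scl (1 / of_nat (card \<Gamma>')) (\<Sum>\<tau>\<in>\<Gamma>'. x)"
    using * by (subst e1_expand) (simp add: mul_scale_left mul_sum_left)
  also have "(\<Sum>\<tau>\<in>\<Gamma>'. x) = scl (of_nat (card \<Gamma>')) x"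
    by (auto simp: fun_eq_iff sum_apply scl_def)
  finally show "e1 \<star> x = x" using card_\<Gamma>'_pos by simp
next
  assume *: "e1 \<star> x = x"
  show "\<forall>\<tau>\<in>\<Gamma>'. grp_elt \<tau> \<star> x = x"
  proof
    fix \<tau> assume "\<tau> \<in> \<Gamma>'"
    then have "grp_elt \<tau> \<star> (e1 \<star> x) = e1 \<star> x" by (simp add: conv_assoc[symmetric] grp_elt_e1)
    then show "grp_elt \<tau> \<star> x = x" using * by simp
  qed
qed

lemma u_u: "u \<star> u = u"
proof -
  have "u \<star> u = e \<star> (e1 \<star> e) \<star> e1" by (simp add: u_def conv_assoc)
  also have "\<dots> = (e \<star> e) \<star> (e1 \<star> e1)" by (simp add: e_central[OF e1_A, symmetric] conv_assoc)
  finally show ?thesis by (simp add: e_idem e1_e1 u_def)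
qed

text \<open>Elements of \<open>B\<close> absorb \<open>e\<close>, so \<open>u\<close> and
  \<open>e1\<close> act on them alike. With \<open>u_conv\<close> this identifies \<open>P\<close>
  with \<open>R e1\<close>, and being fixed by \<open>u\<close> with being invariant under
  \<open>\<Gamma>'\<close>.\<close>

lemma conv_u: "x \<in> B \<Longrightarrow> x \<star> u = x \<star> e1"
  unfolding u_def conv_assoc[symmetric] by (simp add: B_def)

lemma u_conv: "x \<in> B \<Longrightarrow> u \<star> x = e1 \<star> x"
  by (simp add: u_def e_central conv_assoc) (simp add: B_def conv_assoc[symmetric] e_central)

definition P where "P = {r \<star> u | r. r \<in> R}"
definition Q where "Q = {y \<in> R. u \<star> y = y}"
definition O_u where "O_u = {z \<in> P. u \<star> z = z}"

lemma denominator_A: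
  assumes "f \<in> A"
  shows "\<exists>m::nat. m > 0 \<and> scl (of_nat m) f \<in> \<Lambda>"
proof -
  have "\<exists>m::nat. m > 0 \<and> (\<forall>x\<in>X. of_nat m * f x \<in> Zp)" if "finite X" for X
    using that
  proof (induction X)
    case empty
    then show ?case by (intro exI[of _ 1]) auto
  next
    case (insert x X)
    then obtain m where m: "m > 0" "\<forall>x\<in>X. of_nat m * f x \<in> Zp" by blast
    obtain k where k: "k > 0" "of_nat k * f x \<in> Zp" using Zp_denominator by blast
    have "of_nat (k * m) * f y = of_nat m * (of_nat k * f y)"
      "of_nat (k * m) * f y = of_nat k * (of_nat m * f y)" for y by simp_all
    then have "\<forall>y\<in>insert x X. of_nat (k * m) * f y \<in> Zp"
      using m k Zp_mult[OF Zp_of_nat] by (metis insert_iff)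
    then show ?case using m k by (intro exI[of _ "k * m"]) auto
  qed
  from this[OF finite_carrier] obtain m where m: "m > 0" "\<forall>x\<in>carrier \<Gamma>. of_nat m * f x \<in> Zp" by blast
  then show ?thesis
    using assms scl_A[OF assms] by (intro exI[of _ m]) (auto simp: loc_group_ring_def scl_def)
qed

lemma denominator_B:
  assumes "x \<in> B"
  shows "\<exists>m::nat. m > 0 \<and> scl (of_nat m) x \<in> R"
proof -
  obtain m :: nat where "m > 0" "scl (of_nat m) x \<in> \<Lambda>" using denominator_A[OF B_A[OF assms]] by blast
  then show ?thesis using assms by (intro exI[of _ m]) (auto simp: R_iff B_def mul_scale_left mul_scale_right)
qed

text \<open>\<open>e\<close> is a sum of products \<open>a e1 b\<close>. As \<open>e\<close> is
  central, \<open>e a e1 b = (e a u) (u b)\<close>, whose factors become elements of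
  \<open>P\<close> and \<open>Q\<close> after clearing denominators. \<open>Z\<close> collects the
  elements for which some multiplier works; for a sum the product of the two multipliers
  does.\<close>

lemma full_idempotent: "\<exists>m::nat. m > 0 \<and> scl (of_nat m) e \<in> span_prod P Q"
proof -
  define Z where "Z = {x. \<exists>m::nat. m > 0 \<and> scl (of_nat m) (e \<star> x) \<in> span_prod P Q}"
  have PQ_nat: "scl (of_nat k) s \<in> span_prod P Q" if "s \<in> span_prod P Q" for s and k :: nat
  proof (induction k)
    case (Suc k)
    have "scl (of_nat (Suc k)) s = s + scl (of_nat k) s"
      by (auto simp: scl_def fun_eq_iff algebra_simps)
    then show ?case using span_prod_plus[OF that Suc] by (simp only:)
  next
    case 0
    have "scl (of_nat 0) s = 0" by (auto simp: scl_def)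
    then show ?case using span_prod.zero by (simp only:)
  qed
  have "e \<in> Z"
  proof (rule span_prod_image[where f = "\<lambda>x. x"])
    show "e \<in> span_prod A ((\<star>) e1 ` A)" by (rule e_mem_ideal)
    show "0 \<in> Z" by (auto simp: Z_def intro: span_prod.zero)
    show "x + y \<in> Z" if "x \<in> Z" "y \<in> Z" for x y
    proof -
      obtain m k :: nat where mk: "m > 0" "scl (of_nat m) (e \<star> x) \<in> span_prod P Q"
        "k > 0" "scl (of_nat k) (e \<star> y) \<in> span_prod P Q" using \<open>x \<in> Z\<close> \<open>y \<in> Z\<close> by (auto simp: Z_def)
      have "scl (of_nat (m * k)) (e \<star> (x + y))
          = scl (of_nat k) (scl (of_nat m) (e \<star> x)) + scl (of_nat m) (scl (of_nat k) (e \<star> y))"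
        by (simp add: mul_add_right scale_right_distrib mult.commute)
      also have "\<dots> \<in> span_prod P Q" by (intro span_prod_plus PQ_nat mk)
      finally show ?thesis using mk by (auto simp: Z_def intro!: exI[of _ "m * k"])
    qed
    fix a b' assume a: "a \<in> A" and "b' \<in> (\<star>) e1 ` A"
    then obtain b where b: "b \<in> A" "b' = e1 \<star> b" by blast
    obtain m :: nat where m: "m > 0" "scl (of_nat m) (e \<star> a) \<in> R" using denominator_B[OF e_conv_B[OF a]] by blast
    have "u \<star> b \<in> B"
      using e_conv_B[of "e1 \<star> b"] by (simp add: u_def conv_assoc)
    then obtain k :: nat where k: "k > 0" "scl (of_nat k) (u \<star> b) \<in> R" using denominator_B by blast
    have "scl (of_nat k) (u \<star> b) \<in> Q"
      using k u_u by (simp add: Q_def mul_scale_right conv_assoc[symmetric])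
    moreover have "scl (of_nat m) (e \<star> a) \<star> u \<in> P" using m by (auto simp: P_def)
    ultimately have "(scl (of_nat m) (e \<star> a) \<star> u) \<star> scl (of_nat k) (u \<star> b) \<in> span_prod P Q"
      by (intro span_prod_mul)
    also have "(scl (of_nat m) (e \<star> a) \<star> u) \<star> scl (of_nat k) (u \<star> b)
        = scl (of_nat (m * k)) ((e \<star> a) \<star> (u \<star> b))"
      by (simp add: mul_scale_left mul_scale_right conv_assoc mult.commute)
        (simp add: conv_assoc[symmetric] conv_assoc[of _ u u] u_u)
    also have "(e \<star> a) \<star> (u \<star> b) = e \<star> (a \<star> b')"
    proof -
      have "(e \<star> a) \<star> (u \<star> b) = (e \<star> a \<star> e) \<star> (e1 \<star> b)" by (simp add: u_def conv_assoc)
      also have "e \<star> a \<star> e = e \<star> a" using e_conv_B[OF a] by (simp add: B_def)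
      finally show ?thesis by (simp add: b conv_assoc)
    qed
    finally show "a \<star> b' \<in> Z" using m k by (auto simp: Z_def intro!: exI[of _ "m * k"])
  qed auto
  then show ?thesis by (simp add: Z_def e_idem)
qed

lemma \<Lambda>_coeff: "f \<in> \<Lambda> \<Longrightarrow> f x \<in> Zp"
  by (simp add: \<Lambda>_iff)

lemma coeff_at_one: "g \<in> carrier \<Gamma> \<Longrightarrow> f g = (f \<star> grp_elt (inv g)) \<one>"
  by (simp add: conv_grp_elt)

text \<open>Let \<open>n\<close> be the order of \<open>\<Gamma>'\<close>. Testing \<open>z\<close>
  against the elements \<open>n u (inv g)\<close> of \<open>Q\<close> shows that \<open>n z\<close>
  has coefficients in \<open>Zp\<close>. Since \<open>z\<close> is constant on left cosets,
  \<open>z = \<sigma> e1\<close> for the element \<open>\<sigma>\<close> that has the coefficients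
  of \<open>n z\<close> on coset representatives and vanishes elsewhere; the factor \<open>n\<close>
  compensates the averaging in \<open>e1\<close>.\<close>

lemma dual_Q_P:
  assumes z: "z \<in> B" "z \<star> u = z" and zQ: "\<And>y. y \<in> Q \<Longrightarrow> z \<star> y \<in> R"
  shows "z \<in> P"
proof -
  let ?n = "of_nat (card \<Gamma>') :: rat"
  have n0: "?n \<noteq> 0" using card_\<Gamma>'_pos by simp
  have Ne1: "scl ?n e1 \<in> \<Lambda>"
    using scl_A[OF e1_A] n0 by (auto simp: loc_group_ring_def scl_def avg_idem_def Zp_0 Zp_1)
  have coeff: "?n * z g \<in> Zp" if g: "g \<in> carrier \<Gamma>" for g
  proof -
    define y where "y = scl ?n u \<star> grp_elt (inv g)"
    have "y = e \<star> (scl ?n e1 \<star> grp_elt (inv g))"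
      by (simp add: y_def u_def mul_scale_left mul_scale_right conv_assoc)
    then have "y \<in> R" using g by (simp add: e_conv_R conv_\<Lambda> Ne1 grp_elt_\<Lambda>)
    moreover have "u \<star> y = y" by (simp add: y_def mul_scale_left mul_scale_right conv_assoc[symmetric] u_u)
    ultimately have "z \<star> y \<in> \<Lambda>" using zQ R_\<Lambda> by (simp add: Q_def)
    moreover have "z \<star> y = scl ?n (z \<star> grp_elt (inv g))"
      by (simp add: y_def mul_scale_left mul_scale_right conv_assoc[symmetric] z(2))
    ultimately have "scl ?n (z \<star> grp_elt (inv g)) \<one> \<in> Zp" using \<Lambda>_coeff by metis
    then show ?thesis using coeff_at_one[OF g, of z] by (simp add: scl_def)
  qed
  define \<sigma> where "\<sigma> = (\<Sum>i<num_cosets. scl (?n * z (coset_rep i)) (grp_elt (coset_rep i)))"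
  have "\<sigma> \<in> \<Lambda>" unfolding \<sigma>_def
    by (intro add_closed_sum[OF add_closed_\<Lambda>] scl_\<Lambda> coeff grp_elt_\<Lambda>) (auto simp: coset_rep_carrier)
  have ze1: "z \<star> e1 = z" using conv_u z by simp
  have "\<sigma> \<star> e1 = z"
  proof (rule A_eqI)
    fix x assume x: "x \<in> carrier \<Gamma>"
    have z_coset: "z (y \<otimes> \<tau>) = z y" if "y \<in> carrier \<Gamma>" "\<tau> \<in> \<Gamma>'" for y \<tau>
    proof -
      have "e1 \<star> grp_elt (inv \<tau>) = e1"
      proof (rule A_eqI)
        fix x assume x: "x \<in> carrier \<Gamma>"
        have "x \<otimes> \<tau> \<in> \<Gamma>' \<longleftrightarrow> x \<in> \<Gamma>'"
          using x that \<Gamma>'_mult \<Gamma>'_inv \<Gamma>'_carrier by (metis inv_solve_right')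
        then show "(e1 \<star> grp_elt (inv \<tau>)) x = e1 x"
          using x that(2) \<Gamma>'_carrier by (simp add: conv_grp_elt) (simp add: avg_idem_def)
      qed (use that \<Gamma>'_carrier in auto)
      then have "z \<star> grp_elt (inv \<tau>) = z" using ze1 by (metis conv_assoc)
      then have "(z \<star> grp_elt (inv \<tau>)) y = z y" by simp
      then show ?thesis using that \<Gamma>'_carrier by (simp add: conv_grp_elt)
    qed
    let ?r = "coset_rep (coset_index x)"
    have r: "?r \<in> carrier \<Gamma>" "inv ?r \<otimes> x \<in> \<Gamma>'" using coset_index x coset_rep_carrier by auto
    have "x = ?r \<otimes> (inv ?r \<otimes> x)" using r x by (simp add: m_assoc[symmetric])
    then have zx: "z x = z ?r" using z_coset r by metis
    have "(\<sigma> \<star> e1) x = (\<Sum>i<num_cosets. ?n * z (coset_rep i) * e1 (inv (coset_rep i) \<otimes> x))"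
    proof -
      have "\<sigma> \<star> e1 = (\<Sum>i<num_cosets. scl (?n * z (coset_rep i)) (grp_elt (coset_rep i) \<star> e1))"
        by (simp only: \<sigma>_def mul_sum_left mul_scale_left)
      then show ?thesis using x by (simp add: sum_apply scl_def grp_elt_conv coset_rep_carrier)
    qed
    also have "\<dots> = (\<Sum>i<num_cosets. if i = coset_index x then z (coset_rep i) else 0)"
    proof (rule sum.cong[OF refl])
      fix i assume i: "i \<in> {..<num_cosets}"
      have "inv (coset_rep i) \<otimes> x \<in> \<Gamma>' \<longleftrightarrow> i = coset_index x"
        using coset_index_eqI[OF x, of i] i r by auto
      then show "?n * z (coset_rep i) * e1 (inv (coset_rep i) \<otimes> x)
          = (if i = coset_index x then z (coset_rep i) else 0)"
        using n0 by (simp add: avg_idem_def)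
    qed
    also have "\<dots> = z x" using coset_index(1)[OF x] zx by simp
    finally show "(\<sigma> \<star> e1) x = z x" .
  qed (use B_A[OF z(1)] in auto)
  then have "(e \<star> \<sigma>) \<star> u = z"
    using z conv_u[OF e_conv_B, of \<sigma>] \<open>\<sigma> \<in> \<Lambda>\<close> by (simp add: \<Lambda>_iff conv_assoc B_def)
  then show ?thesis using e_conv_R[OF \<open>\<sigma> \<in> \<Lambda>\<close>] by (auto simp: P_def)
qed

lemma add_closed_R: "add_closed R"
  using add_closed_\<Lambda> by (auto simp: add_closed_def R_def mul_diff_right)

lemma R_mult: "x \<in> R \<Longrightarrow> y \<in> R \<Longrightarrow> x \<star> y \<in> R"
  by (simp add: R_def conv_\<Lambda> conv_assoc[symmetric])

lemma e_in_R: "e \<in> R"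
  by (simp add: R_def e_\<Lambda> e_idem)

lemma R_scl: "c \<in> Zp \<Longrightarrow> x \<in> R \<Longrightarrow> scl c x \<in> R"
  by (simp add: R_def scl_\<Lambda> mul_scale_right)

text \<open>The form \<open>(x, y) \<mapsto> (x y)(1)\<close> makes \<open>\<Lambda>\<close> self-dual, so the dual of a right ideal \<open>T\<close> of \<open>R\<close>
  is \<open>{x. x T \<subseteq> R}\<close>.\<close>

lemma dual_ideal_R:
  assumes T: "T \<subseteq> R" "add_closed T" and TR: "\<And>t r. t \<in> T \<Longrightarrow> r \<in> R \<Longrightarrow> t \<star> r \<in> T"
    and dual: "\<And>x. x \<in> B \<Longrightarrow> (\<And>t. t \<in> T \<Longrightarrow> x \<star> t \<in> R) \<Longrightarrow> x \<in> R"
  shows "e \<in> T"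
proof -
  define e' where "e' = grp_elt \<one> - e"
  have e'\<Lambda>: "e' \<in> \<Lambda>" unfolding e'_def by (intro add_closed_diff[OF add_closed_\<Lambda>] grp_elt_\<Lambda> e_\<Lambda>) simp
  \<comment> \<open>The duality criterion concerns submodules of the full coordinate lattice
    \<open>\<Lambda>\<close>, so \<open>T\<close> is completed by
    \<open>(1 - e) \<Lambda>\<close>.\<close>
  define W where "W = set_sum T ((\<star>) e' ` \<Lambda>)"
  have T\<Lambda>: "t \<in> \<Lambda>" if "t \<in> T" for t using that T R_\<Lambda> by blast
  have eT: "e \<star> t = t" "t \<star> e = t" if "t \<in> T" for t
    using that T(1) R_iff by (auto simp: B_def subset_iff)
  have e'add: "add_closed ((\<star>) e' ` \<Lambda>)"
  proof (rule add_closedI)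
    show "0 \<in> (\<star>) e' ` \<Lambda>" using add_closed_zero[OF add_closed_\<Lambda>] by (intro image_eqI[of _ _ 0]) auto
    fix x y assume "x \<in> (\<star>) e' ` \<Lambda>" "y \<in> (\<star>) e' ` \<Lambda>"
    then show "x - y \<in> (\<star>) e' ` \<Lambda>"
      using add_closed_diff[OF add_closed_\<Lambda>] by (auto simp: mul_diff_right[symmetric])
  qed
  have W_add: "add_closed W" unfolding W_def by (rule add_closed_set_sum[OF T(2) e'add])
  have T_scl: "scl c t \<in> T" if "c \<in> Zp" "t \<in> T" for c t
    using TR[OF that(2) R_scl[OF that(1) e_in_R]] eT that by (simp add: mul_scale_right)
  have W_scl: "scl c w \<in> W" if "c \<in> Zp" "w \<in> W" for c w
  proof -
    obtain t l where "w = t + e' \<star> l" "t \<in> T" "l \<in> \<Lambda>" using \<open>w \<in> W\<close> by (auto simp: W_def elim!: set_sumE)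
    then show ?thesis
      using that(1) T_scl scl_\<Lambda> unfolding W_def
      by (auto simp: scale_right_distrib mul_scale_right[symmetric] intro!: set_sumI)
  qed
  have W\<Lambda>: "W \<subseteq> \<Lambda>" unfolding W_def
    by (rule set_sum_least[OF add_closed_\<Lambda>]) (use T\<Lambda> conv_\<Lambda>[OF e'\<Lambda>] in auto)
  have TW: "T \<subseteq> W" and e'W: "(\<star>) e' ` \<Lambda> \<subseteq> W"
    unfolding W_def by (rule set_sum_left[OF e'add], rule set_sum_right[OF T(2)])
  have "e \<in> W"
  proof (rule submodule_eq_if_dual_integral[OF finite_carrier])
    show "w x \<in> Zp" if "w \<in> W" for w x using that W\<Lambda> \<Lambda>_coeff by blast
    show "w x = 0" if "w \<in> W" "x \<notin> carrier \<Gamma>" for w x using that W\<Lambda> by (auto simp: \<Lambda>_iff A_iff)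
    show "0 \<in> W" by (rule add_closed_zero[OF W_add])
    show "(\<lambda>x. a x + c * b x) \<in> W" if "a \<in> W" "b \<in> W" "c \<in> Zp" for a b c
      using add_closed_add[OF W_add that(1) W_scl[OF that(3,2)]] by (simp add: scl_def plus_fun_def)
    show "e x \<in> Zp" for x using \<Lambda>_coeff[OF e_\<Lambda>] .
    show "e x = 0" if "x \<notin> carrier \<Gamma>" for x using e_A that by (simp add: A_iff)
    fix y assume y: "\<And>w. w \<in> W \<Longrightarrow> (\<Sum>x\<in>carrier \<Gamma>. y x * w x) \<in> Zp"
    \<comment> \<open>This turns the coordinate pairing of \<open>y\<close> with \<open>w\<close>
      into the coefficient of \<open>x \<star> w\<close> at \<open>\<one>\<close>; right translates
      of \<open>w\<close> recover the other coefficients.\<close>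
    define x where "x = adj y"
    have xA: "x \<in> A" by (simp add: x_def)
    have xw: "(x \<star> w) \<one> \<in> Zp" if "w \<in> W" for w
    proof -
      have "(x \<star> w) \<one> = (\<Sum>g\<in>carrier \<Gamma>. y (inv g) * w (inv g))"
        by (auto simp: conv_apply x_def adj_def intro!: sum.cong)
      also have "\<dots> = (\<Sum>g\<in>carrier \<Gamma>. y g * w g)" by (rule sum_inverse)
      finally show ?thesis using y[OF that] by simp
    qed
    have xw\<Lambda>: "x \<star> w \<in> \<Lambda>" if "w \<in> W" "\<And>g. g \<in> carrier \<Gamma> \<Longrightarrow> w \<star> grp_elt (inv g) \<in> W" for w
    proof -
      have "(x \<star> w) g \<in> Zp" if g: "g \<in> carrier \<Gamma>" for g
        unfolding coeff_at_one[OF g, of "x \<star> w"] conv_assoc using xw \<open>\<And>g. g \<in> carrier \<Gamma> \<Longrightarrow> _\<close> g by blast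
      then show ?thesis by (simp add: loc_group_ring_def)
    qed
    have "x \<star> e \<in> R"
    proof (rule dual)
      show "x \<star> e \<in> B" using e_conv_B[OF xA] e_central[OF xA] by simp
      fix t assume t: "t \<in> T"
      have "x \<star> t \<in> \<Lambda>"
      proof (rule xw\<Lambda>)
        show "t \<in> W" using t TW by blast
        fix g assume g: "g \<in> carrier \<Gamma>"
        have "t \<star> grp_elt (inv g) = t \<star> (e \<star> grp_elt (inv g))" using eT(2)[OF t] by (metis conv_assoc)
        also have "\<dots> \<in> T" using g by (intro TR[OF t] e_conv_R grp_elt_\<Lambda>) simp
        finally show "t \<star> grp_elt (inv g) \<in> W" using TW by blast
      qed
      moreover have "(x \<star> e) \<star> t = x \<star> t" by (simp add: conv_assoc eT(1)[OF t])
      moreover have "(x \<star> e) \<star> t \<in> B"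
        using \<open>x \<star> e \<in> B\<close> eT[OF t] by (simp add: B_iff conv_assoc[symmetric])
      ultimately show "(x \<star> e) \<star> t \<in> R" by (simp add: R_iff)
    qed
    moreover have "x \<star> e' \<in> \<Lambda>"
    proof (rule xw\<Lambda>)
      have "e' \<star> grp_elt \<one> \<in> W" using e'W grp_elt_\<Lambda> by blast
      then show "e' \<in> W" using e'\<Lambda> by (simp add: \<Lambda>_iff)
      show "e' \<star> grp_elt (inv g) \<in> W" if "g \<in> carrier \<Gamma>" for g using e'W grp_elt_\<Lambda> that by blast
    qed
    ultimately have "x \<star> e + x \<star> e' \<in> \<Lambda>" using R_\<Lambda> add_closed_add[OF add_closed_\<Lambda>] by blast
    then have x\<Lambda>: "x \<in> \<Lambda>" using xA by (simp add: mul_add_right[symmetric] e'_def)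
    show "\<forall>g\<in>carrier \<Gamma>. y g \<in> Zp"
    proof
      fix g assume "g \<in> carrier \<Gamma>"
      then have "y g = x (inv g)" by (simp add: x_def adj_def)
      then show "y g \<in> Zp" using \<Lambda>_coeff[OF x\<Lambda>] by simp
    qed
  qed
  \<comment> \<open>Multiplying by \<open>e\<close> removes the component in
    \<open>(1 - e) \<Lambda>\<close> and leaves \<open>e = t\<close>.\<close>
  then obtain t l where tl: "e = t + e' \<star> l" "t \<in> T" "l \<in> \<Lambda>" by (auto simp: W_def elim!: set_sumE)
  have "e \<star> e = e \<star> t + (e \<star> e') \<star> l" by (subst (2) tl(1)) (simp add: mul_add_right conv_assoc)
  moreover have "e \<star> e' = 0" by (simp add: e'_def mul_diff_right e_idem)
  ultimately show ?thesis using eT(1)[OF tl(2)] tl(2) by (simp add: e_idem)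
qed

text \<open>The bound \<open>m\<close> makes \<open>L\<close> finitely generated over
  \<open>Zp\<close>, and \<open>R \<subseteq> L\<close> makes it span \<open>B\<close>, so
  \<open>L\<close> is an order in the sense of \<open>is_order\<close>. What remains is to match
  sums in the record with sums of functions.\<close>

lemma maximal_R:
  assumes L: "L \<subseteq> B" "R \<subseteq> L" "add_closed L" and mul: "\<And>x y. x \<in> L \<Longrightarrow> y \<in> L \<Longrightarrow> x \<star> y \<in> L"
    and m: "(m::nat) > 0" "\<And>x. x \<in> L \<Longrightarrow> scl (of_nat m) x \<in> R"
  shows "L \<subseteq> R"
proof -
  define BB where "BB = subalg B e"
  have addB: "add_closed B" by (rule add_closedI) (auto simp: B_def mul_diff_left mul_diff_right)
  have mulB: "x \<star> y \<in> B" if "x \<in> B" "y \<in> B" for x y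
    using that by (simp add: B_iff conv_assoc[symmetric])
  have eB: "e \<in> B" by (simp add: B_def e_idem)
  have ringB: "ring BB" unfolding BB_def
    by (rule ring_subalg[OF addB mulB eB]) (auto simp: B_def)
  interpret BB: ring BB by fact
  have BB_eq: "corner (group_alg \<Gamma>) e A = BB"
  proof -
    have "{e \<star> x | x. x \<in> A} = B" using e_conv_B B_iff by (auto, metis)
    then show ?thesis by (simp add: corner_def BB_def subalg_def group_alg_simps)
  qed
  have L_scl: "scl c x \<in> L" if "c \<in> Zp" "x \<in> L" for c x
  proof -
    have "scl c e \<star> x \<in> L" using mul[OF _ that(2)] R_scl[OF that(1) e_in_R] L(2) by blast
    then show ?thesis using that(2) L(1) by (auto simp: mul_scale_left B_def)
  qed
  have finsumB: "(\<Oplus>\<^bsub>BB\<^esub>x\<in>Y. c x \<odot>\<^bsub>BB\<^esub> x) = (\<Sum>x\<in>Y. scl (c x) x)" if "finite Y" "Y \<subseteq> B" for Y c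
  proof -
    have "scl (c x) x \<in> B" if "x \<in> Y" for x
      using that \<open>Y \<subseteq> B\<close> by (auto simp: B_def mul_scale_left mul_scale_right)
    then show ?thesis
      using finsum_subalg[OF ringB[unfolded BB_def] that(1), of "\<lambda>x. scl (c x) x"] by (simp add: BB_def)
  qed
  have "is_order p BB L"
    unfolding is_order_def
  proof (intro conjI)
    show "subring L BB"
    proof (rule BB.subringI)
      show "L \<subseteq> carrier BB" using L by (simp add: BB_def)
      show "\<one>\<^bsub>BB\<^esub> \<in> L" using L e_in_R by (auto simp: BB_def)
      show "\<ominus>\<^bsub>BB\<^esub> h \<in> L" if "h \<in> L" for h
        using a_inv_subalg[OF ringB[unfolded BB_def] addB, of h] that L add_closed_uminus[OF L(3)]
        by (auto simp: BB_def)
      show "h1 \<otimes>\<^bsub>BB\<^esub> h2 \<in> L" "h1 \<oplus>\<^bsub>BB\<^esub> h2 \<in> L" if "h1 \<in> L" "h2 \<in> L" for h1 h2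
        using that mul add_closed_add[OF L(3)] by (auto simp: BB_def)
    qed
    have "\<exists>Y. finite Y \<and> Y \<subseteq> L \<and> (\<forall>w\<in>L. \<exists>c. (\<forall>y. c y \<in> Zp) \<and> w = (\<Sum>y\<in>Y. (\<lambda>x. c y * y x)))"
    proof (rule bounded_submodule_finitely_generated[OF finite_carrier m(1)])
      show "of_nat m * w x \<in> Zp" if "w \<in> L" for w x
        using \<Lambda>_coeff[OF R_\<Lambda>[OF m(2)[OF that]], of x] by (simp add: scl_def)
      show "w x = 0" if "w \<in> L" "x \<notin> carrier \<Gamma>" for w x
        using B_A that L(1) by (auto simp: A_iff)
      show "0 \<in> L" by (rule add_closed_zero[OF L(3)])
      show "(\<lambda>x. a x + c * b x) \<in> L" if "a \<in> L" "b \<in> L" "c \<in> Zp" for a b c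
        using add_closed_add[OF L(3) that(1) L_scl[OF that(3,2)]] by (simp add: scl_def plus_fun_def)
    qed
    then obtain Y where Y: "finite Y" "Y \<subseteq> L"
      "\<And>w. w \<in> L \<Longrightarrow> \<exists>c. (\<forall>y. c y \<in> Zp) \<and> w = (\<Sum>y\<in>Y. (\<lambda>x. c y * y x))" by blast
    have "L = scalar_span Zp BB Y"
    proof
      show "L \<subseteq> scalar_span Zp BB Y"
      proof
        fix w assume "w \<in> L"
        then obtain c where c: "\<forall>y. c y \<in> Zp" "w = (\<Sum>y\<in>Y. scl (c y) y)"
          using Y(3) by (auto simp: scl_def)
        then have "w = (\<Oplus>\<^bsub>BB\<^esub>y\<in>Y. c y \<odot>\<^bsub>BB\<^esub> y)" using finsumB Y L by simp
        then show "w \<in> scalar_span Zp BB Y" unfolding scalar_span_def using Y(1) c(1) by blast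
      qed
      show "scalar_span Zp BB Y \<subseteq> L"
      proof
        fix w assume "w \<in> scalar_span Zp BB Y"
        then obtain Y' c where Y': "finite Y'" "Y' \<subseteq> Y" "c \<in> Y' \<rightarrow> Zp" "w = (\<Oplus>\<^bsub>BB\<^esub>y\<in>Y'. c y \<odot>\<^bsub>BB\<^esub> y)"
          by (auto simp: scalar_span_def)
        then have "w = (\<Sum>y\<in>Y'. scl (c y) y)" using finsumB Y L by auto
        also have "\<dots> \<in> L" using Y' Y by (intro add_closed_sum[OF L(3)] L_scl) auto
        finally show "w \<in> L" .
      qed
    qed
    then show "\<exists>X. finite X \<and> X \<subseteq> L \<and> L = scalar_span Zp BB X" using Y by blast
    show "scalar_span UNIV BB L = carrier BB"
    proof
      show "scalar_span UNIV BB L \<subseteq> carrier BB"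
      proof
        fix w assume "w \<in> scalar_span UNIV BB L"
        then obtain Y' c where Y': "finite Y'" "Y' \<subseteq> L" "w = (\<Oplus>\<^bsub>BB\<^esub>y\<in>Y'. c y \<odot>\<^bsub>BB\<^esub> y)"
          by (auto simp: scalar_span_def)
        then have "w = (\<Sum>y\<in>Y'. scl (c y) y)" using finsumB L by auto
        also have "\<dots> \<in> B"
          using Y' L by (intro add_closed_sum[OF addB]) (auto simp: B_def mul_scale_left mul_scale_right)
        finally show "w \<in> carrier BB" by (simp add: BB_def)
      qed
      show "carrier BB \<subseteq> scalar_span UNIV BB L"
      proof
        fix x assume "x \<in> carrier BB"
        then have x: "x \<in> B" by (simp add: BB_def)
        obtain k :: nat where k: "k > 0" "scl (of_nat k) x \<in> R" using denominator_B[OF x] by blast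
        define w where "w = scl (of_nat k) x"
        have wL: "w \<in> L" using k L by (auto simp: w_def)
        have "x = (\<Sum>y\<in>{w}. scl (1 / of_nat k) y)" using k by (simp add: w_def)
        also have "\<dots> = (\<Oplus>\<^bsub>BB\<^esub>y\<in>{w}. (\<lambda>_. 1 / of_nat k) y \<odot>\<^bsub>BB\<^esub> y)"
          using finsumB[of "{w}" "\<lambda>_. 1 / of_nat k"] wL L by auto
        finally show "x \<in> scalar_span UNIV BB L"
          unfolding scalar_span_def using wL
          by (intro CollectI exI[of _ "{w}"] exI[of _ "\<lambda>_. 1 / of_nat k"] conjI) auto
      qed
    qed
  qed
  moreover have "is_maximal_order p BB R"
    using good unfolding good_prime_def BB_eq carrier_loc_corner by simp
  ultimately show ?thesis using L(2) unfolding is_maximal_order_def by blast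
qed

text \<open>Multiplication by \<open>card \<Gamma>'\<close> makes all coefficients of elements of
  \<open>O_u\<close> integral, so \<open>O_u\<close> is finitely generated over \<open>Zp\<close>.
  Combinations of generators with coefficients below \<open>p\<close> then represent all classes
  modulo \<open>p\<close>.\<close>

lemma residues_O_u:
  "\<exists>X. finite X \<and> X \<subseteq> O_u \<and> (\<forall>z\<in>O_u. \<exists>x\<in>X. \<exists>w\<in>O_u. z = x + scl (of_nat p) w)"
proof -
  let ?n = "card \<Gamma>'"
  have P_scl: "scl c x \<in> P" if "c \<in> Zp" "x \<in> P" for c x
    using that R_scl unfolding P_def by (force simp: mul_scale_left[symmetric])
  have P_add: "x + y \<in> P" if "x \<in> P" "y \<in> P" for x y
    using that add_closed_add[OF add_closed_R] unfolding P_def by (force simp: mul_add_left[symmetric])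
  have O_scl: "scl c x \<in> O_u" if "c \<in> Zp" "x \<in> O_u" for c x
    using that P_scl by (simp add: O_u_def mul_scale_right)
  have O_add: "x + y \<in> O_u" if "x \<in> O_u" "y \<in> O_u" for x y
    using that P_add by (simp add: O_u_def mul_add_right)
  have O_zero: "0 \<in> O_u"
    using add_closed_zero[OF add_closed_R] by (auto simp: O_u_def P_def intro!: exI[of _ 0])
  have O_add_closed: "add_closed O_u"
  proof (rule add_closedI[OF O_zero])
    fix x y assume "x \<in> O_u" "y \<in> O_u"
    then have "x + scl (- 1) y \<in> O_u" using O_add O_scl Zp_uminus[OF Zp_1] by blast
    then show "x - y \<in> O_u" by simp
  qed
  have "\<exists>Y. finite Y \<and> Y \<subseteq> O_u \<and> (\<forall>w\<in>O_u. \<exists>c. (\<forall>y. c y \<in> Zp) \<and> w = (\<Sum>y\<in>Y. (\<lambda>x. c y * y x)))"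
  proof (rule bounded_submodule_finitely_generated[OF finite_carrier card_\<Gamma>'_pos])
    show "of_nat ?n * w x \<in> Zp" if w: "w \<in> O_u" for w x
    proof (cases "x \<in> carrier \<Gamma>")
      case True
      obtain r where r: "w = r \<star> u" "r \<in> R" using w by (auto simp: O_u_def P_def)
      then have "w = r \<star> e1" using conv_u by (simp add: R_iff)
      then have "of_nat ?n * w x = (\<Sum>\<tau>\<in>\<Gamma>'. r (x \<otimes> \<tau>))"
        using True card_\<Gamma>'_pos by (simp add: conv_e1_apply)
      also have "\<dots> \<in> Zp" using r by (intro Zp_sum \<Lambda>_coeff R_\<Lambda>)
      finally show ?thesis .
    next
      case False
      have "w \<in> A" using w by (auto simp: O_u_def P_def)
      then show ?thesis using False by (simp add: A_iff Zp_0)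
    qed
    show "w x = 0" if "w \<in> O_u" "x \<notin> carrier \<Gamma>" for w x
    proof -
      have "w \<in> A" using \<open>w \<in> O_u\<close> by (auto simp: O_u_def P_def)
      then show ?thesis using that by (simp add: A_iff)
    qed
    show "(\<lambda>x. a x + c * b x) \<in> O_u" if "a \<in> O_u" "b \<in> O_u" "c \<in> Zp" for a b c
      using O_add[OF that(1) O_scl[OF that(3,2)]] by (simp add: scl_def plus_fun_def)
  qed (rule O_zero)
  then obtain Y where Y: "finite Y" "Y \<subseteq> O_u"
    "\<And>w. w \<in> O_u \<Longrightarrow> \<exists>c. (\<forall>y. c y \<in> Zp) \<and> w = (\<Sum>y\<in>Y. scl (c y) y)"
    unfolding scl_def by blast
  \<comment> \<open>Coefficient functions are taken extensional on \<open>Y\<close>, as there are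
    only finitely many of those.\<close>
  define X where "X = (\<lambda>n :: ('g \<Rightarrow> rat) \<Rightarrow> nat. \<Sum>y\<in>Y. scl (of_nat (n y)) y) ` (Y \<rightarrow>\<^sub>E {..<p})"
  have "finite X" unfolding X_def using Y(1) by (intro finite_imageI finite_PiE) auto
  moreover have "X \<subseteq> O_u" unfolding X_def
    using Y(2) Zp_of_nat by (auto intro!: add_closed_sum[OF O_add_closed] O_scl)
  moreover have "\<exists>x\<in>X. \<exists>w\<in>O_u. z = x + scl (of_nat p) w" if "z \<in> O_u" for z
  proof -
    obtain c where c: "\<forall>y. c y \<in> Zp" "z = (\<Sum>y\<in>Y. scl (c y) y)" using Y(3)[OF \<open>z \<in> O_u\<close>] by blast
    have "\<forall>y. \<exists>n d. n < p \<and> d \<in> Zp \<and> c y = of_nat n + of_nat p * d" using Zp_residue c(1) by blast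
    then obtain n d where nd: "\<And>y. n y < p" "\<And>y. d y \<in> Zp" "\<And>y. c y = of_nat (n y) + of_nat p * d y"
      by metis
    have "z = (\<Sum>y\<in>Y. scl (of_nat (restrict n Y y)) y) + scl (of_nat p) (\<Sum>y\<in>Y. scl (d y) y)"
      unfolding c(2) scale_sum_right sum.distrib[symmetric]
      by (rule sum.cong) (auto simp: nd(3) scale_left_distrib)
    moreover have "(\<Sum>y\<in>Y. scl (of_nat (restrict n Y y)) y) \<in> X"
      unfolding X_def using nd(1) by (intro image_eqI[of _ _ "restrict n Y"]) auto
    moreover have "(\<Sum>y\<in>Y. scl (d y) y) \<in> O_u"
      using nd(2) Y(2) by (intro add_closed_sum[OF O_add_closed] O_scl) auto
    ultimately show ?thesis by blast
  qed
  ultimately show ?thesis by blast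
qed

lemma scl_card_u: "scl (of_nat (card \<Gamma>')) u \<in> R"
proof -
  have "scl (of_nat (card \<Gamma>')) e1 \<in> \<Lambda>"
    using scl_A[OF e1_A] card_\<Gamma>'_pos by (auto simp: loc_group_ring_def scl_def avg_idem_def Zp_0 Zp_1)
  from e_conv_R[OF this] show ?thesis by (simp add: u_def mul_scale_right)
qed

lemma u_in_B: "u \<in> B"
  unfolding u_def by (rule e_conv_B) simp

lemma R_sub_B: "R \<subseteq> B"
  using R_iff by blast

text \<open>The order of \<open>\<Gamma>'\<close> plays the part of \<open>N\<close>: it clears the
  denominators of \<open>u\<close>.\<close>

sublocale morita_order scl conv p e u R "card \<Gamma>'" B P Q O_u
proof (unfold_locales, fold B_def P_def Q_def, fold O_u_def)
  show "L \<subseteq> R"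
    if "L \<subseteq> B" "R \<subseteq> L" "add_closed L" "\<And>x y. x \<in> L \<Longrightarrow> y \<in> L \<Longrightarrow> x \<star> y \<in> L"
      "0 < m" "\<And>x. x \<in> L \<Longrightarrow> scl (of_nat m) x \<in> R" for L and m :: nat
    by (rule maximal_R) (fact that)+
  show "z \<in> P" if "z \<in> B" "z \<star> u = z" "\<And>y. y \<in> Q \<Longrightarrow> z \<star> y \<in> R" for z
    by (rule dual_Q_P) (fact that)+
  show "e \<in> T"
    if "T \<subseteq> R" "add_closed T" "\<And>t r. t \<in> T \<Longrightarrow> r \<in> R \<Longrightarrow> t \<star> r \<in> T"
      "\<And>x. x \<in> B \<Longrightarrow> (\<And>t. t \<in> T \<Longrightarrow> x \<star> t \<in> R) \<Longrightarrow> x \<in> R" for T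
    by (rule dual_ideal_R) (fact that)+
qed (fact prime_p add_closed_R R_mult R_scl e_in_R R_sub_B u_u u_in_B card_\<Gamma>'_pos scl_card_u
    full_idempotent residues_O_u reflexive)+

end

section \<open>Modules and their invariants\<close>

lemma additive_zero:
  assumes "abelian_group M" "abelian_group N" "h \<in> carrier M \<rightarrow> carrier N"
    and "\<And>x y. x \<in> carrier M \<Longrightarrow> y \<in> carrier M \<Longrightarrow> h (x \<oplus>\<^bsub>M\<^esub> y) = h x \<oplus>\<^bsub>N\<^esub> h y"
  shows "h \<zero>\<^bsub>M\<^esub> = \<zero>\<^bsub>N\<^esub>"
proof -
  interpret M: abelian_group M by fact
  interpret N: abelian_group N by fact
  have "h \<zero>\<^bsub>M\<^esub> \<oplus>\<^bsub>N\<^esub> h \<zero>\<^bsub>M\<^esub> = h \<zero>\<^bsub>M\<^esub>" using assms(4)[of "\<zero>\<^bsub>M\<^esub>" "\<zero>\<^bsub>M\<^esub>"] by simp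
  moreover have "h \<zero>\<^bsub>M\<^esub> \<in> carrier N" using assms(3) by auto
  ultimately show ?thesis by (metis N.add.l_cancel_one)
qed

lemma additive_finsum:
  assumes "abelian_group M" "abelian_group N" "h \<in> carrier M \<rightarrow> carrier N"
    and "\<And>x y. x \<in> carrier M \<Longrightarrow> y \<in> carrier M \<Longrightarrow> h (x \<oplus>\<^bsub>M\<^esub> y) = h x \<oplus>\<^bsub>N\<^esub> h y"
    and "finite I" "\<And>i. i \<in> I \<Longrightarrow> f i \<in> carrier M"
  shows "h (finsum M f I) = (\<Oplus>\<^bsub>N\<^esub>i\<in>I. h (f i))"
  using assms(5,6)
proof (induction I)
  interpret M: abelian_group M by fact
  interpret N: abelian_group N by fact
  case empty
  then show ?case using additive_zero[OF assms(1-4)] by (simp only: M.finsum_empty N.finsum_empty)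
next
  interpret M: abelian_group M by fact
  interpret N: abelian_group N by fact
  case (insert i I)
  have "f \<in> I \<rightarrow> carrier M" "(\<lambda>i. h (f i)) \<in> I \<rightarrow> carrier N" using insert assms(3) by auto
  then show ?case using insert assms(3,4)
    by (simp add: M.finsum_insert N.finsum_insert M.finsum_closed Pi_iff)
qed

lemma mod_homD:
  assumes "h \<in> mod_hom R M N"
  shows "x \<in> carrier M \<Longrightarrow> h x \<in> carrier N"
    and "x \<in> carrier M \<Longrightarrow> y \<in> carrier M \<Longrightarrow> h (x \<oplus>\<^bsub>M\<^esub> y) = h x \<oplus>\<^bsub>N\<^esub> h y"
    and "r \<in> carrier R \<Longrightarrow> x \<in> carrier M \<Longrightarrow> h (r \<odot>\<^bsub>M\<^esub> x) = r \<odot>\<^bsub>N\<^esub> h x"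
  using assms by (auto simp: mod_hom_def)

lemma mod_homI:
  assumes "\<And>x. x \<in> carrier M \<Longrightarrow> h x \<in> carrier N"
    and "\<And>x y. x \<in> carrier M \<Longrightarrow> y \<in> carrier M \<Longrightarrow> h (x \<oplus>\<^bsub>M\<^esub> y) = h x \<oplus>\<^bsub>N\<^esub> h y"
    and "\<And>r x. r \<in> carrier R \<Longrightarrow> x \<in> carrier M \<Longrightarrow> h (r \<odot>\<^bsub>M\<^esub> x) = r \<odot>\<^bsub>N\<^esub> h x"
  shows "h \<in> mod_hom R M N"
  using assms by (auto simp: mod_hom_def)

lemma mod_hom_comp:
  assumes "g \<in> mod_hom R M N" "h \<in> mod_hom R N K"
  shows "(\<lambda>x. h (g x)) \<in> mod_hom R M K"
  by (rule mod_homI) (simp_all add: mod_homD[OF assms(1)] mod_homD[OF assms(2)])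

lemma mod_isomorphic_trans:
  assumes "mod_isomorphic R M N" "mod_isomorphic R N K"
  shows "mod_isomorphic R M K"
proof -
  obtain g h where "g \<in> mod_hom R M N" "bij_betw g (carrier M) (carrier N)"
    and "h \<in> mod_hom R N K" "bij_betw h (carrier N) (carrier K)"
    using assms by (auto simp: mod_isomorphic_def)
  then show ?thesis
    unfolding mod_isomorphic_def using bij_betw_trans[of g "carrier M" "carrier N" h "carrier K"]
    by (intro bexI[OF _ mod_hom_comp[of g R M N h K]]) (simp_all add: comp_def)
qed

lemma mod_hom_cong:
  assumes "g \<in> mod_hom R M N" "\<And>x. x \<in> carrier M \<Longrightarrow> h x = g x"
    and "\<And>x y. x \<in> carrier M \<Longrightarrow> y \<in> carrier M \<Longrightarrow> x \<oplus>\<^bsub>M\<^esub> y \<in> carrier M"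
    and "\<And>r x. r \<in> carrier R \<Longrightarrow> x \<in> carrier M \<Longrightarrow> r \<odot>\<^bsub>M\<^esub> x \<in> carrier M"
  shows "h \<in> mod_hom R M N"
  by (rule mod_homI) (simp_all add: assms mod_homD[OF assms(1)])

lemma mod_hom_inv_into:
  assumes h: "h \<in> mod_hom R M N" "bij_betw h (carrier M) (carrier N)"
    and "\<And>x y. x \<in> carrier M \<Longrightarrow> y \<in> carrier M \<Longrightarrow> x \<oplus>\<^bsub>M\<^esub> y \<in> carrier M"
    and "\<And>r x. r \<in> carrier R \<Longrightarrow> x \<in> carrier M \<Longrightarrow> r \<odot>\<^bsub>M\<^esub> x \<in> carrier M"
  shows "inv_into (carrier M) h \<in> mod_hom R N M"
proof (rule mod_homI)
  let ?k = "inv_into (carrier M) h"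
  have k: "?k y \<in> carrier M" "h (?k y) = y" if "y \<in> carrier N" for y
    using that h(2) by (auto simp: bij_betw_def inv_into_into f_inv_into_f)
  have kh: "?k (h x) = x" if "x \<in> carrier M" for x
    using that h(2) by (auto simp: bij_betw_def)
  show "?k x \<in> carrier M" if "x \<in> carrier N" for x by (rule k[OF that])
  show "?k (x \<oplus>\<^bsub>N\<^esub> y) = ?k x \<oplus>\<^bsub>M\<^esub> ?k y" if "x \<in> carrier N" "y \<in> carrier N" for x y
    using kh[of "?k x \<oplus>\<^bsub>M\<^esub> ?k y"] k that assms(3) mod_homD(2)[OF h(1)] by simp
  show "?k (r \<odot>\<^bsub>N\<^esub> x) = r \<odot>\<^bsub>M\<^esub> ?k x" if "r \<in> carrier R" "x \<in> carrier N" for r x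
    using kh[of "r \<odot>\<^bsub>M\<^esub> ?k x"] k that assms(4) mod_homD(3)[OF h(1)] by simp
qed

text \<open>Transport of structure along an injection; it serves to replace a module of functions by
  one whose elements are natural numbers.\<close>

lemma left_module_transfer:
  fixes b :: "'a \<Rightarrow> 'b" and G :: "('r, 'a) module"
  assumes G: "left_module R G" and b: "inj_on b (carrier G)"
  shows "\<exists>G' :: ('r, 'b) module. left_module R G' \<and> carrier G' = b ` carrier G \<and> b \<in> mod_hom R G G'"
proof -
  interpret left_module R G by fact
  let ?k = "inv_into (carrier G) b"
  define G' :: "('r, 'b) module" where
    "G' = \<lparr>carrier = b ` carrier G, monoid.mult = undefined, monoid.one = undefined, ring.zero = b \<zero>\<^bsub>G\<^esub>,
      ring.add = (\<lambda>x y. b (?k x \<oplus>\<^bsub>G\<^esub> ?k y)), module.smult = (\<lambda>r x. b (r \<odot>\<^bsub>G\<^esub> ?k x))\<rparr>"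
  have kb: "?k (b x) = x" if "x \<in> carrier G" for x using b that by simp
  have "left_module R G'"
  proof (intro left_module.intro left_module_axioms.intro R.ring_axioms abelian_groupI)
    show "\<exists>y\<in>carrier G'. y \<oplus>\<^bsub>G'\<^esub> x = \<zero>\<^bsub>G'\<^esub>" if x: "x \<in> carrier G'" for x
    proof -
      obtain g where g: "x = b g" "g \<in> carrier G" using x by (auto simp: G'_def)
      then show ?thesis
        by (intro bexI[of _ "b (\<ominus>\<^bsub>G\<^esub> g)"]) (auto simp: G'_def kb M.l_neg)
    qed
  qed (auto simp: G'_def kb M.a_ac smult_closed smult_l_distr smult_r_distr smult_assoc smult_one)
  moreover have "carrier G' = b ` carrier G" by (simp add: G'_def)
  moreover have "b \<in> mod_hom R G G'" by (rule mod_homI) (auto simp: G'_def kb)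
  ultimately show ?thesis by blast
qed

context good_prime_setup
begin

abbreviation RR where "RR \<equiv> subalg R e"
abbreviation OU where "OU \<equiv> subalg O_u u"
abbreviation inv_mod where "inv_mod \<equiv> inv_module \<Gamma> \<Gamma>' p"

lemma aug_loc_ring_eq: "aug_loc_ring \<Gamma> \<Gamma>' p = RR"
proof -
  have "carrier (aug_loc_ring \<Gamma> \<Gamma>' p) = R"
    by (simp add: aug_loc_ring_def carrier_loc_corner)
  then show ?thesis
    by (simp add: aug_loc_ring_def loc_corner_def corner_def subalg_def)
qed

lemma P_eq: "P = {r \<star> e1 | r. r \<in> R}"
  unfolding P_def using conv_u R_iff by (metis (lifting))

lemma inv_order_eq: "inv_order \<Gamma> \<Gamma>' p = OU"
proof -
  have "{x. (\<exists>y\<in>R. x = y \<star> e1) \<and> (\<forall>\<tau>\<in>\<Gamma>'. grp_elt \<tau> \<star> x = x)} = O_u"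
  proof -
    have "(\<forall>\<tau>\<in>\<Gamma>'. grp_elt \<tau> \<star> x = x) \<longleftrightarrow> u \<star> x = x" if "x \<in> P" for x
      using invariant_iff[OF B_A[OF P_B[OF that]]] u_conv[OF P_B[OF that]] by simp
    moreover have "(\<exists>y\<in>R. x = y \<star> e1) \<longleftrightarrow> x \<in> P" for x by (auto simp: P_eq)
    ultimately show ?thesis unfolding O_u_def by blast
  qed
  then show ?thesis
    by (simp add: inv_order_def aug_loc_ring_eq group_alg_simps subalg_def u_def)
qed

lemma ring_RR: "ring RR"
  by (rule ring_subalg[OF add_closed_R R_mult e_in_R]) (auto simp: R_iff B_def)

text \<open>An element of \<open>Q\<close> acting as \<open>u\<close> on \<open>u\<close> witnesses that \<open>P\<close> is projective over \<open>R\<close>.\<close>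

lemma q0_exists: "\<exists>q0\<in>Q. q0 \<star> u = u"
proof -
  have "u \<in> (\<lambda>q. q \<star> u) ` Q"
  proof (rule span_prod_image[where f = "\<lambda>x. x", OF u_span_QP])
    show "x \<star> y \<in> (\<lambda>q. q \<star> u) ` Q" if "x \<in> Q" "y \<in> P" for x y
    proof -
      obtain r where "y = r \<star> u" "r \<in> R" using \<open>y \<in> P\<close> by (auto simp: P_def)
      then show ?thesis using mul_Q_R[OF \<open>x \<in> Q\<close>] by (intro image_eqI[of _ _ "x \<star> r"]) (auto simp: conv_assoc)
    qed
    show "0 \<in> (\<lambda>q. q \<star> u) ` Q" using add_closed_zero[OF add_closed_Q] by (intro image_eqI[of _ _ 0]) auto
    show "a + b \<in> (\<lambda>q. q \<star> u) ` Q" if "a \<in> (\<lambda>q. q \<star> u) ` Q" "b \<in> (\<lambda>q. q \<star> u) ` Q" for a b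
    proof -
      obtain x y where "a = x \<star> u" "b = y \<star> u" "x \<in> Q" "y \<in> Q" using \<open>a \<in> _\<close> \<open>b \<in> _\<close> by blast
      then show ?thesis using add_closed_add[OF add_closed_Q]
        by (intro image_eqI[of _ _ "x + y"]) (auto simp: mul_add_left)
    qed
  qed auto
  then show ?thesis by force
qed

lemma inv_mod_simps:
  "carrier (inv_mod G) = {g \<in> carrier G. \<forall>\<tau>\<in>\<Gamma>'. (e \<star> grp_elt \<tau>) \<odot>\<^bsub>G\<^esub> g = g}"
  "ring.add (inv_mod G) = ring.add G" "ring.zero (inv_mod G) = ring.zero G"
  by (simp_all add: inv_module_def group_alg_simps)

lemma e_tau_R: "\<tau> \<in> \<Gamma>' \<Longrightarrow> e \<star> grp_elt \<tau> \<in> R"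
  by (intro e_conv_R grp_elt_\<Lambda> \<Gamma>'_carrier)

context
  fixes G :: "('g \<Rightarrow> rat, 'a) module"
  assumes G: "left_module RR G"
begin

interpretation G: left_module RR G by (rule G)

lemmas smult_facts = G.smult_closed[simplified] G.smult_l_distr[simplified] G.smult_r_distr[simplified]
  G.smult_assoc[simplified] G.smult_one[simplified]

lemma abelian_group_G: "abelian_group G" by (rule G.abelian_group_axioms)

lemma smult_zero_left: "g \<in> carrier G \<Longrightarrow> 0 \<odot>\<^bsub>G\<^esub> g = \<zero>\<^bsub>G\<^esub>"
  using smult_facts(2)[of 0 0 g] smult_facts(1)[of 0 g] add_closed_zero[OF add_closed_R]
  by (metis G.M.add.l_cancel_one add_0)

lemma smult_sum:
  assumes "finite I" "\<And>i. i \<in> I \<Longrightarrow> a i \<in> R" "g \<in> carrier G"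
  shows "sum a I \<odot>\<^bsub>G\<^esub> g = (\<Oplus>\<^bsub>G\<^esub>i\<in>I. a i \<odot>\<^bsub>G\<^esub> g)"
  using assms(1,2)
proof (induction I)
  case empty
  then show ?case using smult_zero_left[OF assms(3)] by (simp only: sum.empty G.M.finsum_empty)
next
  case (insert i I)
  have "sum a I \<in> R" using insert by (intro add_closed_sum[OF add_closed_R]) auto
  then have "(a i + sum a I) \<odot>\<^bsub>G\<^esub> g = a i \<odot>\<^bsub>G\<^esub> g \<oplus>\<^bsub>G\<^esub> sum a I \<odot>\<^bsub>G\<^esub> g"
    using insert assms(3) by (intro smult_facts(2)) auto
  moreover have "(\<Oplus>\<^bsub>G\<^esub>j\<in>insert i I. a j \<odot>\<^bsub>G\<^esub> g) = a i \<odot>\<^bsub>G\<^esub> g \<oplus>\<^bsub>G\<^esub> (\<Oplus>\<^bsub>G\<^esub>j\<in>I. a j \<odot>\<^bsub>G\<^esub> g)"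
    using insert assms(3) smult_facts(1) by (intro G.M.finsum_insert) auto
  ultimately show ?case using insert by (simp only: sum.insert insert_iff simp_thms)
qed

lemma smult_finsum:
  assumes "r \<in> R" "finite I" "\<And>i. i \<in> I \<Longrightarrow> f i \<in> carrier G"
  shows "r \<odot>\<^bsub>G\<^esub> finsum G f I = (\<Oplus>\<^bsub>G\<^esub>i\<in>I. r \<odot>\<^bsub>G\<^esub> f i)"
  by (rule additive_finsum[OF abelian_group_G abelian_group_G])
    (use assms smult_facts in auto)

text \<open>Division by \<open>card \<Gamma>'\<close> may be impossible in \<open>G\<close>, so
  \<open>e1\<close> cannot be applied to \<open>g\<close>. Instead each group element
  \<open>x\<close> is replaced by its coset representative \<open>t x\<close>, which does not change
  its effect on an invariant. By \<open>\<sigma> \<star> e1 = 0\<close> the coefficients of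
  \<open>\<sigma>\<close> sum to zero over each left coset, so nothing remains after the
  replacement.\<close>

lemma annihilates_invariants:
  assumes \<sigma>: "\<sigma> \<in> R" "\<sigma> \<star> e1 = 0" and g: "g \<in> carrier (inv_mod G)"
  shows "\<sigma> \<odot>\<^bsub>G\<^esub> g = \<zero>\<^bsub>G\<^esub>"
proof -
  have gG: "g \<in> carrier G" and inv: "\<And>\<tau>. \<tau> \<in> \<Gamma>' \<Longrightarrow> (e \<star> grp_elt \<tau>) \<odot>\<^bsub>G\<^esub> g = g"
    using g by (auto simp: inv_mod_simps)
  define t where "t x = coset_rep (coset_index x)" for x
  have t: "t x \<in> carrier \<Gamma>" "inv (t x) \<otimes> x \<in> \<Gamma>'" "t x \<otimes> (inv (t x) \<otimes> x) = x" if "x \<in> carrier \<Gamma>" for x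
    using coset_index[OF that] coset_rep_carrier that by (auto simp: t_def m_assoc[symmetric])
  define s where "s = (\<Sum>x\<in>carrier \<Gamma>. scl (\<sigma> x) (grp_elt (t x)))"
  have "s = 0"
  proof -
    have "s = (\<Sum>i<num_cosets. \<Sum>\<tau>\<in>\<Gamma>'. scl (\<sigma> (coset_rep i \<otimes> \<tau>)) (grp_elt (coset_rep i)))"
      unfolding s_def sum_carrier_cosets
      by (intro sum.cong refl) (simp add: t_def coset_index_mult_right coset_rep_carrier coset_index_rep)
    also have "\<dots> = (\<Sum>i<num_cosets. scl (\<Sum>\<tau>\<in>\<Gamma>'. \<sigma> (coset_rep i \<otimes> \<tau>)) (grp_elt (coset_rep i)))"
      by (simp only: scale_sum_left)
    also have "\<dots> = 0"
    proof (rule sum.neutral, intro ballI)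
      fix i assume "i \<in> {..<num_cosets}"
      then have "(\<sigma> \<star> e1) (coset_rep i) = (\<Sum>\<tau>\<in>\<Gamma>'. \<sigma> (coset_rep i \<otimes> \<tau>)) / of_nat (card \<Gamma>')"
        by (intro conv_e1_apply coset_rep_carrier) simp
      then have "(\<Sum>\<tau>\<in>\<Gamma>'. \<sigma> (coset_rep i \<otimes> \<tau>)) = 0" using \<sigma>(2) card_\<Gamma>'_pos by simp
      then show "scl (\<Sum>\<tau>\<in>\<Gamma>'. \<sigma> (coset_rep i \<otimes> \<tau>)) (grp_elt (coset_rep i)) = 0"
        by (simp only: scale_zero_left)
    qed
    finally show ?thesis .
  qed
  \<comment> \<open>Each \<open>a x\<close> has integral coefficients by itself, so the action of
    \<open>\<sigma>\<close> on \<open>g\<close> may be computed summand by summand; every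
    \<open>a x\<close> kills \<open>g\<close>.\<close>
  define a where "a x = e \<star> scl (\<sigma> x) (grp_elt x) - e \<star> scl (\<sigma> x) (grp_elt (t x))" for x
  have "\<sigma> = e \<star> \<sigma> - e \<star> s" using \<sigma>(1) \<open>s = 0\<close> by (simp add: R_def)
  also have "e \<star> \<sigma> = (\<Sum>x\<in>carrier \<Gamma>. e \<star> scl (\<sigma> x) (grp_elt x))"
    by (subst expand[OF R_A[OF \<sigma>(1)]]) (rule mul_sum_right)
  also have "\<dots> - e \<star> s = (\<Sum>x\<in>carrier \<Gamma>. a x)"
    unfolding s_def mul_sum_right a_def sum_subtractf ..
  finally have \<sigma>_eq: "\<sigma> = (\<Sum>x\<in>carrier \<Gamma>. a x)" .
  have coeff: "\<sigma> x \<in> Zp" for x by (rule \<Lambda>_coeff[OF R_\<Lambda>[OF \<sigma>(1)]])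
  have aR: "a x \<in> R" if "x \<in> carrier \<Gamma>" for x
    unfolding a_def using that t(1)[OF that] coeff
    by (intro add_closed_diff[OF add_closed_R] e_conv_R scl_\<Lambda> grp_elt_\<Lambda>)
  have a0: "a x \<odot>\<^bsub>G\<^esub> g = \<zero>\<^bsub>G\<^esub>" if x: "x \<in> carrier \<Gamma>" for x
  proof -
    define b \<tau> where "b = e \<star> scl (\<sigma> x) (grp_elt (t x))" and "\<tau> = inv (t x) \<otimes> x"
    have bR: "b \<in> R" unfolding b_def using t(1)[OF x] coeff by (intro e_conv_R scl_\<Lambda> grp_elt_\<Lambda>)
    have \<tau>: "\<tau> \<in> \<Gamma>'" "t x \<otimes> \<tau> = x" using t[OF x] by (auto simp: \<tau>_def)
    have "b \<star> (e \<star> grp_elt \<tau>) = e \<star> scl (\<sigma> x) (grp_elt x)"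
    proof -
      have "b \<star> (e \<star> grp_elt \<tau>) = (b \<star> e) \<star> grp_elt \<tau>" by (simp add: conv_assoc)
      also have "b \<star> e = b" using bR R_iff by (simp add: B_def)
      also have "b \<star> grp_elt \<tau> = e \<star> scl (\<sigma> x) (grp_elt (t x) \<star> grp_elt \<tau>)"
        by (simp add: b_def mul_scale_left mul_scale_right conv_assoc)
      finally show ?thesis using grp_elt_mult[OF t(1)[OF x] \<Gamma>'_carrier[OF \<tau>(1)]] \<tau>(2) by simp
    qed
    then have "a x + b = b \<star> (e \<star> grp_elt \<tau>)" by (simp add: a_def b_def)
    then have "a x \<odot>\<^bsub>G\<^esub> g \<oplus>\<^bsub>G\<^esub> b \<odot>\<^bsub>G\<^esub> g = b \<odot>\<^bsub>G\<^esub> ((e \<star> grp_elt \<tau>) \<odot>\<^bsub>G\<^esub> g)"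
      using smult_facts(2)[OF aR[OF x] bR gG] smult_facts(4)[OF bR e_tau_R[OF \<tau>(1)] gG] by simp
    then have "a x \<odot>\<^bsub>G\<^esub> g \<oplus>\<^bsub>G\<^esub> b \<odot>\<^bsub>G\<^esub> g = b \<odot>\<^bsub>G\<^esub> g" using inv[OF \<tau>(1)] by simp
    then show ?thesis
      using smult_facts(1)[OF aR[OF x] gG] smult_facts(1)[OF bR gG] by (metis G.M.add.r_cancel_one)
  qed
  have "\<sigma> \<odot>\<^bsub>G\<^esub> g = (\<Oplus>\<^bsub>G\<^esub>x\<in>carrier \<Gamma>. a x \<odot>\<^bsub>G\<^esub> g)"
    by (subst \<sigma>_eq) (rule smult_sum[OF finite_carrier aR gG])
  also have "\<dots> = (\<Oplus>\<^bsub>G\<^esub>x\<in>carrier \<Gamma>. \<zero>\<^bsub>G\<^esub>)"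
    by (rule G.M.finsum_cong') (auto simp: a0)
  finally show ?thesis by (simp add: G.M.finsum_zero)
qed

text \<open>Two choices of \<open>\<sigma>\<close> differ by an element annihilating the invariants,
  so the definite description has a value. The formula covers all of \<open>P\<close>, not only
  \<open>O_u\<close>: it is the pairing of \<open>P\<close> with the invariants, with values in
  \<open>G\<close>.\<close>

lemma inv_smult:
  assumes r: "r \<in> R" and g: "g \<in> carrier (inv_mod G)"
  shows "(r \<star> u) \<odot>\<^bsub>inv_mod G\<^esub> g = r \<odot>\<^bsub>G\<^esub> g"
proof -
  have gG: "g \<in> carrier G" using g by (simp add: inv_mod_simps)
  have "(r \<star> u) \<odot>\<^bsub>inv_mod G\<^esub> g = (THE h. \<exists>\<sigma>\<in>R. r \<star> u = \<sigma> \<star> e1 \<and> h = \<sigma> \<odot>\<^bsub>G\<^esub> g)"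
    by (simp add: inv_module_def aug_loc_ring_eq group_alg_simps)
  also have "\<dots> = r \<odot>\<^bsub>G\<^esub> g"
  proof (rule the_equality)
    show "\<exists>\<sigma>\<in>R. r \<star> u = \<sigma> \<star> e1 \<and> r \<odot>\<^bsub>G\<^esub> g = \<sigma> \<odot>\<^bsub>G\<^esub> g"
      using r conv_u R_iff by blast
    fix h assume "\<exists>\<sigma>\<in>R. r \<star> u = \<sigma> \<star> e1 \<and> h = \<sigma> \<odot>\<^bsub>G\<^esub> g"
    then obtain \<sigma> where \<sigma>: "\<sigma> \<in> R" "r \<star> u = \<sigma> \<star> e1" "h = \<sigma> \<odot>\<^bsub>G\<^esub> g" by blast
    have d: "\<sigma> - r \<in> R" by (rule add_closed_diff[OF add_closed_R \<sigma>(1) r])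
    have "r \<star> u = r \<star> e1" using r conv_u R_iff by blast
    then have "(\<sigma> - r) \<star> e1 = 0" using \<sigma>(2) by (simp add: mul_diff_left)
    then have "(\<sigma> - r) \<odot>\<^bsub>G\<^esub> g = \<zero>\<^bsub>G\<^esub>" by (rule annihilates_invariants[OF d _ g])
    moreover have "((\<sigma> - r) + r) \<odot>\<^bsub>G\<^esub> g = (\<sigma> - r) \<odot>\<^bsub>G\<^esub> g \<oplus>\<^bsub>G\<^esub> r \<odot>\<^bsub>G\<^esub> g"
      by (rule smult_facts(2)[OF d r gG])
    ultimately show "h = r \<odot>\<^bsub>G\<^esub> g" using \<sigma>(3) smult_facts(1)[OF r gG] by simp
  qed
  finally show ?thesis .
qed

lemma Q_smult_inv:
  assumes "q \<in> Q" "g \<in> carrier G"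
  shows "q \<odot>\<^bsub>G\<^esub> g \<in> carrier (inv_mod G)"
proof -
  have "(e \<star> grp_elt \<tau>) \<odot>\<^bsub>G\<^esub> (q \<odot>\<^bsub>G\<^esub> g) = q \<odot>\<^bsub>G\<^esub> g" if \<tau>: "\<tau> \<in> \<Gamma>'" for \<tau>
  proof -
    have "e1 \<star> q = q" using u_conv[OF Q_B[OF assms(1)]] Q_u[OF assms(1)] by simp
    then have "grp_elt \<tau> \<star> q = q" using grp_elt_e1[OF \<tau>] by (metis conv_assoc)
    then have "(e \<star> grp_elt \<tau>) \<star> q = q" using e_left[OF Q_B[OF assms(1)]] by (simp add: conv_assoc)
    then show ?thesis using smult_facts(4)[OF e_tau_R[OF \<tau>] Q_R[OF assms(1)] assms(2)] by simp
  qed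
  then show ?thesis using smult_facts(1)[OF Q_R[OF assms(1)] assms(2)] by (simp add: inv_mod_simps)
qed

lemma inv_smult_closed_G: "x \<in> P \<Longrightarrow> g \<in> carrier (inv_mod G) \<Longrightarrow> x \<odot>\<^bsub>inv_mod G\<^esub> g \<in> carrier G"
  using inv_smult smult_facts(1) by (auto simp: P_def inv_mod_simps)

lemma smult_inv_smult:
  assumes "r \<in> R" "x \<in> P" "g \<in> carrier (inv_mod G)"
  shows "r \<odot>\<^bsub>G\<^esub> (x \<odot>\<^bsub>inv_mod G\<^esub> g) = (r \<star> x) \<odot>\<^bsub>inv_mod G\<^esub> g"
proof -
  obtain s where s: "x = s \<star> u" "s \<in> R" using assms(2) by (auto simp: P_def)
  have "(r \<star> x) \<odot>\<^bsub>inv_mod G\<^esub> g = (r \<star> s) \<odot>\<^bsub>G\<^esub> g"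
    unfolding s(1) conv_assoc[symmetric] by (rule inv_smult[OF R_mult[OF assms(1) s(2)] assms(3)])
  also have "\<dots> = r \<odot>\<^bsub>G\<^esub> (s \<odot>\<^bsub>G\<^esub> g)"
    using assms s by (intro smult_facts(4)) (auto simp: inv_mod_simps)
  finally show ?thesis using inv_smult[OF s(2) assms(3)] s(1) by simp
qed

lemma inv_smult_Q:
  assumes "x \<in> P" "q \<in> Q" "g \<in> carrier G"
  shows "x \<odot>\<^bsub>inv_mod G\<^esub> (q \<odot>\<^bsub>G\<^esub> g) = (x \<star> q) \<odot>\<^bsub>G\<^esub> g"
proof -
  obtain s where s: "x = s \<star> u" "s \<in> R" using assms(1) by (auto simp: P_def)
  have "x \<odot>\<^bsub>inv_mod G\<^esub> (q \<odot>\<^bsub>G\<^esub> g) = s \<odot>\<^bsub>G\<^esub> (q \<odot>\<^bsub>G\<^esub> g)"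
    unfolding s(1) by (rule inv_smult[OF s(2) Q_smult_inv[OF assms(2,3)]])
  also have "\<dots> = (s \<star> q) \<odot>\<^bsub>G\<^esub> g" using smult_facts(4)[OF s(2) Q_R[OF assms(2)] assms(3)] by simp
  also have "s \<star> q = x \<star> q" using s(1) Q_u[OF assms(2)] by (simp add: conv_assoc)
  finally show ?thesis .
qed

lemma inv_smult_inv:
  assumes "z \<in> O_u" "g \<in> carrier (inv_mod G)"
  shows "z \<odot>\<^bsub>inv_mod G\<^esub> g \<in> carrier (inv_mod G)"
proof -
  have "(e \<star> grp_elt \<tau>) \<odot>\<^bsub>G\<^esub> (z \<odot>\<^bsub>inv_mod G\<^esub> g) = z \<odot>\<^bsub>inv_mod G\<^esub> g" if \<tau>: "\<tau> \<in> \<Gamma>'" for \<tau>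
  proof -
    have "e1 \<star> z = z" using u_conv[OF O_B[OF assms(1)]] O_u_left[OF assms(1)] by simp
    then have "grp_elt \<tau> \<star> z = z" using grp_elt_e1[OF \<tau>] by (metis conv_assoc)
    then have "(e \<star> grp_elt \<tau>) \<star> z = z" using e_left[OF O_B[OF assms(1)]] by (simp add: conv_assoc)
    then show ?thesis using smult_inv_smult[OF e_tau_R[OF \<tau>] O_P[OF assms(1)] assms(2)] by simp
  qed
  then show ?thesis using inv_smult_closed_G[OF O_P[OF assms(1)] assms(2)] by (simp add: inv_mod_simps(1))
qed

lemma inv_add_inv:
  assumes "g \<in> carrier (inv_mod G)" "h \<in> carrier (inv_mod G)"
  shows "g \<oplus>\<^bsub>G\<^esub> h \<in> carrier (inv_mod G)"
  using assms smult_facts(3) e_tau_R by (simp add: inv_mod_simps)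

text \<open>Every \<open>k\<close> in \<open>G\<close> equals \<open>sum a_i (b_i k)\<close>, where
  \<open>b_i k\<close> is invariant and \<open>a_i\<close> acts through the pairing of
  \<open>P\<close> with the invariants.\<close>

lemma separation:
  assumes "g \<in> carrier G" "h \<in> carrier G" "\<And>q. q \<in> Q \<Longrightarrow> q \<odot>\<^bsub>G\<^esub> g = q \<odot>\<^bsub>G\<^esub> h"
  shows "g = h"
proof -
  obtain n :: nat and a b where ab: "e = (\<Sum>i<n. a i \<star> b i)"
    "\<And>i. i < n \<Longrightarrow> a i \<in> P" "\<And>i. i < n \<Longrightarrow> b i \<in> Q"
    by (rule span_prod_sum_repr[OF e_span_PQ]) blast
  have repr: "k = (\<Oplus>\<^bsub>G\<^esub>i\<in>{..<n}. a i \<odot>\<^bsub>inv_mod G\<^esub> (b i \<odot>\<^bsub>G\<^esub> k))" if k: "k \<in> carrier G" for k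
  proof -
    have "k = e \<odot>\<^bsub>G\<^esub> k" using smult_facts(5)[OF k] by simp
    also have "\<dots> = (\<Oplus>\<^bsub>G\<^esub>i\<in>{..<n}. (a i \<star> b i) \<odot>\<^bsub>G\<^esub> k)"
      by (subst ab(1)) (use ab mul_P_Q k in \<open>intro smult_sum; simp\<close>)
    also have "\<dots> = (\<Oplus>\<^bsub>G\<^esub>i\<in>{..<n}. a i \<odot>\<^bsub>inv_mod G\<^esub> (b i \<odot>\<^bsub>G\<^esub> k))"
      using ab k Q_smult_inv inv_smult_closed_G smult_facts(1)[OF mul_P_Q]
      by (intro G.M.finsum_cong') (auto simp: inv_smult_Q)
    finally show ?thesis .
  qed
  have "(\<Oplus>\<^bsub>G\<^esub>i\<in>{..<n}. a i \<odot>\<^bsub>inv_mod G\<^esub> (b i \<odot>\<^bsub>G\<^esub> g)) = (\<Oplus>\<^bsub>G\<^esub>i\<in>{..<n}. a i \<odot>\<^bsub>inv_mod G\<^esub> (b i \<odot>\<^bsub>G\<^esub> h))"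
    using ab assms Q_smult_inv inv_smult_closed_G by (intro G.M.finsum_cong') auto
  then show ?thesis using repr[OF assms(1)] repr[OF assms(2)] by simp
qed

lemma abelian_group_inv_mod: "abelian_group (inv_mod G)"
proof (rule abelian_groupI)
  have zeroR: "r \<odot>\<^bsub>G\<^esub> \<zero>\<^bsub>G\<^esub> = \<zero>\<^bsub>G\<^esub>" if "r \<in> R" for r
    by (rule additive_zero[OF abelian_group_G abelian_group_G]) (use that smult_facts in auto)
  show "\<zero>\<^bsub>inv_mod G\<^esub> \<in> carrier (inv_mod G)" using zeroR e_tau_R by (simp add: inv_mod_simps)
  show "\<exists>h\<in>carrier (inv_mod G). h \<oplus>\<^bsub>inv_mod G\<^esub> g = \<zero>\<^bsub>inv_mod G\<^esub>" if g: "g \<in> carrier (inv_mod G)" for g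
  proof (rule bexI)
    have gG: "g \<in> carrier G" using g by (simp add: inv_mod_simps)
    have mR: "- e \<in> R" by (rule add_closed_uminus[OF add_closed_R e_in_R])
    have "(- e + e) \<odot>\<^bsub>G\<^esub> g = (- e) \<odot>\<^bsub>G\<^esub> g \<oplus>\<^bsub>G\<^esub> e \<odot>\<^bsub>G\<^esub> g" by (rule smult_facts(2)[OF mR e_in_R gG])
    then have sum0: "(- e) \<odot>\<^bsub>G\<^esub> g \<oplus>\<^bsub>G\<^esub> g = \<zero>\<^bsub>G\<^esub>"
      using smult_facts(5)[OF gG] smult_zero_left[OF gG] by (simp only: add.left_inverse)
    have eq: "(- u) \<odot>\<^bsub>inv_mod G\<^esub> g = (- e) \<odot>\<^bsub>G\<^esub> g"
      using inv_smult[OF mR g] e_left[OF u_in_B] by (simp add: mul_minus_left)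
    show "(- u) \<odot>\<^bsub>inv_mod G\<^esub> g \<oplus>\<^bsub>inv_mod G\<^esub> g = \<zero>\<^bsub>inv_mod G\<^esub>"
      using sum0 eq by (simp add: inv_mod_simps)
    show "(- u) \<odot>\<^bsub>inv_mod G\<^esub> g \<in> carrier (inv_mod G)"
      by (rule inv_smult_inv[OF add_closed_uminus[OF add_closed_O u_O] g])
  qed
qed (use inv_add_inv G.M.a_ac in \<open>auto simp: inv_mod_simps\<close>)

lemma finsum_inv_mod:
  assumes "finite I" "\<And>i. i \<in> I \<Longrightarrow> f i \<in> carrier (inv_mod G)"
  shows "finsum (inv_mod G) f I = finsum G f I"
  by (rule additive_finsum[OF abelian_group_inv_mod abelian_group_G, where h = "\<lambda>x. x"])
    (use assms in \<open>auto simp: inv_mod_simps\<close>)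

end

section \<open>Full faithfulness of taking invariants\<close>

lemma mod_hom_inv_mod:
  assumes G: "left_module RR G" "left_module RR G'" and h: "h \<in> mod_hom RR G G'"
  shows "h \<in> mod_hom OU (inv_mod G) (inv_mod G')"
proof (rule mod_homI)
  note hD = mod_homD[OF h, simplified]
  show cl: "h x \<in> carrier (inv_mod G')" if "x \<in> carrier (inv_mod G)" for x
    using that hD(1) hD(3)[OF e_tau_R, symmetric] by (simp add: inv_mod_simps)
  show "h (x \<oplus>\<^bsub>inv_mod G\<^esub> y) = h x \<oplus>\<^bsub>inv_mod G'\<^esub> h y"
    if "x \<in> carrier (inv_mod G)" "y \<in> carrier (inv_mod G)" for x y
    using that hD(2) by (simp add: inv_mod_simps)
  show "h (z \<odot>\<^bsub>inv_mod G\<^esub> x) = z \<odot>\<^bsub>inv_mod G'\<^esub> h x"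
    if z: "z \<in> carrier OU" and x: "x \<in> carrier (inv_mod G)" for z x
  proof -
    obtain r where r: "z = r \<star> u" "r \<in> R" using z by (auto simp: O_u_def P_def)
    show ?thesis
      unfolding r(1) inv_smult[OF G(1) r(2) x] inv_smult[OF G(2) r(2) cl[OF x]]
      using hD(3)[OF r(2)] x by (simp add: inv_mod_simps)
  qed
qed

lemma mod_iso_inv_mod:
  assumes G: "left_module RR G" "left_module RR G'" and h: "h \<in> mod_hom RR G G'"
    and bij: "bij_betw h (carrier G) (carrier G')"
  shows "bij_betw h (carrier (inv_mod G)) (carrier (inv_mod G'))"
proof -
  note hD = mod_homD[OF h, simplified]
  have inj: "inj_on h (carrier G)" using bij by (simp add: bij_betw_def)
  have sub: "carrier (inv_mod G) \<subseteq> carrier G" by (auto simp: inv_mod_simps)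
  have "y \<in> h ` carrier (inv_mod G)" if y: "y \<in> carrier (inv_mod G')" for y
  proof -
    have "y \<in> h ` carrier G" using y bij by (auto simp: bij_betw_def inv_mod_simps)
    then obtain x where x: "x \<in> carrier G" "y = h x" by blast
    have "(e \<star> grp_elt \<tau>) \<odot>\<^bsub>G\<^esub> x = x" if \<tau>: "\<tau> \<in> \<Gamma>'" for \<tau>
    proof (rule inj_onD[OF inj])
      show "h ((e \<star> grp_elt \<tau>) \<odot>\<^bsub>G\<^esub> x) = h x"
        using hD(3)[OF e_tau_R[OF \<tau>] x(1)] y x(2) \<tau> by (simp add: inv_mod_simps)
      show "(e \<star> grp_elt \<tau>) \<odot>\<^bsub>G\<^esub> x \<in> carrier G" by (rule smult_facts(1)[OF G(1) e_tau_R[OF \<tau>] x(1)])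
    qed (rule x(1))
    then show ?thesis using x by (auto simp: inv_mod_simps)
  qed
  then show ?thesis
    unfolding bij_betw_def using inj_on_subset[OF inj sub] mod_homD(1)[OF mod_hom_inv_mod[OF G h]] by auto
qed

text \<open>For \<open>q\<close> in \<open>Q\<close> the element \<open>q g\<close> is invariant, so
  \<open>q (h g) = h (q g)\<close> is the same for both maps, and \<open>separation\<close>
  applies.\<close>

lemma hom_eq_if_eq_on_invariants:
  assumes G: "left_module RR G" "left_module RR G'" and h: "h \<in> mod_hom RR G G'" "k \<in> mod_hom RR G G'"
    and eq: "\<And>g. g \<in> carrier (inv_mod G) \<Longrightarrow> h g = k g" and g: "g \<in> carrier G"
  shows "h g = k g"
proof (rule separation[OF G(2)])
  show "h g \<in> carrier G'" "k g \<in> carrier G'" using g mod_homD(1)[OF h(1)] mod_homD(1)[OF h(2)] by auto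
  show "q \<odot>\<^bsub>G'\<^esub> h g = q \<odot>\<^bsub>G'\<^esub> k g" if q: "q \<in> Q" for q
    using mod_homD(3)[OF h(1), of q g] mod_homD(3)[OF h(2), of q g] eq[OF Q_smult_inv[OF G(1) q g]]
      Q_R[OF q] g by simp
qed

text \<open>The decomposition of \<open>e\<close> forces an extension to send \<open>g\<close> to
  \<open>sum a_i (\<phi> (b_i g))\<close>, and this is taken as its definition.\<close>

lemma hom_extends_from_invariants:
  assumes G: "left_module RR G" "left_module RR G'" and \<phi>: "\<phi> \<in> mod_hom OU (inv_mod G) (inv_mod G')"
  shows "\<exists>\<psi>\<in>mod_hom RR G G'. \<forall>g\<in>carrier (inv_mod G). \<psi> g = \<phi> g"
proof -
  note \<phi>D = mod_homD[OF \<phi>, simplified, unfolded inv_mod_simps(2)]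
  note Gf = smult_facts[OF G(1)] and G'f = smult_facts[OF G(2)]
  interpret M: abelian_group G by (rule abelian_group_G[OF G(1)])
  interpret M': abelian_group G' by (rule abelian_group_G[OF G(2)])
  obtain n :: nat and a b where ab: "e = (\<Sum>i<n. a i \<star> b i)"
    "\<And>i. i < n \<Longrightarrow> a i \<in> P" "\<And>i. i < n \<Longrightarrow> b i \<in> Q"
    by (rule span_prod_sum_repr[OF e_span_PQ]) blast
  define \<psi> where "\<psi> g = (\<Oplus>\<^bsub>G'\<^esub>i\<in>{..<n}. a i \<odot>\<^bsub>inv_mod G'\<^esub> \<phi> (b i \<odot>\<^bsub>G\<^esub> g))" for g
  have \<phi>b: "\<phi> (q \<odot>\<^bsub>G\<^esub> g) \<in> carrier (inv_mod G')" if "q \<in> Q" "g \<in> carrier G" for q g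
    by (rule \<phi>D(1)[OF Q_smult_inv[OF G(1) that]])
  have term_closed: "a i \<odot>\<^bsub>inv_mod G'\<^esub> \<phi> (b i \<odot>\<^bsub>G\<^esub> g) \<in> carrier G'" if "i < n" "g \<in> carrier G" for i g
    using that ab \<phi>b by (intro inv_smult_closed_G[OF G(2)]) auto
  have \<psi>_closed: "\<psi> g \<in> carrier G'" if "g \<in> carrier G" for g
    unfolding \<psi>_def using that term_closed by (intro M'.finsum_closed) auto
  \<comment> \<open>This identity characterizes \<open>\<psi> g\<close> independently of the
    decomposition of \<open>e\<close>. It holds because \<open>q \<star> a i\<close> lies in
    \<open>O_u\<close>, over which \<open>\<phi>\<close> is linear. Linearity of
    \<open>\<psi>\<close> and agreement with \<open>\<phi>\<close> then follow by
    \<open>separation\<close>.\<close>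
  have key: "q \<odot>\<^bsub>G'\<^esub> \<psi> g = \<phi> (q \<odot>\<^bsub>G\<^esub> g)" if q: "q \<in> Q" and g: "g \<in> carrier G" for q g
  proof -
    have qa: "q \<star> a i \<in> O_u" if "i < n" for i using mul_Q_P[OF q ab(2)[OF that]] .
    have qab: "q \<star> a i \<star> b i \<in> Q" if "i < n" for i by (rule mul_O_Q[OF qa[OF that] ab(3)[OF that]])
    have "q \<odot>\<^bsub>G'\<^esub> \<psi> g = (\<Oplus>\<^bsub>G'\<^esub>i\<in>{..<n}. q \<odot>\<^bsub>G'\<^esub> (a i \<odot>\<^bsub>inv_mod G'\<^esub> \<phi> (b i \<odot>\<^bsub>G\<^esub> g)))"
      unfolding \<psi>_def using term_closed g Q_R[OF q] by (intro smult_finsum[OF G(2)]) auto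
    also have "\<dots> = (\<Oplus>\<^bsub>G'\<^esub>i\<in>{..<n}. \<phi> ((q \<star> a i \<star> b i) \<odot>\<^bsub>G\<^esub> g))"
    proof (rule M'.finsum_cong')
      show "(\<lambda>i. \<phi> ((q \<star> a i \<star> b i) \<odot>\<^bsub>G\<^esub> g)) \<in> {..<n} \<rightarrow> carrier G'"
        using \<phi>b[OF qab g] by (auto simp: inv_mod_simps)
      fix i assume "i \<in> {..<n}"
      then have i: "i < n" by simp
      have "q \<odot>\<^bsub>G'\<^esub> (a i \<odot>\<^bsub>inv_mod G'\<^esub> \<phi> (b i \<odot>\<^bsub>G\<^esub> g)) = (q \<star> a i) \<odot>\<^bsub>inv_mod G'\<^esub> \<phi> (b i \<odot>\<^bsub>G\<^esub> g)"
        by (rule smult_inv_smult[OF G(2) Q_R[OF q] ab(2)[OF i] \<phi>b[OF ab(3)[OF i] g]])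
      also have "\<dots> = \<phi> ((q \<star> a i) \<odot>\<^bsub>inv_mod G\<^esub> (b i \<odot>\<^bsub>G\<^esub> g))"
        using \<phi>D(3)[OF qa[OF i] Q_smult_inv[OF G(1) ab(3)[OF i] g]] by simp
      also have "(q \<star> a i) \<odot>\<^bsub>inv_mod G\<^esub> (b i \<odot>\<^bsub>G\<^esub> g) = (q \<star> a i \<star> b i) \<odot>\<^bsub>G\<^esub> g"
        by (rule inv_smult_Q[OF G(1) O_P[OF qa[OF i]] ab(3)[OF i] g])
      finally show "q \<odot>\<^bsub>G'\<^esub> (a i \<odot>\<^bsub>inv_mod G'\<^esub> \<phi> (b i \<odot>\<^bsub>G\<^esub> g)) = \<phi> ((q \<star> a i \<star> b i) \<odot>\<^bsub>G\<^esub> g)" .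
    qed simp
    also have "\<dots> = (\<Oplus>\<^bsub>inv_mod G'\<^esub>i\<in>{..<n}. \<phi> ((q \<star> a i \<star> b i) \<odot>\<^bsub>G\<^esub> g))"
      using \<phi>b[OF qab g] by (intro finsum_inv_mod[OF G(2), symmetric]) auto
    also have "\<dots> = \<phi> (\<Oplus>\<^bsub>inv_mod G\<^esub>i\<in>{..<n}. (q \<star> a i \<star> b i) \<odot>\<^bsub>G\<^esub> g)"
      using Q_smult_inv[OF G(1) qab g] mod_homD[OF \<phi>]
      by (intro additive_finsum[OF abelian_group_inv_mod[OF G(1)] abelian_group_inv_mod[OF G(2)], symmetric]) auto
    also have "(\<Oplus>\<^bsub>inv_mod G\<^esub>i\<in>{..<n}. (q \<star> a i \<star> b i) \<odot>\<^bsub>G\<^esub> g) = (\<Oplus>\<^bsub>G\<^esub>i\<in>{..<n}. (q \<star> a i \<star> b i) \<odot>\<^bsub>G\<^esub> g)"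
      using Q_smult_inv[OF G(1) qab g] by (intro finsum_inv_mod[OF G(1)]) auto
    also have "\<dots> = (\<Sum>i<n. q \<star> a i \<star> b i) \<odot>\<^bsub>G\<^esub> g"
      using qab Q_R g by (intro smult_sum[OF G(1), symmetric]) auto
    also have "(\<Sum>i<n. q \<star> a i \<star> b i) = q"
      using e_right[OF Q_B[OF q]] by (simp add: ab(1) mul_sum_right conv_assoc)
    finally show ?thesis .
  qed
  have "\<psi> \<in> mod_hom RR G G'"
  proof (rule mod_homI)
    show "\<psi> x \<in> carrier G'" if "x \<in> carrier G" for x by (rule \<psi>_closed[OF that])
    show "\<psi> (x \<oplus>\<^bsub>G\<^esub> y) = \<psi> x \<oplus>\<^bsub>G'\<^esub> \<psi> y" if x: "x \<in> carrier G" and y: "y \<in> carrier G" for x y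
    proof (rule separation[OF G(2)])
      fix q assume q: "q \<in> Q"
      have "q \<odot>\<^bsub>G'\<^esub> \<psi> (x \<oplus>\<^bsub>G\<^esub> y) = \<phi> (q \<odot>\<^bsub>G\<^esub> x \<oplus>\<^bsub>G\<^esub> q \<odot>\<^bsub>G\<^esub> y)"
        using key[OF q, of "x \<oplus>\<^bsub>G\<^esub> y"] x y Gf(3)[OF Q_R[OF q] x y] by simp
      also have "\<dots> = \<phi> (q \<odot>\<^bsub>G\<^esub> x) \<oplus>\<^bsub>G'\<^esub> \<phi> (q \<odot>\<^bsub>G\<^esub> y)"
        by (rule \<phi>D(2)[OF Q_smult_inv[OF G(1) q x] Q_smult_inv[OF G(1) q y]])
      also have "\<dots> = q \<odot>\<^bsub>G'\<^esub> (\<psi> x \<oplus>\<^bsub>G'\<^esub> \<psi> y)"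
        using key[OF q x] key[OF q y] G'f(3)[OF Q_R[OF q] \<psi>_closed[OF x] \<psi>_closed[OF y]] by simp
      finally show "q \<odot>\<^bsub>G'\<^esub> \<psi> (x \<oplus>\<^bsub>G\<^esub> y) = q \<odot>\<^bsub>G'\<^esub> (\<psi> x \<oplus>\<^bsub>G'\<^esub> \<psi> y)" .
    qed (use x y \<psi>_closed in auto)
    show "\<psi> (r \<odot>\<^bsub>G\<^esub> x) = r \<odot>\<^bsub>G'\<^esub> \<psi> x" if "r \<in> carrier RR" and x: "x \<in> carrier G" for r x
    proof (rule separation[OF G(2)])
      have r: "r \<in> R" using that by simp
      show "\<psi> (r \<odot>\<^bsub>G\<^esub> x) \<in> carrier G'" "r \<odot>\<^bsub>G'\<^esub> \<psi> x \<in> carrier G'"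
        using Gf(1)[OF r x] G'f(1)[OF r] \<psi>_closed x by auto
      fix q assume q: "q \<in> Q"
      have "q \<odot>\<^bsub>G'\<^esub> \<psi> (r \<odot>\<^bsub>G\<^esub> x) = \<phi> (q \<odot>\<^bsub>G\<^esub> (r \<odot>\<^bsub>G\<^esub> x))" by (rule key[OF q Gf(1)[OF r x]])
      also have "\<dots> = \<phi> ((q \<star> r) \<odot>\<^bsub>G\<^esub> x)" using Gf(4)[OF Q_R[OF q] r x] by simp
      also have "\<dots> = (q \<star> r) \<odot>\<^bsub>G'\<^esub> \<psi> x" by (rule key[OF mul_Q_R[OF q r] x, symmetric])
      also have "\<dots> = q \<odot>\<^bsub>G'\<^esub> (r \<odot>\<^bsub>G'\<^esub> \<psi> x)" by (rule G'f(4)[OF Q_R[OF q] r \<psi>_closed[OF x]])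
      finally show "q \<odot>\<^bsub>G'\<^esub> \<psi> (r \<odot>\<^bsub>G\<^esub> x) = q \<odot>\<^bsub>G'\<^esub> (r \<odot>\<^bsub>G'\<^esub> \<psi> x)" .
    qed
  qed
  moreover have "\<psi> g = \<phi> g" if g: "g \<in> carrier (inv_mod G)" for g
  proof (rule separation[OF G(2)])
    have gG: "g \<in> carrier G" using g by (simp add: inv_mod_simps)
    have \<phi>g: "\<phi> g \<in> carrier (inv_mod G')" by (rule \<phi>D(1)[OF g])
    show "\<psi> g \<in> carrier G'" "\<phi> g \<in> carrier G'" using \<psi>_closed[OF gG] \<phi>g by (auto simp: inv_mod_simps)
    fix q assume q: "q \<in> Q"
    have qu: "q \<star> u \<in> O_u" by (rule mul_Q_P[OF q u_P])
    have "q \<odot>\<^bsub>G'\<^esub> \<psi> g = \<phi> ((q \<star> u) \<odot>\<^bsub>inv_mod G\<^esub> g)" using key[OF q gG] inv_smult[OF G(1) Q_R[OF q] g] by simp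
    also have "\<dots> = (q \<star> u) \<odot>\<^bsub>inv_mod G'\<^esub> \<phi> g" by (rule \<phi>D(3)[OF qu g])
    also have "\<dots> = q \<odot>\<^bsub>G'\<^esub> \<phi> g" by (rule inv_smult[OF G(2) Q_R[OF q] \<phi>g])
    finally show "q \<odot>\<^bsub>G'\<^esub> \<psi> g = q \<odot>\<^bsub>G'\<^esub> \<phi> g" .
  qed
  ultimately show ?thesis by blast
qed

text \<open>The extensions of \<open>\<phi>\<close> and of its inverse are inverse to each other,
  since their composites agree with the identity on invariants.\<close>

lemma iso_extends_from_invariants:
  assumes G: "left_module RR G" "left_module RR G'" and \<phi>: "\<phi> \<in> mod_hom OU (inv_mod G) (inv_mod G')"
    and bij: "bij_betw \<phi> (carrier (inv_mod G)) (carrier (inv_mod G'))"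
  shows "\<exists>\<psi>\<in>mod_hom RR G G'. bij_betw \<psi> (carrier G) (carrier G') \<and> (\<forall>g\<in>carrier (inv_mod G). \<psi> g = \<phi> g)"
proof -
  obtain \<psi> where \<psi>: "\<psi> \<in> mod_hom RR G G'" "\<And>g. g \<in> carrier (inv_mod G) \<Longrightarrow> \<psi> g = \<phi> g"
    using hom_extends_from_invariants[OF G \<phi>] by blast
  define \<phi>' where "\<phi>' = inv_into (carrier (inv_mod G)) \<phi>"
  have "\<phi>' \<in> mod_hom OU (inv_mod G') (inv_mod G)"
    unfolding \<phi>'_def using inv_add_inv[OF G(1)] inv_smult_inv[OF G(1)]
    by (intro mod_hom_inv_into[OF \<phi> bij]) (auto simp: inv_mod_simps(2))
  then obtain \<psi>' where \<psi>': "\<psi>' \<in> mod_hom RR G' G" "\<And>g. g \<in> carrier (inv_mod G') \<Longrightarrow> \<psi>' g = \<phi>' g"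
    using hom_extends_from_invariants[OF G(2,1)] by blast
  have id: "(\<lambda>x. x) \<in> mod_hom RR M M" for M :: "('g \<Rightarrow> rat, 'c) module" by (rule mod_homI) auto
  have \<phi>\<phi>': "\<phi>' (\<phi> g) = g" if "g \<in> carrier (inv_mod G)" for g
    using that bij by (simp add: \<phi>'_def bij_betw_def)
  have \<phi>'\<phi>: "\<phi> (\<phi>' g) = g" "\<phi>' g \<in> carrier (inv_mod G)" if "g \<in> carrier (inv_mod G')" for g
    using that bij by (auto simp: \<phi>'_def bij_betw_def f_inv_into_f inv_into_into)
  have 1: "\<psi>' (\<psi> g) = g" if "g \<in> carrier G" for g
    by (rule hom_eq_if_eq_on_invariants[OF G(1,1) mod_hom_comp[OF \<psi>(1) \<psi>'(1)] id _ that])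
      (use \<psi>(2) \<psi>'(2) \<phi>\<phi>' mod_homD(1)[OF \<phi>] in auto)
  have 2: "\<psi> (\<psi>' g) = g" if "g \<in> carrier G'" for g
    by (rule hom_eq_if_eq_on_invariants[OF G(2,2) mod_hom_comp[OF \<psi>'(1) \<psi>(1)] id _ that])
      (use \<psi>(2) \<psi>'(2) \<phi>'\<phi> in auto)
  have "bij_betw \<psi> (carrier G) (carrier G')"
    by (rule bij_betw_byWitness[of _ \<psi>'])
      (use 1 2 mod_homD(1)[OF \<psi>(1)] mod_homD(1)[OF \<psi>'(1)] in auto)
  then show ?thesis using \<psi> by blast
qed

lemma unique_module_with_invariants:
  assumes G: "left_module RR G" "left_module RR G'"
    and iso: "mod_isomorphic OU (inv_mod G) H" "mod_isomorphic OU (inv_mod G') H"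
  shows "mod_isomorphic RR G G'"
proof -
  obtain \<theta>' where \<theta>': "\<theta>' \<in> mod_hom OU (inv_mod G') H" "bij_betw \<theta>' (carrier (inv_mod G')) (carrier H)"
    using iso(2) by (auto simp: mod_isomorphic_def)
  have "inv_into (carrier (inv_mod G')) \<theta>' \<in> mod_hom OU H (inv_mod G')"
    using inv_add_inv[OF G(2)] inv_smult_inv[OF G(2)]
    by (intro mod_hom_inv_into[OF \<theta>']) (auto simp: inv_mod_simps(2))
  then have "mod_isomorphic OU H (inv_mod G')"
    unfolding mod_isomorphic_def by (rule bexI[rotated]) (rule bij_betw_inv_into[OF \<theta>'(2)])
  then have "mod_isomorphic OU (inv_mod G) (inv_mod G')"
    by (rule mod_isomorphic_trans[OF iso(1)])
  then show ?thesis
    unfolding mod_isomorphic_def using iso_extends_from_invariants[OF G] by blast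
qed

text \<open>The isomorphism restricts an automorphism to the invariants and conjugates it by
  \<open>\<theta>\<close>. Faithfulness gives injectivity, extension of isomorphisms gives
  surjectivity. The explicit \<open>restrict\<close> is there because members of \<open>Bij\<close>
  are extensional, which makes equality of automorphisms an equality of functions.\<close>

lemma mod_Aut_iso:
  assumes G: "left_module RR G" and H: "left_module OU H" and iso: "mod_isomorphic OU (inv_mod G) H"
  shows "mod_Aut RR G \<cong> mod_Aut OU H"
proof -
  obtain \<theta> where \<theta>: "\<theta> \<in> mod_hom OU (inv_mod G) H" and bij: "bij_betw \<theta> (carrier (inv_mod G)) (carrier H)"
    using iso by (auto simp: mod_isomorphic_def)
  define \<theta>' where "\<theta>' = inv_into (carrier (inv_mod G)) \<theta>"
  have \<theta>'_hom: "\<theta>' \<in> mod_hom OU H (inv_mod G)"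
    unfolding \<theta>'_def using inv_add_inv[OF G] inv_smult_inv[OF G]
    by (intro mod_hom_inv_into[OF \<theta> bij]) (auto simp: inv_mod_simps(2))
  have bij': "bij_betw \<theta>' (carrier H) (carrier (inv_mod G))"
    unfolding \<theta>'_def by (rule bij_betw_inv_into[OF bij])
  have \<theta>'\<theta>: "\<theta>' (\<theta> g) = g" if "g \<in> carrier (inv_mod G)" for g
    using that bij by (simp add: \<theta>'_def bij_betw_def)
  have \<theta>\<theta>': "\<theta> (\<theta>' h) = h" if "h \<in> carrier H" for h
    using that bij by (simp add: \<theta>'_def bij_betw_def f_inv_into_f)
  have inv_sub: "g \<in> carrier G" if "g \<in> carrier (inv_mod G)" for g
    using that by (simp add: inv_mod_simps)
  interpret MG: left_module RR G by (rule G)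
  interpret MH: left_module OU H by (rule H)
  define \<Psi> where "\<Psi> f = restrict (\<lambda>h. \<theta> (f (\<theta>' h))) (carrier H)" for f
  have \<theta>'_cl: "\<theta>' h \<in> carrier (inv_mod G)" if "h \<in> carrier H" for h
    by (rule mod_homD(1)[OF \<theta>'_hom that])
  have f_inv: "f g \<in> carrier (inv_mod G)" if "f \<in> mod_hom RR G G" "g \<in> carrier (inv_mod G)" for f g
    by (rule mod_homD(1)[OF mod_hom_inv_mod[OF G G that(1)] that(2)])
  have \<Psi>_hom: "\<Psi> f \<in> mod_hom OU H H" if "f \<in> mod_hom RR G G" for f
  proof (rule mod_hom_cong)
    show "(\<lambda>h. \<theta> (f (\<theta>' h))) \<in> mod_hom OU H H"
      by (rule mod_hom_comp[OF mod_hom_comp[OF \<theta>'_hom mod_hom_inv_mod[OF G G that]] \<theta>])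
  qed (auto simp: \<Psi>_def MH.smult_closed[simplified])
  have \<Psi>_bij: "bij_betw (\<Psi> f) (carrier H) (carrier H)"
    if "f \<in> mod_hom RR G G" "bij_betw f (carrier G) (carrier G)" for f
  proof -
    have "bij_betw (\<theta> \<circ> (f \<circ> \<theta>')) (carrier H) (carrier H)"
      by (rule bij_betw_trans[OF bij_betw_trans[OF bij' mod_iso_inv_mod[OF G G that]] bij])
    then show ?thesis by (subst bij_betw_cong[of _ _ "\<theta> \<circ> (f \<circ> \<theta>')"]) (auto simp: \<Psi>_def)
  qed
  have "\<Psi> \<in> iso (mod_Aut RR G) (mod_Aut OU H)"
    unfolding iso_def
  proof (intro CollectI conjI)
    have cl: "\<Psi> f \<in> carrier (mod_Aut OU H)" if "f \<in> carrier (mod_Aut RR G)" for f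
      using that \<Psi>_hom \<Psi>_bij by (auto simp: mod_Aut_def Bij_def \<Psi>_def)
    show "\<Psi> \<in> hom (mod_Aut RR G) (mod_Aut OU H)"
    proof (rule homI[OF cl])
      fix f k assume fk: "f \<in> carrier (mod_Aut RR G)" "k \<in> carrier (mod_Aut RR G)"
      then have k: "k \<in> mod_hom RR G G" and f: "f \<in> Bij (carrier G)" "k \<in> Bij (carrier G)" by (auto simp: mod_Aut_def)
      have fk': "\<Psi> f \<in> Bij (carrier H)" "\<Psi> k \<in> Bij (carrier H)" using cl fk by (auto simp: mod_Aut_def)
      have "f \<otimes>\<^bsub>mod_Aut RR G\<^esub> k = compose (carrier G) f k" using f by (simp add: mod_Aut_def BijGroup_def)
      moreover have "\<Psi> f \<otimes>\<^bsub>mod_Aut OU H\<^esub> \<Psi> k = compose (carrier H) (\<Psi> f) (\<Psi> k)"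
        using fk' by (simp add: mod_Aut_def BijGroup_def)
      moreover have "\<Psi> (compose (carrier G) f k) = compose (carrier H) (\<Psi> f) (\<Psi> k)"
      proof
        fix h
        show "\<Psi> (compose (carrier G) f k) h = compose (carrier H) (\<Psi> f) (\<Psi> k) h"
        proof (cases "h \<in> carrier H")
          case True
          have 1: "\<theta>' h \<in> carrier (inv_mod G)" "k (\<theta>' h) \<in> carrier (inv_mod G)"
            using \<theta>'_cl[OF True] f_inv[OF k] by auto
          have 2: "\<theta> (k (\<theta>' h)) \<in> carrier H" using mod_homD(1)[OF \<theta>] 1 by simp
          show ?thesis using True 1 2 inv_sub by (simp add: \<Psi>_def compose_def \<theta>'\<theta>)
        qed (simp add: \<Psi>_def compose_def)
      qed
      ultimately show "\<Psi> (f \<otimes>\<^bsub>mod_Aut RR G\<^esub> k) = \<Psi> f \<otimes>\<^bsub>mod_Aut OU H\<^esub> \<Psi> k" by simp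
    qed
    show "bij_betw \<Psi> (carrier (mod_Aut RR G)) (carrier (mod_Aut OU H))"
      unfolding bij_betw_def
    proof (intro conjI inj_onI equalityI subsetI)
      fix f k assume fk: "f \<in> carrier (mod_Aut RR G)" "k \<in> carrier (mod_Aut RR G)" "\<Psi> f = \<Psi> k"
      then have f: "f \<in> mod_hom RR G G" "f \<in> extensional (carrier G)"
        and k: "k \<in> mod_hom RR G G" "k \<in> extensional (carrier G)" by (auto simp: mod_Aut_def Bij_def)
      have "f g = k g" if g: "g \<in> carrier (inv_mod G)" for g
      proof -
        have \<theta>g: "\<theta> g \<in> carrier H" by (rule mod_homD(1)[OF \<theta> g])
        have "\<theta> (f g) = \<Psi> f (\<theta> g)" "\<theta> (k g) = \<Psi> k (\<theta> g)" using \<theta>g by (simp_all add: \<Psi>_def \<theta>'\<theta>[OF g])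
        then have "\<theta> (f g) = \<theta> (k g)" using fk(3) by simp
        then show ?thesis by (metis \<theta>'\<theta>[OF f_inv[OF f(1) g]] \<theta>'\<theta>[OF f_inv[OF k(1) g]])
      qed
      then have "f g = k g" if "g \<in> carrier G" for g
        using hom_eq_if_eq_on_invariants[OF G G f(1) k(1)] that by blast
      then show "f = k" using f(2) k(2) by (metis extensionalityI)
    next
      fix k assume "k \<in> \<Psi> ` carrier (mod_Aut RR G)"
      then show "k \<in> carrier (mod_Aut OU H)" using cl by blast
    next
      fix k assume "k \<in> carrier (mod_Aut OU H)"
      then have k: "k \<in> mod_hom OU H H" "k \<in> extensional (carrier H)" "bij_betw k (carrier H) (carrier H)"
        by (auto simp: mod_Aut_def Bij_def)
      define \<phi> where "\<phi> g = \<theta>' (k (\<theta> g))" for g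
      have "\<phi> \<in> mod_hom OU (inv_mod G) (inv_mod G)"
        unfolding \<phi>_def by (rule mod_hom_comp[OF mod_hom_comp[OF \<theta> k(1)] \<theta>'_hom])
      moreover have "bij_betw \<phi> (carrier (inv_mod G)) (carrier (inv_mod G))"
        using bij_betw_trans[OF bij_betw_trans[OF bij k(3)] bij'] by (simp add: \<phi>_def[abs_def] comp_def)
      ultimately obtain \<psi> where \<psi>: "\<psi> \<in> mod_hom RR G G" "bij_betw \<psi> (carrier G) (carrier G)"
        "\<And>g. g \<in> carrier (inv_mod G) \<Longrightarrow> \<psi> g = \<phi> g"
        using iso_extends_from_invariants[OF G G] by blast
      define f where "f = restrict \<psi> (carrier G)"
      have "f \<in> mod_hom RR G G"
        by (rule mod_hom_cong[OF \<psi>(1)]) (auto simp: f_def MG.smult_closed[simplified])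
      moreover have "bij_betw f (carrier G) (carrier G)"
        using \<psi>(2) by (subst bij_betw_cong[of _ _ \<psi>]) (auto simp: f_def)
      ultimately have "f \<in> carrier (mod_Aut RR G)" by (simp add: mod_Aut_def Bij_def f_def)
      moreover have "\<Psi> f = k"
      proof
        fix h show "\<Psi> f h = k h"
        proof (cases "h \<in> carrier H")
          case True
          then show ?thesis
            using \<theta>'_cl[OF True] inv_sub \<psi>(3) \<theta>\<theta>' mod_homD(1)[OF k(1)]
            by (simp add: \<Psi>_def f_def \<phi>_def)
        next
          case False
          then show ?thesis using k(2) by (simp add: \<Psi>_def extensional_def)
        qed
      qed
      ultimately show "k \<in> \<Psi> ` carrier (mod_Aut RR G)" by blast
    qed
  qed
  then show ?thesis by (auto simp: is_iso_def)
qed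

section \<open>Realizing modules over \<open>O_u\<close> as invariants\<close>

lemma Q_add: "x \<in> Q \<Longrightarrow> y \<in> Q \<Longrightarrow> x + y \<in> Q"
  by (rule add_closed_add[OF add_closed_Q])

text \<open>The module \<open>Hom\<^sub>O(Q, H)\<close>, which is isomorphic to \<open>P \<otimes>\<^sub>O H\<close>.\<close>

definition coinduced :: "('g \<Rightarrow> rat, 'h) module \<Rightarrow> ('g \<Rightarrow> rat, ('g \<Rightarrow> rat) \<Rightarrow> 'h) module" where
  "coinduced H = \<lparr>carrier = {\<eta> \<in> Q \<rightarrow>\<^sub>E carrier H.
       (\<forall>x\<in>Q. \<forall>y\<in>Q. \<eta> (x + y) = \<eta> x \<oplus>\<^bsub>H\<^esub> \<eta> y) \<and> (\<forall>z\<in>O_u. \<forall>x\<in>Q. \<eta> (z \<star> x) = z \<odot>\<^bsub>H\<^esub> \<eta> x)},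
     monoid.mult = undefined, monoid.one = undefined, ring.zero = restrict (\<lambda>_. \<zero>\<^bsub>H\<^esub>) Q,
     ring.add = (\<lambda>\<eta> \<zeta>. restrict (\<lambda>x. \<eta> x \<oplus>\<^bsub>H\<^esub> \<zeta> x) Q),
     module.smult = (\<lambda>r \<eta>. restrict (\<lambda>x. \<eta> (x \<star> r)) Q)\<rparr>"

context
  fixes H :: "('g \<Rightarrow> rat, 'h) module"
  assumes H: "left_module OU H"
begin

interpretation H: left_module OU H by (rule H)

lemmas H_smult_facts = H.smult_closed[simplified] H.smult_l_distr[simplified] H.smult_r_distr[simplified]
  H.smult_assoc[simplified] H.smult_one[simplified]

lemma coinducedD:
  assumes "\<eta> \<in> carrier (coinduced H)"
  shows "x \<in> Q \<Longrightarrow> \<eta> x \<in> carrier H" "x \<in> Q \<Longrightarrow> y \<in> Q \<Longrightarrow> \<eta> (x + y) = \<eta> x \<oplus>\<^bsub>H\<^esub> \<eta> y"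
    "z \<in> O_u \<Longrightarrow> x \<in> Q \<Longrightarrow> \<eta> (z \<star> x) = z \<odot>\<^bsub>H\<^esub> \<eta> x" "\<eta> \<in> extensional Q"
  using assms by (auto simp: coinduced_def PiE_def)

lemma coinducedI:
  assumes "\<And>x. x \<in> Q \<Longrightarrow> f x \<in> carrier H" "\<And>x y. x \<in> Q \<Longrightarrow> y \<in> Q \<Longrightarrow> f (x + y) = f x \<oplus>\<^bsub>H\<^esub> f y"
    "\<And>z x. z \<in> O_u \<Longrightarrow> x \<in> Q \<Longrightarrow> f (z \<star> x) = z \<odot>\<^bsub>H\<^esub> f x"
  shows "restrict f Q \<in> carrier (coinduced H)"
proof -
  have "restrict f Q (x + y) = restrict f Q x \<oplus>\<^bsub>H\<^esub> restrict f Q y" if "x \<in> Q" "y \<in> Q" for x y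
    using that Q_add[OF that] assms(2) by (simp only: restrict_apply' if_True)
  moreover have "restrict f Q (z \<star> x) = z \<odot>\<^bsub>H\<^esub> restrict f Q x" if "z \<in> O_u" "x \<in> Q" for x z
    using that mul_O_Q[OF that] assms(3) by simp
  ultimately show ?thesis using assms(1) by (simp add: coinduced_def)
qed

lemma coinduced_simps:
  "\<zero>\<^bsub>coinduced H\<^esub> = restrict (\<lambda>_. \<zero>\<^bsub>H\<^esub>) Q"
  "\<eta> \<oplus>\<^bsub>coinduced H\<^esub> \<zeta> = restrict (\<lambda>x. \<eta> x \<oplus>\<^bsub>H\<^esub> \<zeta> x) Q"
  "r \<odot>\<^bsub>coinduced H\<^esub> \<eta> = restrict (\<lambda>x. \<eta> (x \<star> r)) Q"
  by (simp_all add: coinduced_def)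

lemma coinduced_eqI:
  "\<eta> \<in> carrier (coinduced H) \<Longrightarrow> \<zeta> \<in> carrier (coinduced H) \<Longrightarrow> (\<And>x. x \<in> Q \<Longrightarrow> \<eta> x = \<zeta> x) \<Longrightarrow> \<eta> = \<zeta>"
  using coinducedD(4) by (metis extensionalityI)

lemma H_smult_zero: "z \<in> O_u \<Longrightarrow> z \<odot>\<^bsub>H\<^esub> \<zero>\<^bsub>H\<^esub> = \<zero>\<^bsub>H\<^esub>"
  by (rule additive_zero[OF H.abelian_group_axioms H.abelian_group_axioms])
    (use H_smult_facts in auto)

lemma coinduced_add: "\<eta> \<in> carrier (coinduced H) \<Longrightarrow> \<zeta> \<in> carrier (coinduced H) \<Longrightarrow>
    \<eta> \<oplus>\<^bsub>coinduced H\<^esub> \<zeta> \<in> carrier (coinduced H)"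
  unfolding coinduced_simps
  by (rule coinducedI) (simp_all add: coinducedD H.M.a_ac H_smult_facts(3))

lemma coinduced_smult: "r \<in> R \<Longrightarrow> \<eta> \<in> carrier (coinduced H) \<Longrightarrow> r \<odot>\<^bsub>coinduced H\<^esub> \<eta> \<in> carrier (coinduced H)"
  unfolding coinduced_simps
  by (rule coinducedI) (simp_all add: coinducedD mul_Q_R mul_add_left conv_assoc)

lemma left_module_coinduced: "left_module RR (coinduced H)"
proof (intro left_module.intro left_module_axioms.intro ring_RR abelian_groupI)
  have zero: "\<zero>\<^bsub>coinduced H\<^esub> \<in> carrier (coinduced H)"
    unfolding coinduced_simps by (rule coinducedI) (simp_all add: H_smult_zero)
  then show "\<zero>\<^bsub>coinduced H\<^esub> \<in> carrier (coinduced H)" .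
  fix \<eta> \<zeta> \<xi> assume \<eta>: "\<eta> \<in> carrier (coinduced H)"
  show "\<exists>\<eta>'\<in>carrier (coinduced H). \<eta>' \<oplus>\<^bsub>coinduced H\<^esub> \<eta> = \<zero>\<^bsub>coinduced H\<^esub>"
  proof (rule bexI)
    have mR: "- e \<in> R" by (rule add_closed_uminus[OF add_closed_R e_in_R])
    show m: "(- e) \<odot>\<^bsub>coinduced H\<^esub> \<eta> \<in> carrier (coinduced H)" by (rule coinduced_smult[OF mR \<eta>])
    have "\<eta> (x \<star> (- e)) \<oplus>\<^bsub>H\<^esub> \<eta> x = \<zero>\<^bsub>H\<^esub>" if x: "x \<in> Q" for x
    proof -
      have "\<eta> (x \<star> (- e) + x) = \<eta> (x \<star> (- e)) \<oplus>\<^bsub>H\<^esub> \<eta> x" by (rule coinducedD(2)[OF \<eta> mul_Q_R[OF x mR] x])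
      moreover have "x \<star> (- e) + x = 0" using e_right[OF Q_B[OF x]] by (simp add: mul_minus_right)
      moreover have "\<eta> 0 = \<zero>\<^bsub>H\<^esub>"
      proof -
        have 0: "(0 :: 'g \<Rightarrow> rat) \<in> Q" by (rule add_closed_zero[OF add_closed_Q])
        have "\<eta> 0 \<oplus>\<^bsub>H\<^esub> \<eta> 0 = \<eta> 0" using coinducedD(2)[OF \<eta> 0 0] by (simp only: add_0)
        then show ?thesis using coinducedD(1)[OF \<eta> 0] by (metis H.M.add.l_cancel_one)
      qed
      ultimately show ?thesis by (simp only:)
    qed
    then show "(- e) \<odot>\<^bsub>coinduced H\<^esub> \<eta> \<oplus>\<^bsub>coinduced H\<^esub> \<eta> = \<zero>\<^bsub>coinduced H\<^esub>"
      unfolding coinduced_simps by (intro restrict_ext) simp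
  qed
  show "\<zero>\<^bsub>coinduced H\<^esub> \<oplus>\<^bsub>coinduced H\<^esub> \<eta> = \<eta>"
    by (rule coinduced_eqI[OF coinduced_add[OF zero \<eta>] \<eta>]) (simp add: coinduced_simps coinducedD(1)[OF \<eta>])
  show "\<one>\<^bsub>RR\<^esub> \<odot>\<^bsub>coinduced H\<^esub> \<eta> = \<eta>"
    using coinduced_smult[OF e_in_R \<eta>] \<eta>
    by (intro coinduced_eqI) (simp_all add: coinduced_simps e_right Q_B)
  show "(a \<oplus>\<^bsub>RR\<^esub> b) \<odot>\<^bsub>coinduced H\<^esub> \<eta> = a \<odot>\<^bsub>coinduced H\<^esub> \<eta> \<oplus>\<^bsub>coinduced H\<^esub> b \<odot>\<^bsub>coinduced H\<^esub> \<eta>"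
    if "a \<in> carrier RR" "b \<in> carrier RR" for a b
    unfolding coinduced_simps using that
    by (intro restrict_ext) (simp add: mul_add_right coinducedD(2)[OF \<eta>] mul_Q_R)
  show "(a \<otimes>\<^bsub>RR\<^esub> b) \<odot>\<^bsub>coinduced H\<^esub> \<eta> = a \<odot>\<^bsub>coinduced H\<^esub> (b \<odot>\<^bsub>coinduced H\<^esub> \<eta>)"
    if "a \<in> carrier RR" "b \<in> carrier RR" for a b
    unfolding coinduced_simps using that by (intro restrict_ext) (simp add: mul_Q_R conv_assoc)
  assume \<zeta>: "\<zeta> \<in> carrier (coinduced H)"
  show "\<eta> \<oplus>\<^bsub>coinduced H\<^esub> \<zeta> = \<zeta> \<oplus>\<^bsub>coinduced H\<^esub> \<eta>"
    unfolding coinduced_simps by (intro restrict_ext) (simp add: coinducedD(1) \<eta> \<zeta> H.M.a_comm)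
  show "a \<odot>\<^bsub>coinduced H\<^esub> (\<eta> \<oplus>\<^bsub>coinduced H\<^esub> \<zeta>) = a \<odot>\<^bsub>coinduced H\<^esub> \<eta> \<oplus>\<^bsub>coinduced H\<^esub> a \<odot>\<^bsub>coinduced H\<^esub> \<zeta>"
    if "a \<in> carrier RR" for a
    unfolding coinduced_simps using that by (intro restrict_ext) (simp add: mul_Q_R)
  assume \<xi>: "\<xi> \<in> carrier (coinduced H)"
  show "\<eta> \<oplus>\<^bsub>coinduced H\<^esub> \<zeta> \<oplus>\<^bsub>coinduced H\<^esub> \<xi> = \<eta> \<oplus>\<^bsub>coinduced H\<^esub> (\<zeta> \<oplus>\<^bsub>coinduced H\<^esub> \<xi>)"
    unfolding coinduced_simps by (intro restrict_ext) (simp add: coinducedD(1) \<eta> \<zeta> \<xi> H.M.a_assoc)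
qed (simp_all add: coinduced_add coinduced_smult)

text \<open>From \<open>q = sum (q a_i) b_i\<close> with \<open>q a_i\<close> in \<open>O_u\<close>,
  an element of the coinduced module is determined by its values at the finitely many
  \<open>b_i\<close>.\<close>

lemma finite_coinduced:
  assumes "finite (carrier H)"
  shows "finite (carrier (coinduced H))"
proof -
  obtain n :: nat and a b where ab: "e = (\<Sum>i<n. a i \<star> b i)"
    "\<And>i. i < n \<Longrightarrow> a i \<in> P" "\<And>i. i < n \<Longrightarrow> b i \<in> Q"
    by (rule span_prod_sum_repr[OF e_span_PQ]) blast
  define v where "v \<eta> = restrict (\<lambda>i. \<eta> (b i)) {..<n}" for \<eta> :: "('g \<Rightarrow> rat) \<Rightarrow> 'h"
  have "inj_on v (carrier (coinduced H))"
  proof (rule inj_onI)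
    fix \<eta> \<zeta> assume \<eta>: "\<eta> \<in> carrier (coinduced H)" and \<zeta>: "\<zeta> \<in> carrier (coinduced H)" and eq: "v \<eta> = v \<zeta>"
    have eqb: "\<eta> (b i) = \<zeta> (b i)" if "i < n" for i
      using fun_cong[OF eq, of i] that by (simp add: v_def)
    show "\<eta> = \<zeta>"
    proof (rule coinduced_eqI[OF \<eta> \<zeta>])
      fix q assume q: "q \<in> Q"
      \<comment> \<open>Partial sums are followed together with their membership in
        \<open>Q\<close>, because \<open>\<eta>\<close> is additive only there.\<close>
      have "(\<Sum>i<m. (q \<star> a i) \<star> b i) \<in> Q \<and> \<eta> (\<Sum>i<m. (q \<star> a i) \<star> b i) = \<zeta> (\<Sum>i<m. (q \<star> a i) \<star> b i)"
        if "m \<le> n" for m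
        using that
      proof (induction m)
        case 0
        have "(0 :: 'g \<Rightarrow> rat) \<in> Q" by (rule add_closed_zero[OF add_closed_Q])
        moreover have "\<eta> 0 = \<zero>\<^bsub>H\<^esub>" if "\<eta> \<in> carrier (coinduced H)" for \<eta>
          using coinducedD(2)[OF that calculation calculation] coinducedD(1)[OF that calculation]
          by (metis H.M.add.l_cancel_one add_0)
        ultimately show ?case using \<eta> \<zeta> unfolding lessThan_0 sum.empty by metis
      next
        case (Suc m)
        have m: "m < n" using Suc by simp
        have qa: "q \<star> a m \<in> O_u" by (rule mul_Q_P[OF q ab(2)[OF m]])
        have t: "(q \<star> a m) \<star> b m \<in> Q" by (rule mul_O_Q[OF qa ab(3)[OF m]])
        have te: "\<eta> ((q \<star> a m) \<star> b m) = \<zeta> ((q \<star> a m) \<star> b m)"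
          using coinducedD(3)[OF \<eta> qa ab(3)[OF m]] coinducedD(3)[OF \<zeta> qa ab(3)[OF m]] eqb[OF m] by simp
        have IH: "(\<Sum>i<m. (q \<star> a i) \<star> b i) \<in> Q" "\<eta> (\<Sum>i<m. (q \<star> a i) \<star> b i) = \<zeta> (\<Sum>i<m. (q \<star> a i) \<star> b i)"
          using Suc by auto
        show ?case
          unfolding sum.lessThan_Suc
          using Q_add[OF IH(1) t] coinducedD(2)[OF \<eta> IH(1) t] coinducedD(2)[OF \<zeta> IH(1) t] IH(2) te
          by (simp only:)
      qed
      from this[OF order_refl] have "\<eta> (\<Sum>i<n. (q \<star> a i) \<star> b i) = \<zeta> (\<Sum>i<n. (q \<star> a i) \<star> b i)" by blast
      moreover have "(\<Sum>i<n. (q \<star> a i) \<star> b i) = q"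
        using e_right[OF Q_B[OF q]] by (simp add: ab(1) mul_sum_right conv_assoc)
      ultimately show "\<eta> q = \<zeta> q" by (simp only:)
    qed
  qed
  moreover have "v ` carrier (coinduced H) \<subseteq> {..<n} \<rightarrow>\<^sub>E carrier H"
    using coinducedD(1) ab(3) by (auto simp: v_def split: if_splits)
  moreover have "finite ({..<n} \<rightarrow>\<^sub>E carrier H)" using assms by (intro finite_PiE) auto
  ultimately show ?thesis by (meson finite_imageD finite_subset)
qed

text \<open>An invariant \<open>\<eta>\<close> satisfies
  \<open>\<eta> q = (q u) (\<eta> q0)\<close>. Hence evaluation at \<open>q0\<close> is bijective on
  invariants, with inverse sending \<open>h\<close> to the function
  \<open>q \<mapsto> (q u) h\<close>.\<close>

lemma coinduced_invariants: "mod_isomorphic OU (inv_mod (coinduced H)) H"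
proof -
  note C = left_module_coinduced
  obtain q0 where q0: "q0 \<in> Q" "q0 \<star> u = u" using q0_exists by blast
  have q0_left: "q0 \<star> x = x" if "u \<star> x = x" for x using q0(2) that by (metis conv_assoc)
  have cl: "\<eta> \<in> carrier (coinduced H)" if "\<eta> \<in> carrier (inv_mod (coinduced H))" for \<eta>
    using that by (simp add: inv_mod_simps)
  have qu: "q \<star> u \<in> O_u" if "q \<in> Q" for q by (rule mul_Q_P[OF that u_P])
  have repr: "\<eta> q = (q \<star> u) \<odot>\<^bsub>H\<^esub> \<eta> q0" if \<eta>: "\<eta> \<in> carrier (inv_mod (coinduced H))" and q: "q \<in> Q" for \<eta> q
  proof -
    \<comment> \<open>As \<open>d \<star> u = 0\<close>, \<open>d\<close> annihilates invariants.
      Evaluating \<open>d \<eta> = 0\<close> at \<open>q0\<close> gives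
      \<open>\<eta> (q0 \<star> d) = \<eta> d = 0\<close>, because \<open>q0\<close> is a left
      identity on \<open>Q\<close>.\<close>
    define d where "d = q - q \<star> q0"
    have qq0: "q \<star> q0 \<in> Q" by (rule mul_Q_R[OF q Q_R[OF q0(1)]])
    have d: "d \<in> Q" unfolding d_def by (rule add_closed_diff[OF add_closed_Q q qq0])
    have "d \<star> e1 = d \<star> u" using conv_u[OF Q_B[OF d]] by simp
    also have "\<dots> = 0" by (simp add: d_def mul_diff_left conv_assoc q0(2))
    finally have "d \<odot>\<^bsub>coinduced H\<^esub> \<eta> = \<zero>\<^bsub>coinduced H\<^esub>"
      by (rule annihilates_invariants[OF C Q_R[OF d] _ \<eta>])
    then have "(d \<odot>\<^bsub>coinduced H\<^esub> \<eta>) q0 = \<zero>\<^bsub>coinduced H\<^esub> q0" by (simp only:)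
    then have "\<eta> (q0 \<star> d) = \<zero>\<^bsub>H\<^esub>" using q0(1) by (simp add: coinduced_simps)
    then have "\<eta> d = \<zero>\<^bsub>H\<^esub>" using q0_left[OF Q_u[OF d]] by simp
    moreover have "\<eta> (d + q \<star> q0) = \<eta> d \<oplus>\<^bsub>H\<^esub> \<eta> (q \<star> q0)" by (rule coinducedD(2)[OF cl[OF \<eta>] d qq0])
    moreover have "d + q \<star> q0 = q" by (simp add: d_def)
    ultimately have "\<eta> q = \<eta> (q \<star> q0)" using coinducedD(1)[OF cl[OF \<eta>] qq0] by (simp only: H.M.l_zero)
    also have "q \<star> q0 = (q \<star> u) \<star> q0" using Q_u[OF q0(1)] by (simp add: conv_assoc)
    also have "\<eta> \<dots> = (q \<star> u) \<odot>\<^bsub>H\<^esub> \<eta> q0" by (rule coinducedD(3)[OF cl[OF \<eta>] qu[OF q] q0(1)])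
    finally show ?thesis .
  qed
  define \<theta> where "\<theta> \<eta> = \<eta> q0" for \<eta> :: "('g \<Rightarrow> rat) \<Rightarrow> 'h"
  define \<kappa> where "\<kappa> h = restrict (\<lambda>q. (q \<star> u) \<odot>\<^bsub>H\<^esub> h) Q" for h
  have \<kappa>_cl: "\<kappa> h \<in> carrier (coinduced H)" if h: "h \<in> carrier H" for h
    unfolding \<kappa>_def
    by (rule coinducedI)
      (simp_all add: mul_add_left conv_assoc H_smult_facts(1)[OF qu h] H_smult_facts(2)[OF qu qu h]
        H_smult_facts(4)[OF _ qu h])
  have \<kappa>_inv: "\<kappa> h \<in> carrier (inv_mod (coinduced H))" if h: "h \<in> carrier H" for h
  proof -
    have "(e \<star> grp_elt \<tau>) \<odot>\<^bsub>coinduced H\<^esub> \<kappa> h = \<kappa> h" if \<tau>: "\<tau> \<in> \<Gamma>'" for \<tau>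
    proof (rule coinduced_eqI[OF coinduced_smult[OF e_tau_R[OF \<tau>] \<kappa>_cl[OF h]] \<kappa>_cl[OF h]])
      fix q assume q: "q \<in> Q"
      have "(e \<star> grp_elt \<tau>) \<star> u = u"
      proof -
        have "(e \<star> grp_elt \<tau>) \<star> u = e \<star> (grp_elt \<tau> \<star> e) \<star> e1" by (simp add: u_def conv_assoc)
        also have "\<dots> = (e \<star> e) \<star> (grp_elt \<tau> \<star> e1)"
          by (simp add: e_central[OF grp_elt_A[OF \<Gamma>'_carrier[OF \<tau>]], symmetric] conv_assoc)
        finally show ?thesis by (simp add: e_idem grp_elt_e1[OF \<tau>] u_def)
      qed
      then show "((e \<star> grp_elt \<tau>) \<odot>\<^bsub>coinduced H\<^esub> \<kappa> h) q = \<kappa> h q"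
        using q mul_Q_R[OF q e_tau_R[OF \<tau>]] by (simp add: coinduced_simps \<kappa>_def) (simp add: conv_assoc)
    qed
    then show ?thesis using \<kappa>_cl[OF h] by (simp add: inv_mod_simps)
  qed
  have \<theta>\<kappa>: "\<theta> (\<kappa> h) = h" if "h \<in> carrier H" for h
    using q0 H_smult_facts(5)[OF that] by (simp add: \<theta>_def \<kappa>_def)
  have \<kappa>\<theta>: "\<kappa> (\<theta> \<eta>) = \<eta>" if \<eta>: "\<eta> \<in> carrier (inv_mod (coinduced H))" for \<eta>
    by (rule coinduced_eqI[OF \<kappa>_cl cl[OF \<eta>]])
      (use coinducedD(1)[OF cl[OF \<eta>] q0(1)] repr[OF \<eta>] in \<open>auto simp: \<theta>_def \<kappa>_def\<close>)
  have \<theta>_cl: "\<theta> \<eta> \<in> carrier H" if "\<eta> \<in> carrier (inv_mod (coinduced H))" for \<eta>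
    using coinducedD(1)[OF cl[OF that] q0(1)] by (simp add: \<theta>_def)
  have "\<theta> \<in> mod_hom OU (inv_mod (coinduced H)) H"
  proof (rule mod_homI)
    show "\<theta> \<eta> \<in> carrier H" if "\<eta> \<in> carrier (inv_mod (coinduced H))" for \<eta> by (rule \<theta>_cl[OF that])
    show "\<theta> (\<eta> \<oplus>\<^bsub>inv_mod (coinduced H)\<^esub> \<zeta>) = \<theta> \<eta> \<oplus>\<^bsub>H\<^esub> \<theta> \<zeta>" for \<eta> \<zeta>
      using q0(1) by (simp add: \<theta>_def inv_mod_simps coinduced_simps)
    show "\<theta> (z \<odot>\<^bsub>inv_mod (coinduced H)\<^esub> \<eta>) = z \<odot>\<^bsub>H\<^esub> \<theta> \<eta>"
      if z: "z \<in> carrier OU" and \<eta>: "\<eta> \<in> carrier (inv_mod (coinduced H))" for z \<eta>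
    proof -
      have zO: "z \<in> O_u" using z by simp
      obtain r where r: "z = r \<star> u" "r \<in> R" using zO by (auto simp: O_u_def P_def)
      have q0r: "q0 \<star> r \<in> Q" by (rule mul_Q_R[OF q0(1) r(2)])
      have "\<theta> (z \<odot>\<^bsub>inv_mod (coinduced H)\<^esub> \<eta>) = \<eta> (q0 \<star> r)"
        unfolding r(1) inv_smult[OF C r(2) \<eta>] using q0(1) by (simp add: \<theta>_def coinduced_simps)
      also have "\<dots> = (q0 \<star> r \<star> u) \<odot>\<^bsub>H\<^esub> \<eta> q0" by (rule repr[OF \<eta> q0r])
      also have "q0 \<star> r \<star> u = z" using q0_left[OF O_u_left[OF zO]] r(1) by (simp add: conv_assoc)
      finally show ?thesis by (simp add: \<theta>_def)
    qed
  qed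
  moreover have "bij_betw \<theta> (carrier (inv_mod (coinduced H))) (carrier H)"
    by (rule bij_betw_byWitness[of _ \<kappa>]) (use \<theta>\<kappa> \<kappa>\<theta> \<theta>_cl \<kappa>_inv in auto)
  ultimately show ?thesis by (auto simp: mod_isomorphic_def)
qed

text \<open>The coinduced module consists of functions into \<open>'h\<close>. Being finite, it can
  be renumbered by elements of \<open>nat\<close>, a type independent of \<open>H\<close>.\<close>

lemma finite_nat_module_with_invariants:
  assumes "finite (carrier H)"
  shows "\<exists>G :: ('g \<Rightarrow> rat, nat) module. left_module RR G \<and> finite (carrier G) \<and>
    mod_isomorphic OU (inv_mod G) H"
proof -
  let ?C = "coinduced H"
  have fin: "finite (carrier ?C)" by (rule finite_coinduced[OF assms])
  obtain b :: "(('g \<Rightarrow> rat) \<Rightarrow> 'h) \<Rightarrow> nat" where b: "inj_on b (carrier ?C)"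
    using finite_imp_inj_to_nat_seg[OF fin] by blast
  obtain G :: "('g \<Rightarrow> rat, nat) module" where G: "left_module RR G" "carrier G = b ` carrier ?C"
    "b \<in> mod_hom RR ?C G"
    using left_module_transfer[OF left_module_coinduced b] by blast
  have bij: "bij_betw b (carrier ?C) (carrier G)" using b G(2) by (simp add: bij_betw_def)
  note hom = mod_hom_inv_mod[OF left_module_coinduced G(1,3)]
  note bij' = mod_iso_inv_mod[OF left_module_coinduced G(1,3) bij]
  have "inv_into (carrier (inv_mod ?C)) b \<in> mod_hom OU (inv_mod G) (inv_mod ?C)"
    using inv_add_inv[OF left_module_coinduced] inv_smult_inv[OF left_module_coinduced]
    by (intro mod_hom_inv_into[OF hom bij']) (auto simp: inv_mod_simps(2))
  then have "mod_isomorphic OU (inv_mod G) (inv_mod ?C)"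
    unfolding mod_isomorphic_def by (rule bexI[rotated]) (rule bij_betw_inv_into[OF bij'])
  then have "mod_isomorphic OU (inv_mod G) H"
    by (rule mod_isomorphic_trans) (rule coinduced_invariants)
  then show ?thesis using G fin by auto
qed

end

end

text \<open>Existence is witnessed on natural numbers, since every finite module has a copy there;
  uniqueness and the comparison of automorphism groups hold for modules over arbitrary element
  types.\<close>

theorem theorem1p5:
  fixes \<Gamma> :: "('g, 'm) monoid_scheme" and \<Gamma>' :: "'g set" and p :: nat
    and H :: "('g \<Rightarrow> rat, 'h) module"
  assumes "group \<Gamma>" and "finite (carrier \<Gamma>)" and "subgroup \<Gamma>' \<Gamma>"
    and "prime p" and "good_prime \<Gamma> p (aug_idem \<Gamma> \<Gamma>')"
    and "left_module (inv_order \<Gamma> \<Gamma>' p) H"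
    and "finite (carrier H)" and "\<exists>k. card (carrier H) = p ^ k"
  shows "(\<exists>G :: ('g \<Rightarrow> rat, nat) module. finite_module_with_invariants \<Gamma> \<Gamma>' p H G) \<and>
    (\<forall>(G1 :: ('g \<Rightarrow> rat, 'a) module) (G2 :: ('g \<Rightarrow> rat, 'b) module).
       finite_module_with_invariants \<Gamma> \<Gamma>' p H G1 \<and> finite_module_with_invariants \<Gamma> \<Gamma>' p H G2 \<longrightarrow>
       mod_isomorphic (aug_loc_ring \<Gamma> \<Gamma>' p) G1 G2) \<and>
    (\<forall>G :: ('g \<Rightarrow> rat, 'a) module. finite_module_with_invariants \<Gamma> \<Gamma>' p H G \<longrightarrow>
       mod_Aut (aug_loc_ring \<Gamma> \<Gamma>' p) G \<cong> mod_Aut (inv_order \<Gamma> \<Gamma>' p) H)"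
proof -
  interpret good_prime_setup \<Gamma> \<Gamma>' p
    using assms(1-5)
    by (intro good_prime_setup.intro finite_group_subgroup.intro finite_group.intro
      finite_group_axioms.intro finite_group_subgroup_axioms.intro Z_local.intro good_prime_setup_axioms.intro)
  have H: "left_module OU H" using assms(6) by (simp add: inv_order_eq)
  show ?thesis
    unfolding finite_module_with_invariants_def aug_loc_ring_eq inv_order_eq
    using finite_nat_module_with_invariants[OF H assms(7)] unique_module_with_invariants mod_Aut_iso[OF _ H]
    by blast
qed

end
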